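(* Let $\kappa$ be any well-ordered infinite cardinal. There is a model of $\mathrm{ZFU}_{\mathrm R}$ + RP + $\mathrm{DC}_\kappa$-scheme in which Hume's Principle does not hold for sets. In fact, in this model no parametrically definable map fulfills Hume's Principle.
   Context: The language of urelement set theory has $\in$ and a unary predicate $\mathscr{A}$ for urelements; a set is an object that is not a urelement. $\mathrm{ZFU}_{\mathrm R}$ has the axioms: urelements have no members; Extensionality for sets (sets with the same members are equal); Foundation; Pairing; Union; Powerset; Infinity; the Separation schema; the Replacement schema. The urelements may form a proper class. Ordinals are transitive pure sets (pure: no urelements in the transitive closure) well-ordered by $\in$; a well-ordered cardinal is an initial ordinal. $U$ denotes the class of all objects. RP is the schema: for every formula $\varphi(x_1,\dots,x_n)$ and every set $x$ there is a transitive set $t$ with $x\subseteq t$ such that for all $x_1,\dots,x_n\in t$, $\varphi(x_1,\dots,x_n)\leftrightarrow\varphi^t(x_1,\dots,x_n)$, where $\varphi^t$ is the relativization of $\varphi$ to $t$. The $\mathrm{DC}_\kappa$-scheme is the schema: for every formula $\varphi$ and parameter $u$, if for every $x$ there is some $y$ with $\varphi(x,y,u)$, then there is a function $f:\kappa\to U$ such that $\varphi(f\restriction\alpha,f(\alpha),u)$ for every $\alpha<\kappa$. A map $x\mapsto\#x$ from sets to first-order objects (sets or urelements) fulfills Hume's Principle if for all sets $x,y$: $x\sim y$ if and only if $\#x=\#y$, where $x\sim y$ means that $x$ and $y$ are equinumerous, i.e. there is (in the model) a bijection between them. Hume's Principle holds for sets when a map fulfilling Hume's Principle exists. A map is parametrically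 definable in a model if its graph is defined there by a formula $\varphi(x,y,u)$ of the language of urelement set theory with some object $u$ of the model as parameter. *)

theory Defs
  imports Main
begin

section \<open>Structures for the language of urelement set theory\<close>

text \<open>Only the behaviour of \<open>mem\<close> and \<open>ure\<close> on \<open>univ\<close> matters.\<close>

record 'a ustruct =
  univ :: "'a set"
  mem :: "'a \<Rightarrow> 'a \<Rightarrow> bool"
  ure :: "'a \<Rightarrow> bool"

datatype fm =
    MemF nat nat
  | UreF nat
  | EqF nat nat
  | NegF fm
  | ConjF fm fm
  | AllF nat fm

primrec fv :: "fm \<Rightarrow> nat set" where
  "fv (MemF i j) = {i, j}"
| "fv (UreF i) = {i}"
| "fv (EqF i j) = {i, j}"
| "fv (NegF p) = fv p"
| "fv (ConjF p q) = fv p \<union> fv q"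
| "fv (AllF i p) = fv p - {i}"

text \<open>
  The quantifiers range over \<open>D\<close>. With \<open>D = univ M\<close> this is satisfaction in \<open>M\<close>; with \<open>D\<close> the
  collection of members of an object \<open>t\<close> it is satisfaction in \<open>M\<close> of the relativization of
  the formula to \<open>t\<close>.
\<close>

primrec sat_on :: "'a ustruct \<Rightarrow> 'a set \<Rightarrow> (nat \<Rightarrow> 'a) \<Rightarrow> fm \<Rightarrow> bool" where
  "sat_on M D s (MemF i j) \<longleftrightarrow> mem M (s i) (s j)"
| "sat_on M D s (UreF i) \<longleftrightarrow> ure M (s i)"
| "sat_on M D s (EqF i j) \<longleftrightarrow> s i = s j"
| "sat_on M D s (NegF p) \<longleftrightarrow> \<not> sat_on M D s p"
| "sat_on M D s (ConjF p q) \<longleftrightarrow> sat_on M D s p \<and> sat_on M D s q"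
| "sat_on M D s (AllF i p) \<longleftrightarrow> (\<forall>a\<in>D. sat_on M D (s(i := a)) p)"

abbreviation sat :: "'a ustruct \<Rightarrow> (nat \<Rightarrow> 'a) \<Rightarrow> fm \<Rightarrow> bool" where
  "sat M \<equiv> sat_on M (univ M)"

text \<open>
  The assignment used to evaluate a formula \<open>\<phi>(x, y, u)\<close>: variable 0 is \<open>x\<close>, variable 1 is \<open>y\<close>,
  and every other variable is the parameter \<open>u\<close>, so that no restriction on the free variables of
  the formula is needed.
\<close>

definition asg :: "'a \<Rightarrow> 'a \<Rightarrow> 'a \<Rightarrow> nat \<Rightarrow> 'a" where
  "asg x y u = (\<lambda>_. u)(0 := x, 1 := y)"


section \<open>Basic set-theoretic notions inside a structure\<close>

definition elts :: "'a ustruct \<Rightarrow> 'a \<Rightarrow> 'a set" where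
  "elts M x = {y \<in> univ M. mem M y x}"

definition is_set :: "'a ustruct \<Rightarrow> 'a \<Rightarrow> bool" where
  "is_set M x \<longleftrightarrow> x \<in> univ M \<and> \<not> ure M x"

definition is_upair :: "'a ustruct \<Rightarrow> 'a \<Rightarrow> 'a \<Rightarrow> 'a \<Rightarrow> bool" where
  "is_upair M a b z \<longleftrightarrow> is_set M z \<and> elts M z = {a, b}"

definition is_opair :: "'a ustruct \<Rightarrow> 'a \<Rightarrow> 'a \<Rightarrow> 'a \<Rightarrow> bool" where
  "is_opair M a b p \<longleftrightarrow> (\<exists>v w. is_upair M a a v \<and> is_upair M a b w \<and> is_upair M v w p)"

definition pair_in :: "'a ustruct \<Rightarrow> 'a \<Rightarrow> 'a \<Rightarrow> 'a \<Rightarrow> bool" where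
  "pair_in M a b f \<longleftrightarrow> (\<exists>p\<in>elts M f. is_opair M a b p)"

text \<open>\<open>f\<close> is, in \<open>M\<close>, a function with domain the set \<open>x\<close> and arbitrary objects as values.\<close>

definition is_fun :: "'a ustruct \<Rightarrow> 'a \<Rightarrow> 'a \<Rightarrow> bool" where
  "is_fun M f x \<longleftrightarrow> is_set M f \<and>
     (\<forall>p\<in>elts M f. \<exists>a\<in>elts M x. \<exists>b\<in>univ M. is_opair M a b p) \<and>
     (\<forall>a\<in>elts M x. \<exists>!b. b \<in> univ M \<and> pair_in M a b f)"

definition is_bij :: "'a ustruct \<Rightarrow> 'a \<Rightarrow> 'a \<Rightarrow> 'a \<Rightarrow> bool" where
  "is_bij M f x y \<longleftrightarrow> is_fun M f x \<and>
     (\<forall>a\<in>elts M x. \<forall>b\<in>univ M. pair_in M a b f \<longrightarrow> b \<in> elts M y) \<and>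
     (\<forall>b\<in>elts M y. \<exists>!a. a \<in> elts M x \<and> pair_in M a b f)"

definition equinum :: "'a ustruct \<Rightarrow> 'a \<Rightarrow> 'a \<Rightarrow> bool" where
  "equinum M x y \<longleftrightarrow> (\<exists>f. is_bij M f x y)"

definition is_restr :: "'a ustruct \<Rightarrow> 'a \<Rightarrow> 'a \<Rightarrow> 'a \<Rightarrow> bool" where
  "is_restr M f x g \<longleftrightarrow> is_set M g \<and>
     elts M g = {p \<in> elts M f. \<exists>a\<in>elts M x. \<exists>b\<in>univ M. is_opair M a b p}"

definition trans_set :: "'a ustruct \<Rightarrow> 'a \<Rightarrow> bool" where
  "trans_set M x \<longleftrightarrow> is_set M x \<and> (\<forall>y\<in>elts M x. elts M y \<subseteq> elts M x)"

definition is_trcl :: "'a ustruct \<Rightarrow> 'a \<Rightarrow> 'a \<Rightarrow> bool" where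
  "is_trcl M x c \<longleftrightarrow> trans_set M c \<and> elts M x \<subseteq> elts M c \<and>
     (\<forall>d. trans_set M d \<and> elts M x \<subseteq> elts M d \<longrightarrow> elts M c \<subseteq> elts M d)"

definition pure :: "'a ustruct \<Rightarrow> 'a \<Rightarrow> bool" where
  "pure M x \<longleftrightarrow> is_set M x \<and> (\<exists>c. is_trcl M x c \<and> (\<forall>y\<in>elts M c. \<not> ure M y))"

definition wellordered_by_mem :: "'a ustruct \<Rightarrow> 'a \<Rightarrow> bool" where
  "wellordered_by_mem M x \<longleftrightarrow>
     (\<forall>a\<in>elts M x. \<not> mem M a a) \<and>
     (\<forall>a\<in>elts M x. \<forall>b\<in>elts M x. \<forall>c\<in>elts M x. mem M a b \<and> mem M b c \<longrightarrow> mem M a c) \<and>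
     (\<forall>a\<in>elts M x. \<forall>b\<in>elts M x. mem M a b \<or> a = b \<or> mem M b a) \<and>
     (\<forall>y. is_set M y \<and> elts M y \<subseteq> elts M x \<and> elts M y \<noteq> {} \<longrightarrow>
        (\<exists>m\<in>elts M y. \<forall>z\<in>elts M y. m = z \<or> mem M m z))"

definition ordinal :: "'a ustruct \<Rightarrow> 'a \<Rightarrow> bool" where
  "ordinal M x \<longleftrightarrow> trans_set M x \<and> pure M x \<and> wellordered_by_mem M x"

definition zero_or_succ :: "'a ustruct \<Rightarrow> 'a \<Rightarrow> bool" where
  "zero_or_succ M x \<longleftrightarrow> elts M x = {} \<or> (\<exists>y\<in>elts M x. elts M x = insert y (elts M y))"

definition natural :: "'a ustruct \<Rightarrow> 'a \<Rightarrow> bool" where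
  "natural M n \<longleftrightarrow> ordinal M n \<and> zero_or_succ M n \<and> (\<forall>m\<in>elts M n. zero_or_succ M m)"

definition infinite_cardinal :: "'a ustruct \<Rightarrow> 'a \<Rightarrow> bool" where
  "infinite_cardinal M k \<longleftrightarrow> ordinal M k \<and> (\<forall>b\<in>elts M k. \<not> equinum M b k) \<and>
     \<not> (\<exists>n. natural M n \<and> equinum M k n)"


section \<open>Axioms and schemata\<close>

text \<open>
  Each axiom is the condition that its satisfaction in \<open>M\<close> unfolds to; the schemata quantify
  over the formulas \<open>fm\<close>, with arbitrary parameters from \<open>M\<close> supplied by the assignment.
\<close>

definition ax_urelements :: "'a ustruct \<Rightarrow> bool" where
  "ax_urelements M \<longleftrightarrow> (\<forall>x\<in>univ M. ure M x \<longrightarrow> elts M x = {})"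

definition ax_extensionality :: "'a ustruct \<Rightarrow> bool" where
  "ax_extensionality M \<longleftrightarrow>
     (\<forall>x y. is_set M x \<and> is_set M y \<and> elts M x = elts M y \<longrightarrow> x = y)"

definition ax_foundation :: "'a ustruct \<Rightarrow> bool" where
  "ax_foundation M \<longleftrightarrow>
     (\<forall>x. is_set M x \<and> elts M x \<noteq> {} \<longrightarrow> (\<exists>y\<in>elts M x. elts M y \<inter> elts M x = {}))"

definition ax_pairing :: "'a ustruct \<Rightarrow> bool" where
  "ax_pairing M \<longleftrightarrow> (\<forall>a\<in>univ M. \<forall>b\<in>univ M. \<exists>z. is_upair M a b z)"

definition ax_union :: "'a ustruct \<Rightarrow> bool" where
  "ax_union M \<longleftrightarrow>
     (\<forall>x. is_set M x \<longrightarrow> (\<exists>y. is_set M y \<and> elts M y = (\<Union>z\<in>elts M x. elts M z)))"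

definition ax_powerset :: "'a ustruct \<Rightarrow> bool" where
  "ax_powerset M \<longleftrightarrow>
     (\<forall>x. is_set M x \<longrightarrow>
        (\<exists>y. is_set M y \<and> elts M y = {z. is_set M z \<and> elts M z \<subseteq> elts M x}))"

definition ax_infinity :: "'a ustruct \<Rightarrow> bool" where
  "ax_infinity M \<longleftrightarrow>
     (\<exists>w. is_set M w \<and> (\<exists>e\<in>elts M w. is_set M e \<and> elts M e = {}) \<and>
        (\<forall>x\<in>elts M w. \<exists>y\<in>elts M w. is_set M y \<and> elts M y = insert x (elts M x)))"

definition ax_separation :: "'a ustruct \<Rightarrow> bool" where
  "ax_separation M \<longleftrightarrow>
     (\<forall>\<phi> s x. range s \<subseteq> univ M \<and> is_set M x \<longrightarrow>
        (\<exists>y. is_set M y \<and> elts M y = {z \<in> elts M x. sat M (s(0 := z)) \<phi>}))"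

definition ax_replacement :: "'a ustruct \<Rightarrow> bool" where
  "ax_replacement M \<longleftrightarrow>
     (\<forall>\<phi> s x. range s \<subseteq> univ M \<and> is_set M x \<and>
        (\<forall>a\<in>elts M x. \<exists>!b. b \<in> univ M \<and> sat M (s(0 := a, 1 := b)) \<phi>) \<longrightarrow>
        (\<exists>y. is_set M y \<and>
           elts M y = {b \<in> univ M. \<exists>a\<in>elts M x. sat M (s(0 := a, 1 := b)) \<phi>}))"

definition ZFU_R :: "'a ustruct \<Rightarrow> bool" where
  "ZFU_R M \<longleftrightarrow> ax_urelements M \<and> ax_extensionality M \<and> ax_foundation M \<and> ax_pairing M \<and>
     ax_union M \<and> ax_powerset M \<and> ax_infinity M \<and> ax_separation M \<and> ax_replacement M"

definition ax_choice :: "'a ustruct \<Rightarrow> bool" where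
  "ax_choice M \<longleftrightarrow>
     (\<forall>x. is_set M x \<and> (\<forall>y\<in>elts M x. is_set M y \<and> elts M y \<noteq> {}) \<and>
        (\<forall>y\<in>elts M x. \<forall>z\<in>elts M x. y \<noteq> z \<longrightarrow> elts M y \<inter> elts M z = {}) \<longrightarrow>
        (\<exists>c. is_set M c \<and> (\<forall>y\<in>elts M x. \<exists>!a. a \<in> elts M y \<and> a \<in> elts M c)))"

text \<open>In the absence of urelements, \<open>ZFU_R\<close> is ZF.\<close>

definition ZFC :: "'a ustruct \<Rightarrow> bool" where
  "ZFC M \<longleftrightarrow> ZFU_R M \<and> (\<forall>x\<in>univ M. \<not> ure M x) \<and> ax_choice M"

text \<open>
  Only the values of the free variables are required to lie in \<open>t\<close>; demanding it of the whole
  assignment would let the empty set vacuously reflect every sentence.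
\<close>

definition RP :: "'a ustruct \<Rightarrow> bool" where
  "RP M \<longleftrightarrow>
     (\<forall>\<phi> x. is_set M x \<longrightarrow>
        (\<exists>t. trans_set M t \<and> elts M x \<subseteq> elts M t \<and>
           (\<forall>s. (\<forall>i\<in>fv \<phi>. s i \<in> elts M t) \<longrightarrow>
              (sat M s \<phi> \<longleftrightarrow> sat_on M (elts M t) s \<phi>))))"

definition DC_scheme :: "'a ustruct \<Rightarrow> 'a \<Rightarrow> bool" where
  "DC_scheme M k \<longleftrightarrow>
     (\<forall>\<phi>. \<forall>u\<in>univ M. (\<forall>x\<in>univ M. \<exists>y\<in>univ M. sat M (asg x y u) \<phi>) \<longrightarrow>
        (\<exists>f. is_fun M f k \<and>
           (\<forall>\<alpha>\<in>elts M k. \<exists>g. \<exists>v\<in>univ M.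
              is_restr M f \<alpha> g \<and> pair_in M \<alpha> v f \<and> sat M (asg g v u) \<phi>)))"


section \<open>Hume's Principle\<close>

text \<open>Only the values of \<open>F\<close> on the sets of \<open>M\<close> matter.\<close>

definition fulfills_Hume :: "'a ustruct \<Rightarrow> ('a \<Rightarrow> 'a) \<Rightarrow> bool" where
  "fulfills_Hume M F \<longleftrightarrow>
     (\<forall>x. is_set M x \<longrightarrow> F x \<in> univ M) \<and>
     (\<forall>x y. is_set M x \<and> is_set M y \<longrightarrow> (equinum M x y \<longleftrightarrow> F x = F y))"

definition param_definable :: "'a ustruct \<Rightarrow> ('a \<Rightarrow> 'a) \<Rightarrow> bool" where
  "param_definable M F \<longleftrightarrow>
     (\<exists>\<phi>. \<exists>u\<in>univ M. \<forall>x\<in>univ M. \<forall>y\<in>univ M.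
        sat M (asg x y u) \<phi> \<longleftrightarrow> is_set M x \<and> y = F x)"

text \<open>
  The map is a class of \<open>M\<close>, i.e. a parametrically definable one. Without this restriction the
  principle would hold in every structure, by choosing in the metatheory a representative of each
  equinumerosity class.
\<close>

definition Hume_holds_for_sets :: "'a ustruct \<Rightarrow> bool" where
  "Hume_holds_for_sets M \<longleftrightarrow> (\<exists>F. param_definable M F \<and> fulfills_Hume M F)"


section \<open>Comparing a ground model with a model with urelements\<close>

text \<open>
  \<open>j\<close> identifies \<open>M\<close> with a transitive class of sets of \<open>N\<close>: the members of \<open>j x\<close> in \<open>N\<close> are
  exactly the images of the members of \<open>x\<close> in \<open>M\<close>. This is what makes an ordinal of \<open>M\<close> and
  its image the same ordinal.
\<close>

definition transitive_embedding :: "'a ustruct \<Rightarrow> 'b ustruct \<Rightarrow> ('a \<Rightarrow> 'b) \<Rightarrow> bool" where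
  "transitive_embedding M N j \<longleftrightarrow> inj_on j (univ M) \<and>
     (\<forall>x\<in>univ M. is_set N (j x) \<and> elts N (j x) = j ` elts M x)"

end

theory Submission
  imports Defs
begin

text \<open>
  The model \<open>N\<close> is a permutation model built inside \<open>M\<close>. Its urelements include all ordered pairs
  \<open>(p, r)\<close> of \<open>M\<close>; the flip at the index \<open>p\<close> adds \<open>\<emptyset>\<close> to the second component \<open>r\<close> of every pair
  \<open>(p, r)\<close>, or removes it. \<open>N\<close> consists of the objects that are hereditarily fixed by all flips
  outside a small set of indices, where the small sets are closed under \<open>\<kappa>\<close>-indexed unions; hence
  dependent choice.

  Call \<open>i\<close> the colour of the index \<open>(i, n)\<close>, let \<open>n\<close> range over a set that is not small, and let
  \<open>A\<^sub>i\<close> be the set of all \<open>((i, n), \<emptyset>)\<close> and \<open>((i, n), {\<emptyset>})\<close>. A bijection between \<open>A\<^sub>i\<close> and \<open>A\<^sub>k\<close> with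
  \<open>i \<noteq> k\<close> is destroyed by a flip of colour \<open>i\<close> outside its support. On the other hand, the shift that
  adds or removes \<open>T\<close> in the second components of colour \<open>i\<close> commutes with the flips, so \<open>A\<^sub>i\<close> is
  equinumerous with its image under it.

  Suppose that \<open>F\<close>, definable from \<open>u\<close>, fulfils Hume's Principle. Take \<open>i\<close> outside the transitive
  closure of \<open>u\<close> and put \<open>y = F A\<^sub>i\<close>. All shifts of colour \<open>i\<close> fix \<open>u\<close> and hence \<open>y\<close>; since a suitable
  one moves every urelement of colour \<open>i\<close> out of a given transitive set, \<open>y\<close> involves none of them.
  So exchanging \<open>i\<close> with a new colour \<open>k\<close> fixes \<open>u\<close> and \<open>y\<close>, and \<open>F A\<^sub>i = F A\<^sub>k\<close>, a contradiction.
\<close>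

section \<open>Definable classes\<close>

text \<open>\<open>M\<close> is an arbitrary structure satisfying ZFC and may be ill-founded, so HOL
  recursion and induction do not carry over to its objects. Every class used below has to be
  definable in \<open>M\<close> with parameters; this is why iteration, recursion on membership,
  rank, collection and choice are rebuilt inside \<open>M\<close>. In return \<open>N\<close> is a
  definable class of \<open>M\<close>, and the truth in \<open>N\<close> of a fixed formula is
  definable in \<open>M\<close>, which feeds Separation, Replacement, dependent choice and
  reflection.

  The second components of the pairs range over all of \<open>M\<close> for the sake of the shifts.
  With two components per index the urelements of one colour would form a set, and nothing would
  keep a value of \<open>F\<close> from involving them. With arbitrary components an element outside
  any given set is available for toggling. Flips and shifts both toggle one element of a component,
  hence commute. All permutations are involutions, so no separate inverses appear.

  Choice in \<open>M\<close> is what allows supports to be picked for all terms of a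
  \<kappa>-sequence at once.\<close>

lemma sat_on_fv:
  "(\<And>i. i \<in> fv \<phi> \<Longrightarrow> s i = s' i) \<Longrightarrow> sat_on M D s \<phi> \<longleftrightarrow> sat_on M D s' \<phi>"
proof (induction \<phi> arbitrary: s s')
  case (AllF i p)
  have "sat_on M D (s(i := a)) p \<longleftrightarrow> sat_on M D (s'(i := a)) p" for a
    by (rule AllF.IH) (use AllF.prems in auto)
  then show ?case by simp
next
  case (ConjF p q)
  show ?case using ConjF.IH(1)[of s s'] ConjF.IH(2)[of s s'] ConjF.prems by simp
next
  case (NegF p)
  show ?case using NegF.IH[of s s'] NegF.prems by simp
qed simp_all

lemma finite_fv: "finite (fv \<phi>)"
  by (induction \<phi>) auto

text \<open>As \<open>r\<close> may identify variables, a bound variable cannot keep its index; it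
  moves to an \<open>m\<close> outside the image of the free variables, which avoids capture. The
  lemma links named variables with stacks and slots.\<close>

lemma rename_fm: "\<exists>\<psi>. \<forall>s. sat_on M D s \<psi> \<longleftrightarrow> sat_on M D (\<lambda>k. s (r k)) \<phi>"
proof (induction \<phi> arbitrary: r)
  case (MemF i j)
  then show ?case by (intro exI[of _ "MemF (r i) (r j)"]) simp
next
  case (UreF i)
  then show ?case by (intro exI[of _ "UreF (r i)"]) simp
next
  case (EqF i j)
  then show ?case by (intro exI[of _ "EqF (r i) (r j)"]) simp
next
  case (NegF p)
  then obtain q where "\<forall>s. sat_on M D s q \<longleftrightarrow> sat_on M D (\<lambda>k. s (r k)) p" by metis
  then show ?case by (intro exI[of _ "NegF q"]) simp
next
  case (ConjF p q)
  then obtain p' q' where "\<forall>s. sat_on M D s p' \<longleftrightarrow> sat_on M D (\<lambda>k. s (r k)) p"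
    "\<forall>s. sat_on M D s q' \<longleftrightarrow> sat_on M D (\<lambda>k. s (r k)) q" by metis
  then show ?case by (intro exI[of _ "ConjF p' q'"]) simp
next
  case (AllF i p)
  have "finite (r ` fv p)" by (simp add: finite_fv)
  then obtain m where m: "m \<notin> r ` fv p" using ex_new_if_finite infinite_UNIV_nat by metis
  obtain q where q: "\<forall>s. sat_on M D s q \<longleftrightarrow> sat_on M D (\<lambda>k. s ((r(i := m)) k)) p"
    using AllF by metis
  have "sat_on M D (s(m := a)) q \<longleftrightarrow> sat_on M D ((\<lambda>k. s (r k))(i := a)) p" for s a
    unfolding q[rule_format] using m by (intro sat_on_fv) auto
  then show ?case by (intro exI[of _ "AllF m q"]) simp
qed

named_theorems Dintro

locale zfc_model =
  fixes M :: "'a ustruct"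
  assumes ZFC: "ZFC M"
begin

abbreviation U :: "'a set" where "U \<equiv> univ M"
abbreviation E :: "'a \<Rightarrow> 'a set" where "E \<equiv> elts M"

definition env :: "(nat \<Rightarrow> 'a) \<Rightarrow> bool" where "env s \<longleftrightarrow> (\<forall>i. s i \<in> U)"

text \<open>A formula may have parameters: each of its slots is filled by a variable or by a constant.\<close>

definition fill :: "(nat \<Rightarrow> nat + 'a) \<Rightarrow> (nat \<Rightarrow> 'a) \<Rightarrow> nat \<Rightarrow> 'a" where
  "fill r s k = (case r k of Inl j \<Rightarrow> s j | Inr c \<Rightarrow> c)"

definition slots :: "(nat \<Rightarrow> nat + 'a) \<Rightarrow> bool" where
  "slots r \<longleftrightarrow> (\<forall>k c. r k = Inr c \<longrightarrow> c \<in> U)"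

abbreviation pop :: "(nat \<Rightarrow> 'a) \<Rightarrow> nat \<Rightarrow> 'a" where "pop s \<equiv> \<lambda>i. s (Suc i)"

text \<open>An environment is a de Bruijn stack: a quantifier over it binds variable 0 (see \<open>Def_all\<close>), so that
  the definability of a formula is proved by applying introduction rules.\<close>

definition Def :: "((nat \<Rightarrow> 'a) \<Rightarrow> bool) \<Rightarrow> bool" where
  "Def P \<longleftrightarrow> (\<exists>\<phi> r. slots r \<and> (\<forall>s. env s \<longrightarrow> (P s \<longleftrightarrow> sat M (fill r s) \<phi>)))"

definition Tm :: "((nat \<Rightarrow> 'a) \<Rightarrow> 'a) \<Rightarrow> bool" where
  "Tm f \<longleftrightarrow> (\<forall>s. env s \<longrightarrow> f s \<in> U) \<and> Def (\<lambda>s. s 0 = f (pop s))"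

abbreviation Def1 where "Def1 P \<equiv> Def (\<lambda>s. P (s 0))"
abbreviation Def2 where "Def2 P \<equiv> Def (\<lambda>s. P (s 0) (s 1))"
abbreviation Tm1 where "Tm1 f \<equiv> Tm (\<lambda>s. f (s 0))"
abbreviation Tm2 where "Tm2 f \<equiv> Tm (\<lambda>s. f (s 0) (s 1))"
abbreviation Tm3 where "Tm3 f \<equiv> Tm (\<lambda>s. f (s 0) (s 1) (s 2))"

lemma envD [simp]: "env s \<Longrightarrow> s i \<in> U"
  by (simp add: env_def)

lemma env_Suc [simp]: "env s \<Longrightarrow> env (pop s)"
  by (simp add: env_def)

lemma env_ren: "env s \<Longrightarrow> env (\<lambda>i. s (r i))"
  by (simp add: env_def)

lemma env_case [simp]: "env s \<Longrightarrow> x \<in> U \<Longrightarrow> env (case_nat x s)"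
  by (simp add: env_def split: nat.split)

lemma env_fill [simp]: "slots r \<Longrightarrow> env s \<Longrightarrow> env (fill r s)"
  by (auto simp: env_def fill_def slots_def split: sum.split)

lemma E_U: "y \<in> E x \<Longrightarrow> y \<in> U"
  by (simp add: elts_def)

lemma Def_cong: "Def P \<Longrightarrow> (\<And>s. env s \<Longrightarrow> P s \<longleftrightarrow> Q s) \<Longrightarrow> Def Q"
  unfolding Def_def by simp

lemma Def_fill:
  assumes "Def P" "slots q"
  shows "Def (\<lambda>s. P (fill q s))"
proof -
  obtain \<phi> r where r: "slots r" "\<And>s. env s \<Longrightarrow> P s \<longleftrightarrow> sat M (fill r s) \<phi>"
    using assms(1) unfolding Def_def by metis
  define r' where "r' k = (case r k of Inl j \<Rightarrow> q j | Inr c \<Rightarrow> Inr c)" for k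
  have "fill r (fill q s) = fill r' s" for s
    by (auto simp: fill_def r'_def split: sum.split)
  moreover have "slots r'" using r(1) assms(2) by (auto simp: slots_def r'_def split: sum.splits)
  ultimately show ?thesis using r(2) assms(2) unfolding Def_def
    by (intro exI[of _ \<phi>] exI[of _ r']) simp
qed

lemma Def_ren: "Def P \<Longrightarrow> Def (\<lambda>s. P (\<lambda>i. s (r i)))"
  using Def_fill[of P "\<lambda>k. Inl (r k)"] by (simp add: slots_def fill_def[abs_def])

lemma Def_const: "Def (\<lambda>s. Q)"
proof -
  have "slots Inl" by (simp add: slots_def)
  then show ?thesis unfolding Def_def
    by (intro exI[of _ "if Q then EqF 0 0 else NegF (EqF 0 0)"] exI[of _ Inl]) auto
qed

lemma Def_not: assumes "Def P" shows "Def (\<lambda>s. \<not> P s)"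
proof -
  obtain \<phi> r where "slots r" "\<And>s. env s \<Longrightarrow> P s \<longleftrightarrow> sat M (fill r s) \<phi>"
    using assms unfolding Def_def by metis
  then show ?thesis unfolding Def_def by (intro exI[of _ "NegF \<phi>"] exI[of _ r]) simp
qed

lemma Def_conj: assumes "Def P" "Def Q" shows "Def (\<lambda>s. P s \<and> Q s)"
proof -
  obtain \<phi> r where r: "slots r" "\<And>s. env s \<Longrightarrow> P s \<longleftrightarrow> sat M (fill r s) \<phi>"
    using assms(1) unfolding Def_def by metis
  obtain \<psi> q where q: "slots q" "\<And>s. env s \<Longrightarrow> Q s \<longleftrightarrow> sat M (fill q s) \<psi>"
    using assms(2) unfolding Def_def by metis
  \<comment> \<open>The two formulas come with separate fillings; moving their variables to the even
    and the odd indices lets a single filling \<open>t\<close> serve both.\<close>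
  obtain \<phi>' where \<phi>': "\<And>s. sat M s \<phi>' \<longleftrightarrow> sat M (\<lambda>k. s (2 * k)) \<phi>"
    using rename_fm[of M U "\<lambda>k. 2 * k" \<phi>] by metis
  obtain \<psi>' where \<psi>': "\<And>s. sat M s \<psi>' \<longleftrightarrow> sat M (\<lambda>k. s (Suc (2 * k))) \<psi>"
    using rename_fm[of M U "\<lambda>k. Suc (2 * k)" \<psi>] by metis
  define t where "t k = (if even k then r (k div 2) else q (k div 2))" for k
  have "fill r s = (\<lambda>k. fill t s (2 * k))" "fill q s = (\<lambda>k. fill t s (Suc (2 * k)))" for s
    by (auto simp: fill_def t_def)
  moreover have "slots t" using r(1) q(1) by (simp add: slots_def t_def)
  ultimately show ?thesis unfolding Def_def using r(2) q(2) \<phi>' \<psi>'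
    by (intro exI[of _ "ConjF \<phi>' \<psi>'"] exI[of _ t]) simp
qed

lemma Def_all:
  assumes "Def (\<lambda>s. P (s 0) (pop s))"
  shows "Def (\<lambda>s. \<forall>x\<in>U. P x s)"
proof -
  obtain \<phi> r where r: "slots r"
      "\<And>s. env s \<Longrightarrow> P (s 0) (pop s) \<longleftrightarrow> sat M (fill r s) \<phi>"
    using assms unfolding Def_def by metis
  \<comment> \<open>Index 0 becomes the bound variable: all slots that read the top of the stack are
    merged into it, the others move up by one. Outside the quantifier the stack is one shorter,
    whence \<open>j - 1\<close>; the value of \<open>r'\<close> at 0 gets overwritten.\<close>
  define \<rho> where "\<rho> k = (if r k = Inl 0 then 0 else Suc k)" for k
  obtain \<psi> where \<psi>: "\<And>s. sat M s \<psi> \<longleftrightarrow> sat M (\<lambda>k. s (\<rho> k)) \<phi>"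
    using rename_fm[of M U \<rho> \<phi>] by metis
  define r' where "r' k = (case k of 0 \<Rightarrow> Inl 0 | Suc l \<Rightarrow>
     (case r l of Inl j \<Rightarrow> Inl (j - 1) | Inr c \<Rightarrow> Inr c))" for k
  have "(\<lambda>k. ((fill r' s)(0 := x)) (\<rho> k)) = fill r (case_nat x s)" for s x
    by (auto simp: fill_def \<rho>_def r'_def fun_eq_iff split: sum.split nat.split)
  then have "sat M ((fill r' s)(0 := x)) \<psi> \<longleftrightarrow> P x s" if "env s" "x \<in> U" for s x
    using r(2)[of "case_nat x s"] that \<psi> by simp
  moreover have "slots r'" using r(1) by (auto simp: slots_def r'_def split: sum.splits nat.splits)
  ultimately show ?thesis unfolding Def_def
    by (intro exI[of _ "AllF 0 \<psi>"] exI[of _ r']) simp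
qed

lemma Def_ex:
  assumes "Def (\<lambda>s. P (s 0) (pop s))"
  shows "Def (\<lambda>s. \<exists>x\<in>U. P x s)"
  using Def_not[OF Def_all[of "\<lambda>x s. \<not> P x s"]] Def_not[OF assms] by simp

lemma Def_disj: "Def P \<Longrightarrow> Def Q \<Longrightarrow> Def (\<lambda>s. P s \<or> Q s)"
  using Def_not[OF Def_conj[OF Def_not[of P] Def_not[of Q]]] by simp

lemma Def_imp: "Def P \<Longrightarrow> Def Q \<Longrightarrow> Def (\<lambda>s. P s \<longrightarrow> Q s)"
  using Def_disj[OF Def_not[of P], of Q] by (simp only: imp_conv_disj)

lemma Def_iff: "Def P \<Longrightarrow> Def Q \<Longrightarrow> Def (\<lambda>s. P s \<longleftrightarrow> Q s)"
  using Def_conj[OF Def_imp[of P Q] Def_imp[of Q P]] by (simp only: iff_conv_conj_imp)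

lemma Def_if: "Def P \<Longrightarrow> Def Q \<Longrightarrow> Def R \<Longrightarrow> Def (\<lambda>s. if P s then Q s else R s)"
  using Def_conj[OF Def_imp[of P Q] Def_disj[of P R]] by (rule Def_cong) auto

lemma Def_var_eq: "Def (\<lambda>s. s i = s j)"
  unfolding Def_def
  by (intro exI[of _ "EqF 0 1"] exI[of _ "\<lambda>k. if k = 0 then Inl i else Inl j"])
    (simp add: slots_def fill_def)

lemma Def_var_mem: "Def (\<lambda>s. s i \<in> E (s j))"
  unfolding Def_def
  by (intro exI[of _ "MemF 0 1"] exI[of _ "\<lambda>k. if k = 0 then Inl i else Inl j"])
    (simp add: slots_def fill_def elts_def)

lemma Tm_U: "Tm f \<Longrightarrow> env s \<Longrightarrow> f s \<in> U"
  by (simp add: Tm_def)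

lemma Tm_graph:
  assumes "Tm f" shows "Def (\<lambda>s. s k = f (\<lambda>i. s (r i)))"
  using Def_ren[of "\<lambda>s. s 0 = f (pop s)" "case_nat k r"] assms
  by (simp add: Tm_def)

lemma Tm_ren: "Tm f \<Longrightarrow> Tm (\<lambda>s. f (\<lambda>i. s (r i)))"
  using Tm_graph[of f 0 "\<lambda>i. Suc (r i)"] by (auto simp: Tm_def env_ren)

lemma Tm_var: "Tm (\<lambda>s. s i)"
  using Def_var_eq by (simp add: Tm_def)

lemma Tm_const: "c \<in> U \<Longrightarrow> Tm (\<lambda>s. c)"
  using Def_fill[OF Def_var_eq[of 0 1], of "\<lambda>k. if k = 0 then Inl 0 else Inr c"]
  by (simp add: Tm_def slots_def fill_def)

text \<open>The language has no function symbols, so a term is substituted by quantifying over its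
  value and using its definable graph.\<close>

lemma Def_Tm1: assumes "Def1 R" "Tm f" shows "Def (\<lambda>s. R (f s))"
proof (rule Def_cong)
  show "Def (\<lambda>s. \<exists>x\<in>U. x = f s \<and> R x)"
    by (intro Def_ex Def_conj Tm_graph[OF assms(2)])
      (use Def_ren[OF assms(1), of "\<lambda>_. 0"] in simp)
qed (use Tm_U[OF assms(2)] in auto)

lemma Def_Tm2:
  assumes "Def2 R" "Tm f" "Tm g" shows "Def (\<lambda>s. R (f s) (g s))"
proof (rule Def_cong)
  \<comment> \<open>Quantifying over \<open>x\<close> and then over \<open>y\<close> leaves
    \<open>y\<close> on top of the stack, so the arguments of \<open>R\<close> appear in reverse
    order.\<close>
  have "Def (\<lambda>s. R (s 1) (s 0))"
    using Def_ren[OF assms(1), of "\<lambda>i. 1 - i"] by simp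
  then show "Def (\<lambda>s. \<exists>x\<in>U. x = f s \<and> (\<exists>y\<in>U. y = g s \<and> R x y))"
    by (intro Def_ex Def_conj Tm_graph[OF assms(2)] Tm_graph[OF assms(3)]) simp
qed (use Tm_U[OF assms(2)] Tm_U[OF assms(3)] in auto)

lemma Def_Tm3:
  assumes "Def (\<lambda>s. R (s 0) (s 1) (s 2))" "Tm f" "Tm g" "Tm h"
  shows "Def (\<lambda>s. R (f s) (g s) (h s))"
proof (rule Def_cong)
  have "Def (\<lambda>s. R (s 2) (s 1) (s 0))"
    using Def_ren[OF assms(1), of "\<lambda>i. 2 - i"] by simp
  then show "Def (\<lambda>s. \<exists>x\<in>U. x = f s \<and> (\<exists>y\<in>U. y = g s \<and> (\<exists>z\<in>U. z = h s \<and> R x y z)))"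
    by (intro Def_ex Def_conj Tm_graph[OF assms(2)] Tm_graph[OF assms(3)] Tm_graph[OF assms(4)]) (simp add: numeral_2_eq_2)
qed (use Tm_U[OF assms(2)] Tm_U[OF assms(3)] Tm_U[OF assms(4)] in auto)

lemma Def_eq: "Tm f \<Longrightarrow> Tm g \<Longrightarrow> Def (\<lambda>s. f s = g s)"
  by (rule Def_Tm2[where R = "(=)"]) (rule Def_var_eq)

lemma Def_mem: "Tm f \<Longrightarrow> Tm g \<Longrightarrow> Def (\<lambda>s. f s \<in> E (g s))"
  by (rule Def_Tm2[where R = "\<lambda>x y. x \<in> E y"]) (rule Def_var_mem)

lemma Tm_comp1: assumes "Tm1 F" "Tm f" shows "Tm (\<lambda>s. F (f s))"
  unfolding Tm_def
proof safe
  fix s assume "env s"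
  then have "env (\<lambda>_. f s)" by (simp add: env_def Tm_U[OF assms(2)])
  then show "F (f s) \<in> U" using Tm_U[OF assms(1)] by fastforce
next
  have "Def (\<lambda>s. s 0 = F (s 1))" using Tm_graph[OF assms(1), of 0 "\<lambda>_. 1"] by simp
  from Def_Tm2[OF this Tm_var Tm_ren[OF assms(2)]]
  show "Def (\<lambda>s. s 0 = F (f (pop s)))" .
qed

lemma Tm_comp2:
  assumes "Tm2 F" "Tm f" "Tm g" shows "Tm (\<lambda>s. F (f s) (g s))"
  unfolding Tm_def
proof safe
  fix s assume "env s"
  then have "env (case_nat (f s) (\<lambda>_. g s))" by (simp add: env_def Tm_U[OF assms(2)] Tm_U[OF assms(3)] split: nat.split)
  then show "F (f s) (g s) \<in> U" using Tm_U[OF assms(1)] by fastforce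
next
  have "Def (\<lambda>s. s 0 = F (s 1) (s 2))"
    using Tm_graph[OF assms(1), of 0 Suc] by (simp add: numeral_2_eq_2)
  from Def_Tm3[OF this Tm_var Tm_ren[OF assms(2)] Tm_ren[OF assms(3)]]
  show "Def (\<lambda>s. s 0 = F (f (pop s)) (g (pop s)))" .
qed

lemma Tm_comp3:
  assumes "Tm3 F" "Tm f" "Tm g" "Tm h" shows "Tm (\<lambda>s. F (f s) (g s) (h s))"
  unfolding Tm_def
proof safe
  fix s assume "env s"
  then have "env (case_nat (f s) (case_nat (g s) (\<lambda>_. h s)))"
    by (simp add: env_def Tm_U[OF assms(2)] Tm_U[OF assms(3)] Tm_U[OF assms(4)] split: nat.split)
  then show "F (f s) (g s) (h s) \<in> U" using Tm_U[OF assms(1)] by (fastforce simp: numeral_2_eq_2)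
next
  have *: "Def (\<lambda>s. s 0 = F (s 1) (s 2) (s 3))"
    using Tm_graph[OF assms(1), of 0 Suc] by (simp add: numeral_2_eq_2 numeral_3_eq_3)
  have "Def (\<lambda>s. \<exists>y\<in>U. y = f (pop s) \<and> (\<exists>z\<in>U. z = g (pop s) \<and> (\<exists>w\<in>U. w = h (pop s) \<and> s 0 = F y z w)))"
    by (intro Def_ex Def_conj Tm_graph[OF assms(2)] Tm_graph[OF assms(3)] Tm_graph[OF assms(4)])
     (use Def_ren[OF *, of "\<lambda>i. 3 - i"]
       in \<open>simp add: numeral_2_eq_2 numeral_3_eq_3\<close>)
  then show "Def (\<lambda>s. s 0 = F (f (pop s)) (g (pop s)) (h (pop s)))"
    by (rule Def_cong) (use Tm_U[OF assms(2)] Tm_U[OF assms(3)] Tm_U[OF assms(4)] in auto)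
qed

lemma Def_all_mem:
  assumes "Tm g" "Def (\<lambda>s. P (s 0) (pop s))"
  shows "Def (\<lambda>s. \<forall>x\<in>E (g s). P x s)"
proof (rule Def_cong)
  show "Def (\<lambda>s. \<forall>x\<in>U. x \<in> E (g s) \<longrightarrow> P x s)"
    by (intro Def_all Def_imp Def_mem Tm_var Tm_ren[OF assms(1)] assms(2))
qed (auto dest: E_U)

lemma Def_ex_mem:
  assumes "Tm g" "Def (\<lambda>s. P (s 0) (pop s))"
  shows "Def (\<lambda>s. \<exists>x\<in>E (g s). P x s)"
proof (rule Def_cong)
  show "Def (\<lambda>s. \<exists>x\<in>U. x \<in> E (g s) \<and> P x s)"
    by (intro Def_ex Def_conj Def_mem Tm_var Tm_ren[OF assms(1)] assms(2))
qed (auto dest: E_U)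

lemma Def_sub:
  assumes "Tm f" "Tm g" shows "Def (\<lambda>s. E (f s) \<subseteq> E (g s))"
  unfolding subset_eq
  by (intro Def_all_mem Def_mem Tm_var Tm_ren[OF assms(2)] assms)

lemma Def_Collect: "Def (\<lambda>s. P (f s) s) \<Longrightarrow> Def (\<lambda>s. f s \<in> {x. P x s})"
  by simp

lemma Tm_if:
  assumes "Def P" "Tm f" "Tm g" shows "Tm (\<lambda>s. if P s then f s else g s)"
  unfolding Tm_def
proof safe
  have "Def (\<lambda>s. if P (pop s) then s 0 = f (pop s) else s 0 = g (pop s))"
    by (intro Def_if Tm_graph assms Def_ren[OF assms(1)])
  then show "Def (\<lambda>s. s 0 = (if P (pop s) then f (pop s) else g (pop s)))"
    by (rule Def_cong) auto
qed (use assms in \<open>auto simp: Tm_U\<close>)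

lemmas [Dintro] = Def_all Def_ex Def_all_mem Def_ex_mem Def_conj Def_disj Def_imp Def_iff
  Def_not Def_eq Def_mem Def_sub Def_Collect Def_const Def_if Tm_var Tm_const Tm_if

section \<open>Set theory inside the ground model\<close>

text \<open>\<open>S\<close> tells the external collections that are extensions of objects from the
  others. As \<open>mk\<close> is unspecified outside \<open>S\<close>, each construction first has
  to establish \<open>S\<close>.\<close>

definition S :: "'a set \<Rightarrow> bool" where "S C \<longleftrightarrow> (\<exists>x\<in>U. E x = C)"
definition mk :: "'a set \<Rightarrow> 'a" where "mk C = (THE x. x \<in> U \<and> E x = C)"

lemma not_ure: "x \<in> U \<Longrightarrow> \<not> ure M x"
  using ZFC by (simp add: ZFC_def)

lemma is_set_iff [simp]: "is_set M x \<longleftrightarrow> x \<in> U"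
  using not_ure by (auto simp: is_set_def)

lemma ext: "x \<in> U \<Longrightarrow> y \<in> U \<Longrightarrow> E x = E y \<Longrightarrow> x = y"
  using ZFC by (simp add: ZFC_def ZFU_R_def ax_extensionality_def)

lemma mk_S: assumes "S C" shows "mk C \<in> U \<and> E (mk C) = C"
proof -
  obtain x where "x \<in> U \<and> E x = C" using assms by (auto simp: S_def)
  then show ?thesis unfolding mk_def by (rule theI) (use ext \<open>x \<in> U \<and> E x = C\<close> in auto)
qed

lemmas mk_U = mk_S[THEN conjunct1]
lemmas E_mk = mk_S[THEN conjunct2]

lemma S_E [simp]: "x \<in> U \<Longrightarrow> S (E x)" by (auto simp: S_def)
lemma mk_E [simp]: "x \<in> U \<Longrightarrow> mk (E x) = x" using mk_S[OF S_E] ext by blast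
lemma S_subU: "S C \<Longrightarrow> C \<subseteq> U" by (auto simp: S_def dest: E_U)
lemma eq_mk: "S C \<Longrightarrow> x \<in> U \<Longrightarrow> x = mk C \<longleftrightarrow> E x = C" using E_mk mk_E by auto

lemma S_sep: assumes "x \<in> U" "Def1 P" shows "S {z \<in> E x. P z}"
proof -
  obtain \<phi> r where r: "slots r" "\<And>s. env s \<Longrightarrow> P (s 0) \<longleftrightarrow> sat M (fill r s) \<phi>"
    using assms(2) unfolding Def_def by metis
  \<comment> \<open>\<open>P\<close> looks at the top of the stack only, so all stack variables may
    be read as the single variable 0; the constants become the parameters held by
    \<open>t\<close>.\<close>
  define \<rho> where "\<rho> k = (case r k of Inl _ \<Rightarrow> 0 | Inr c \<Rightarrow> Suc k)" for k
  obtain \<psi> where \<psi>: "\<And>s. sat M s \<psi> \<longleftrightarrow> sat M (\<lambda>k. s (\<rho> k)) \<phi>"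
    using rename_fm[of M U \<rho> \<phi>] by metis
  define t where "t k = (case k of 0 \<Rightarrow> x | Suc k \<Rightarrow> (case r k of Inl _ \<Rightarrow> x | Inr c \<Rightarrow> c))" for k
  have "fill r (\<lambda>_. z) = (\<lambda>k. (t(0 := z)) (\<rho> k))" for z
    by (auto simp: fill_def \<rho>_def t_def split: sum.split)
  then have "P z \<longleftrightarrow> sat M (t(0 := z)) \<psi>" if "z \<in> U" for z
    using r(2)[of "\<lambda>_. z"] that \<psi> by (simp add: env_def)
  moreover have "range t \<subseteq> U" using r(1) assms(1) by (auto simp: t_def slots_def split: nat.splits sum.splits)
  moreover have "ax_separation M" using ZFC by (simp add: ZFC_def ZFU_R_def)
  ultimately obtain y where "y \<in> U" "E y = {z \<in> E x. sat M (t(0 := z)) \<psi>}"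
    using assms(1) unfolding ax_separation_def is_set_iff by blast
  moreover have "{z \<in> E x. sat M (t(0 := z)) \<psi>} = {z \<in> E x. P z}"
    using \<open>\<And>z. z \<in> U \<Longrightarrow> P z \<longleftrightarrow> sat M (t(0 := z)) \<psi>\<close> E_U by blast
  ultimately show ?thesis unfolding S_def by metis
qed

lemma S_Def_sub: assumes "x \<in> U" "C \<subseteq> E x" "Def (\<lambda>s. s 0 \<in> C)" shows "S C"
proof -
  have "{z \<in> E x. z \<in> C} = C" using assms(2) by auto
  then show ?thesis using S_sep[OF assms(1,3)] by simp
qed

text \<open>\<open>ax_replacement\<close> asks for a total functional formula, whereas
  \<open>R\<close> may be partial. Its domain within \<open>x\<close> is therefore cut out by
  Separation first.\<close>

lemma S_repl:
  assumes "x \<in> U" "Def2 R"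
    and fn: "\<And>a b b'. a \<in> E x \<Longrightarrow> b \<in> U \<Longrightarrow> b' \<in> U \<Longrightarrow> R a b \<Longrightarrow> R a b' \<Longrightarrow> b = b'"
  shows "S {b \<in> U. \<exists>a\<in>E x. R a b}"
proof -
  obtain \<phi> r where r: "slots r" "\<And>s. env s \<Longrightarrow> R (s 0) (s 1) \<longleftrightarrow> sat M (fill r s) \<phi>"
    using assms(2) unfolding Def_def by metis
  \<comment> \<open>The stack used is \<open>a\<close> followed by \<open>b\<close> throughout, so
    all stack variables after the first are merged into variable 1.\<close>
  define \<rho> where "\<rho> k = (case r k of Inl 0 \<Rightarrow> 0 | Inl (Suc _) \<Rightarrow> 1 | Inr c \<Rightarrow> Suc (Suc k))" for k
  obtain \<psi> where \<psi>: "\<And>s. sat M s \<psi> \<longleftrightarrow> sat M (\<lambda>k. s (\<rho> k)) \<phi>"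
    using rename_fm[of M U \<rho> \<phi>] by metis
  define t where "t k = (case k of Suc (Suc k) \<Rightarrow> (case r k of Inl _ \<Rightarrow> x | Inr c \<Rightarrow> c) | _ \<Rightarrow> x)" for k
  have "fill r (case_nat a (\<lambda>_. b)) = (\<lambda>k. (t(0 := a, 1 := b)) (\<rho> k))" for a b
    by (auto simp: fill_def \<rho>_def t_def fun_eq_iff split: sum.split nat.split)
  then have R: "R a b \<longleftrightarrow> sat M (t(0 := a, 1 := b)) \<psi>" if "a \<in> U" "b \<in> U" for a b
    using r(2)[of "case_nat a (\<lambda>_. b)"] that \<psi> by (simp add: env_def split: nat.split)
  have "Def (\<lambda>s. \<exists>b\<in>U. R (s 0) b)"
    by (intro Def_ex) (use Def_ren[OF assms(2), of "\<lambda>i. 1 - i"] in simp)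
  then obtain y where y: "y \<in> U" "E y = {a \<in> E x. \<exists>b\<in>U. R a b}"
    using S_sep[OF assms(1), of "\<lambda>a. \<exists>b\<in>U. R a b"] unfolding S_def by blast
  have "\<forall>a\<in>E y. \<exists>!b. b \<in> U \<and> sat M (t(0 := a, 1 := b)) \<psi>"
  proof
    fix a assume "a \<in> E y"
    then obtain b where a: "a \<in> E x" and b: "b \<in> U" "R a b" using y by auto
    then show "\<exists>!b. b \<in> U \<and> sat M (t(0 := a, 1 := b)) \<psi>"
      by (intro ex1I[of _ b]) (use fn R[OF E_U[OF a]] in auto)
  qed
  moreover have "range t \<subseteq> U" using r(1) assms(1) by (auto simp: t_def slots_def split: nat.splits sum.splits)
  moreover have "ax_replacement M" using ZFC by (simp add: ZFC_def ZFU_R_def)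
  ultimately have "\<exists>z. z \<in> U \<and> E z = {b \<in> U. \<exists>a\<in>E y. sat M (t(0 := a, 1 := b)) \<psi>}"
    using y(1) unfolding ax_replacement_def is_set_iff by (elim allE[of _ \<psi>] allE[of _ t] allE[of _ y]) simp
  then have "S {b \<in> U. \<exists>a\<in>E y. sat M (t(0 := a, 1 := b)) \<psi>}" by (auto simp: S_def)
  moreover have "{b \<in> U. \<exists>a\<in>E y. sat M (t(0 := a, 1 := b)) \<psi>} = {b \<in> U. \<exists>a\<in>E x. R a b}"
    using y(2) R E_U by auto
  ultimately show ?thesis by simp
qed

lemma S_image: assumes "x \<in> U" "Tm1 F" shows "S (F ` E x)"
proof -
  have F: "F a \<in> U" if "a \<in> U" for a using Tm_U[OF assms(2), of "\<lambda>_. a"] that by (simp add: env_def)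
  have "S {b \<in> U. \<exists>a\<in>E x. b = F a}"
    by (rule S_repl[OF assms(1)]) (use Tm_graph[OF assms(2), of 1 "\<lambda>_. 0"] in auto)
  moreover have "{b \<in> U. \<exists>a\<in>E x. b = F a} = F ` E x" using F E_U by auto
  ultimately show ?thesis by simp
qed

lemma S_empty [simp]: "S {}"
proof -
  obtain w where "w \<in> U" using ZFC by (auto simp: ZFC_def ZFU_R_def ax_infinity_def)
  from S_sep[OF this Def_const[of False]] show ?thesis by simp
qed

lemma S_upair [simp]: "a \<in> U \<Longrightarrow> b \<in> U \<Longrightarrow> S {a, b}"
  using ZFC unfolding ZFC_def ZFU_R_def ax_pairing_def is_upair_def S_def is_set_iff by metis

lemma S_Union [simp]: "x \<in> U \<Longrightarrow> S (\<Union>y\<in>E x. E y)"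
  using ZFC unfolding ZFC_def ZFU_R_def ax_union_def S_def is_set_iff by metis

lemma S_Pow [simp]: "x \<in> U \<Longrightarrow> S {y \<in> U. E y \<subseteq> E x}"
  using ZFC unfolding ZFC_def ZFU_R_def ax_powerset_def S_def is_set_iff by metis

lemma foundation: "x \<in> U \<Longrightarrow> E x \<noteq> {} \<Longrightarrow> \<exists>y\<in>E x. E y \<inter> E x = {}"
  using ZFC unfolding ZFC_def ZFU_R_def ax_foundation_def is_set_iff by metis

text \<open>An object is pinned down by its members, so a definable membership condition makes the
  graph definable. Most set operations below become terms in this way.\<close>

lemma Tm_mk:
  assumes "Def (\<lambda>s. s 0 \<in> C (pop s))" "\<And>s. env s \<Longrightarrow> S (C s)"
  shows "Tm (\<lambda>s. mk (C s))"
  unfolding Tm_def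
proof safe
  have *: "Def (\<lambda>s. s 0 \<in> C (\<lambda>i. s (Suc (Suc i))))"
    using Def_ren[OF assms(1), of "\<lambda>i. if i = 0 then 0 else Suc i"] by simp
  have "Def (\<lambda>s. \<forall>x\<in>U. x \<in> E (s 0) \<longleftrightarrow> x \<in> C (pop s))"
    by (intro Dintro *)
  then show "Def (\<lambda>s. s 0 = mk (C (pop s)))"
  proof (rule Def_cong)
    fix s assume "env s"
    then have "env (pop s)" "s 0 \<in> U" by simp_all
    then show "(\<forall>x\<in>U. x \<in> E (s 0) \<longleftrightarrow> x \<in> C (pop s)) \<longleftrightarrow> s 0 = mk (C (pop s))"
      using eq_mk[OF assms(2)] S_subU[OF assms(2)] E_U by blast
  qed
qed (use mk_U assms in blast)

definition emp where "emp = mk {}"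
definition up where "up a b = mk {a, b}"
definition un where "un x = mk (\<Union>y\<in>E x. E y)"
definition pw where "pw x = mk {y \<in> U. E y \<subseteq> E x}"

lemma emp [simp]: "emp \<in> U" "E emp = {}" by (simp_all add: emp_def mk_U E_mk)
lemma up [simp]: "a \<in> U \<Longrightarrow> b \<in> U \<Longrightarrow> up a b \<in> U" "a \<in> U \<Longrightarrow> b \<in> U \<Longrightarrow> E (up a b) = {a, b}"
  by (simp_all add: up_def mk_U E_mk)
lemma un [simp]: "x \<in> U \<Longrightarrow> un x \<in> U" "x \<in> U \<Longrightarrow> E (un x) = (\<Union>y\<in>E x. E y)"
  by (simp_all add: un_def mk_U E_mk)
lemma pw [simp]: "x \<in> U \<Longrightarrow> pw x \<in> U" "x \<in> U \<Longrightarrow> E (pw x) = {y \<in> U. E y \<subseteq> E x}"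
  by (simp_all add: pw_def mk_U E_mk)

lemma E_empty_iff: "x \<in> U \<Longrightarrow> E x = {} \<longleftrightarrow> x = emp" using ext[of x emp] by auto

lemma Tm_up [Dintro]: assumes "Tm f" "Tm g" shows "Tm (\<lambda>s. up (f s) (g s))"
proof (rule Tm_comp2[OF _ assms])
  show "Tm2 up"
    unfolding up_def by (rule Tm_mk) (auto intro!: Dintro simp del: One_nat_def)
qed

lemma Tm_un [Dintro]: assumes "Tm f" shows "Tm (\<lambda>s. un (f s))"
proof (rule Tm_comp1[OF _ assms])
  show "Tm1 un"
    unfolding un_def by (rule Tm_mk) (auto intro!: Dintro)
qed

lemma Tm_pw [Dintro]: assumes "Tm f" shows "Tm (\<lambda>s. pw (f s))"
proof (rule Tm_comp1[OF _ assms])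
  have "Def (\<lambda>s. s 0 \<in> U)" by (rule Def_cong[OF Def_const[of True]]) simp
  then show "Tm1 pw"
    unfolding pw_def by (intro Tm_mk) (auto intro!: Dintro)
qed

lemma Def_in_U [Dintro]: "Tm f \<Longrightarrow> Def (\<lambda>s. f s \<in> U)"
  by (rule Def_cong[OF Def_const[of True]]) (simp add: Tm_U)

lemma S_un2 [simp]: assumes "a \<in> U" "b \<in> U" shows "S (E a \<union> E b)"
  using S_Union[of "up a b"] assms by simp

lemma S_insert [simp]: "a \<in> U \<Longrightarrow> S C \<Longrightarrow> S (insert a C)"
  using S_un2[of "up a a" "mk C"] by (simp add: mk_U E_mk)

definition op where "op a b = up (up a a) (up a b)"

lemma op [simp]: "a \<in> U \<Longrightarrow> b \<in> U \<Longrightarrow> op a b \<in> U" by (simp add: op_def)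
lemma op_E: "a \<in> U \<Longrightarrow> b \<in> U \<Longrightarrow> E (op a b) = {up a a, up a b}" by (simp add: op_def)

lemma up_inj: "a \<in> U \<Longrightarrow> b \<in> U \<Longrightarrow> c \<in> U \<Longrightarrow> d \<in> U \<Longrightarrow> up a b = up c d \<longleftrightarrow> {a, b} = {c, d}"
  using up(2) by (metis up_def)

lemma op_inj [simp]:
  "a \<in> U \<Longrightarrow> b \<in> U \<Longrightarrow> c \<in> U \<Longrightarrow> d \<in> U \<Longrightarrow> op a b = op c d \<longleftrightarrow> a = c \<and> b = d"
  unfolding op_def by (auto simp: up_inj doubleton_eq_iff)

lemma Tm_op [Dintro]: "Tm f \<Longrightarrow> Tm g \<Longrightarrow> Tm (\<lambda>s. op (f s) (g s))"
  unfolding op_def by (intro Dintro)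

lemma no_cycle1: "x \<in> U \<Longrightarrow> x \<notin> E x"
  using foundation[of "up x x"] by auto

lemma no_cycle2: "x \<in> U \<Longrightarrow> y \<in> U \<Longrightarrow> x \<in> E y \<Longrightarrow> y \<notin> E x"
  using foundation[of "up x y"] by auto

section \<open>Successors, the natural numbers of \<open>M\<close>, and iteration along them\<close>

definition suc where "suc x = un (up x (up x x))"

lemma suc [simp]: "x \<in> U \<Longrightarrow> suc x \<in> U" "x \<in> U \<Longrightarrow> E (suc x) = insert x (E x)"
  by (auto simp: suc_def)

lemma Tm_suc [Dintro]: "Tm f \<Longrightarrow> Tm (\<lambda>s. suc (f s))"
  unfolding suc_def by (intro Dintro)

lemma suc_inj:
  assumes "x \<in> U" "y \<in> U" "suc x = suc y" shows "x = y"
proof (rule ccontr)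
  assume "x \<noteq> y"
  moreover have "insert x (E x) = insert y (E y)" using assms suc(2) by metis
  ultimately have "x \<in> E y" "y \<in> E x" by (metis insertE insertI1)+
  then show False using no_cycle2 assms by blast
qed

lemma suc_ne [simp]: assumes "x \<in> U" shows "suc x \<noteq> emp" "emp \<noteq> suc x"
proof -
  have "E (suc x) \<noteq> E emp" using assms by simp
  then show "suc x \<noteq> emp" "emp \<noteq> suc x" by metis+
qed

text \<open>The \<omega> of \<open>M\<close>, as the intersection of all inductive sets. It may be
  non-standard, so induction along it (\<open>om_induct\<close>) is restricted to definable
  properties.\<close>

definition om where
  "om = {n \<in> U. \<forall>v\<in>U. emp \<in> E v \<and> (\<forall>x\<in>E v. suc x \<in> E v) \<longrightarrow> n \<in> E v}"

lemma ex_inductive: "\<exists>w\<in>U. emp \<in> E w \<and> (\<forall>x\<in>E w. suc x \<in> E w)"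
proof -
  obtain w where w: "w \<in> U" "\<exists>e\<in>E w. e \<in> U \<and> E e = {}"
      "\<forall>x\<in>E w. \<exists>y\<in>E w. y \<in> U \<and> E y = insert x (E x)"
    using ZFC unfolding ZFC_def ZFU_R_def ax_infinity_def is_set_iff by metis
  have "emp \<in> E w" using w(2) E_empty_iff by auto
  moreover have "suc x \<in> E w" if "x \<in> E w" for x
    using w(3) that suc[OF E_U[OF that]] ext by metis
  ultimately show ?thesis using w(1) by blast
qed

lemma S_om: "S om"
proof -
  obtain w where "w \<in> U" "emp \<in> E w \<and> (\<forall>x\<in>E w. suc x \<in> E w)" using ex_inductive by blast
  then show ?thesis
    by (intro S_Def_sub[of w]) (auto simp: om_def intro!: Dintro)
qed

lemma om_emp [simp]: "emp \<in> om" by (simp add: om_def)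
lemma om_suc [simp]: "n \<in> om \<Longrightarrow> suc n \<in> om" by (auto simp: om_def)
lemma om_U: "n \<in> om \<Longrightarrow> n \<in> U" by (simp add: om_def)

lemma om_induct [consumes 1, case_names Def emp suc]:
  assumes "n \<in> om" "Def1 P" "P emp" "\<And>n. n \<in> om \<Longrightarrow> P n \<Longrightarrow> P (suc n)"
  shows "P n"
proof -
  have "S {n \<in> om. P n}" using S_sep[OF mk_U[OF S_om] assms(2)] E_mk[OF S_om] by simp
  then obtain v where v: "v \<in> U" "E v = {n \<in> om. P n}" by (auto simp: S_def)
  then have "emp \<in> E v \<and> (\<forall>x\<in>E v. suc x \<in> E v)" using assms(3,4) by auto
  then have "n \<in> E v" using assms(1) v(1) by (auto simp: om_def)
  then show ?thesis using v by simp
qed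

lemma om_linear:
  assumes "m \<in> om" "n \<in> om" shows "m \<in> E n \<or> m = n \<or> n \<in> E m"
proof -
  have om: "E (mk om) = om" "mk om \<in> U" using S_om mk_S by auto
  have zero: "m = emp \<or> emp \<in> E m" if "m \<in> om" for m
    using that
  proof (induction rule: om_induct)
    show "Def (\<lambda>s. s 0 = emp \<or> emp \<in> E (s 0))" by (intro Dintro emp(1))
  qed (auto simp: om_U)
  have "\<forall>m\<in>E (mk om). m \<in> E n \<or> m = n \<or> n \<in> E m"
    using assms(2)
  proof (induction rule: om_induct)
    show "Def (\<lambda>s. \<forall>m\<in>E (mk om). m \<in> E (s 0) \<or> m = s 0 \<or> s 0 \<in> E m)" by (intro Dintro om)
  next
    show "\<forall>m\<in>E (mk om). m \<in> E emp \<or> m = emp \<or> emp \<in> E m" using zero om by auto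
  next
    fix n assume n: "n \<in> om" and IH: "\<forall>m\<in>E (mk om). m \<in> E n \<or> m = n \<or> n \<in> E m"
    have *: "n \<in> E m \<longrightarrow> suc n \<in> E m \<or> suc n = m" if "m \<in> om" for m
      using that
    proof (induction rule: om_induct)
      show "Def (\<lambda>s. n \<in> E (s 0) \<longrightarrow> suc n \<in> E (s 0) \<or> suc n = s 0)"
        by (intro Dintro suc om_U[OF n])
    qed (auto simp: om_U)
    show "\<forall>m\<in>E (mk om). m \<in> E (suc n) \<or> m = suc n \<or> suc n \<in> E m"
      using IH * om om_U[OF n] by auto
  qed
  then show ?thesis using assms om by auto
qed

text \<open>The witness is the range of an \<open>\<omega>\<close>-iteration of \<open>G\<close> inside \<open>M\<close>.\<close>

lemma ex_iteration:
  assumes G: "Tm1 G" and c: "c \<in> U"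
  shows "\<exists>t\<in>U. c \<in> E t \<and> (\<forall>y\<in>E t. G y \<in> E t) \<and>
    ((\<forall>y\<in>U. E y \<subseteq> E (G y)) \<longrightarrow> (\<forall>y\<in>E t. \<forall>z\<in>E t. E y \<subseteq> E z \<or> E z \<subseteq> E y))"
proof -
  have GU: "G a \<in> U" if "a \<in> U" for a using Tm_U[OF G, of "\<lambda>_. a"] that by (simp add: env_def)
  note [Dintro] = Tm_comp1[OF G]
  \<comment> \<open>An approximation justifies each of its pairs by a predecessor pair.
    Single-valuedness is not built in but proved by induction in \<open>ex1\<close>, so extending an
    approximation by one pair is immediate.\<close>
  define ap where "ap p \<longleftrightarrow> (\<forall>z\<in>E p. z = op emp c \<or>
    (\<exists>m\<in>U. \<exists>y\<in>U. op m y \<in> E p \<and> z = op (suc m) (G y)))" for p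
  have Dap [Dintro]: "Def (\<lambda>s. ap (f s))" if "Tm f" for f
    by (rule Def_Tm1[OF _ that]) (unfold ap_def, intro Dintro emp c)
  define R where "R n y \<longleftrightarrow> (\<exists>p\<in>U. ap p \<and> op n y \<in> E p)" for n y
  have DR [Dintro]: "Def (\<lambda>s. R (f s) (g s))" if "Tm f" "Tm g" for f g
    by (rule Def_Tm2[OF _ that]) (unfold R_def, intro Dintro)
  have R0: "R emp y \<longleftrightarrow> y = c" if "y \<in> U" for y
  proof
    assume "R emp y"
    then obtain p where "p \<in> U" "ap p" "op emp y \<in> E p" by (auto simp: R_def)
    then have "op emp y = op emp c \<or> (\<exists>m\<in>U. \<exists>z\<in>U. op emp y = op (suc m) (G z))"
      unfolding ap_def by blast
    then show "y = c" using that c GU by auto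
  next
    assume "y = c"
    moreover have "ap (up (op emp c) (op emp c))" using c by (simp add: ap_def)
    ultimately show "R emp y" unfolding R_def using c
      by (intro bexI[of _ "up (op emp c) (op emp c)"]) auto
  qed
  have RS: "R (suc n) y \<longleftrightarrow> (\<exists>z\<in>U. R n z \<and> y = G z)" if "n \<in> U" "y \<in> U" for n y
  proof
    assume "R (suc n) y"
    then obtain p where p: "p \<in> U" "ap p" "op (suc n) y \<in> E p" by (auto simp: R_def)
    moreover have "op (suc n) y \<noteq> op emp c" using that c by simp
    ultimately obtain m z where "m \<in> U" "z \<in> U" "op m z \<in> E p" "op (suc n) y = op (suc m) (G z)"
      unfolding ap_def by blast
    moreover from this have "n = m" using that GU suc_inj[of n m] by simp
    ultimately show "\<exists>z\<in>U. R n z \<and> y = G z" using that GU p by (auto simp: R_def)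
  next
    assume "\<exists>z\<in>U. R n z \<and> y = G z"
    then obtain z p where z: "z \<in> U" "y = G z" "p \<in> U" "ap p" "op n z \<in> E p" by (auto simp: R_def)
    let ?q = "mk (insert (op (suc n) y) (E p))"
    have q: "?q \<in> U" "E ?q = insert (op (suc n) y) (E p)"
      using mk_S[of "insert (op (suc n) y) (E p)"] that z by auto
    then have "ap ?q" using z that unfolding ap_def by blast
    then show "R (suc n) y" unfolding R_def using q by blast
  qed
  have om: "E (mk om) = om" "mk om \<in> U" using S_om mk_S by auto
  have ex1: "\<exists>y\<in>U. R n y \<and> (\<forall>y'\<in>U. R n y' \<longrightarrow> y' = y)" if "n \<in> om" for n
    using that
  proof (induction rule: om_induct)
    show "Def (\<lambda>s. \<exists>y\<in>U. R (s 0) y \<and> (\<forall>y'\<in>U. R (s 0) y' \<longrightarrow> y' = y))" by (intro Dintro)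
  next
    show "\<exists>y\<in>U. R emp y \<and> (\<forall>y'\<in>U. R emp y' \<longrightarrow> y' = y)" using R0 c by auto
  next
    fix n assume "n \<in> om" "\<exists>y\<in>U. R n y \<and> (\<forall>y'\<in>U. R n y' \<longrightarrow> y' = y)"
    then obtain y where y: "y \<in> U" "R n y" "\<And>y'. y' \<in> U \<Longrightarrow> R n y' \<Longrightarrow> y' = y" by blast
    then show "\<exists>y\<in>U. R (suc n) y \<and> (\<forall>y'\<in>U. R (suc n) y' \<longrightarrow> y' = y)"
      unfolding bex_simps using RS[OF om_U[OF \<open>n \<in> om\<close>]] GU[OF y(1)] by blast
  qed
  have "S {b \<in> U. \<exists>a\<in>E (mk om). R a b}"
  proof (rule S_repl[OF om(2)])
    show "Def2 R" by (intro Dintro)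
    show "b = b'" if "a \<in> E (mk om)" "b \<in> U" "b' \<in> U" "R a b" "R a b'" for a b b'
      using ex1[of a] that om(1) by blast
  qed
  then obtain t where t: "t \<in> U" "E t = {b \<in> U. \<exists>a\<in>om. R a b}" unfolding S_def om by metis
  have "c \<in> E t" using t R0 c om_emp by blast
  moreover have "\<forall>y\<in>E t. G y \<in> E t"
  proof
    fix y assume "y \<in> E t"
    then obtain n where n: "y \<in> U" "n \<in> om" "R n y" using t by auto
    then have "R (suc n) (G y)" using RS[OF om_U[OF n(2)] GU[OF n(1)]] by auto
    then show "G y \<in> E t" using t(2) n GU by auto
  qed
  \<comment> \<open>For increasing \<open>G\<close> the stages form a chain, because elements of
    \<open>om\<close> are comparable. The reflection argument works with such chains.\<close>
  moreover have "\<forall>y\<in>E t. \<forall>z\<in>E t. E y \<subseteq> E z \<or> E z \<subseteq> E y" if incr: "\<forall>y\<in>U. E y \<subseteq> E (G y)"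
  proof -
    have mono: "\<forall>m\<in>E (mk om). m \<in> E n \<longrightarrow> (\<forall>y\<in>U. \<forall>z\<in>U. R m y \<and> R n z \<longrightarrow> E y \<subseteq> E z)" if "n \<in> om" for n
      using that
    proof (induction rule: om_induct)
      show "Def (\<lambda>s. \<forall>m\<in>E (mk om). m \<in> E (s 0) \<longrightarrow>
         (\<forall>y\<in>U. \<forall>z\<in>U. R m y \<and> R (s 0) z \<longrightarrow> E y \<subseteq> E z))" by (intro Dintro om)
    next
      fix n assume n: "n \<in> om" and IH: "\<forall>m\<in>E (mk om). m \<in> E n \<longrightarrow> (\<forall>y\<in>U. \<forall>z\<in>U. R m y \<and> R n z \<longrightarrow> E y \<subseteq> E z)"
      show "\<forall>m\<in>E (mk om). m \<in> E (suc n) \<longrightarrow> (\<forall>y\<in>U. \<forall>z\<in>U. R m y \<and> R (suc n) z \<longrightarrow> E y \<subseteq> E z)"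
      proof (intro ballI impI)
        fix m y z assume m: "m \<in> E (mk om)" "m \<in> E (suc n)" and y: "y \<in> U" "z \<in> U" "R m y \<and> R (suc n) z"
        obtain z' where z': "z' \<in> U" "R n z'" "z = G z'" using y RS om_U[OF n] by blast
        have "E y \<subseteq> E z'"
        proof (cases "m = n")
          case True
          then show ?thesis using ex1[OF n] y z' by blast
        next
          case False
          then show ?thesis using IH m y z' om_U[OF n] by auto
        qed
        then show "E y \<subseteq> E z" using incr z' by blast
      qed
    qed auto
    show ?thesis
    proof (intro ballI)
      fix y z assume "y \<in> E t" "z \<in> E t"
      then obtain m n where mn: "m \<in> om" "n \<in> om" "R m y" "R n z" "y \<in> U" "z \<in> U" using t by auto
      from om_linear[OF mn(1,2)] show "E y \<subseteq> E z \<or> E z \<subseteq> E y"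
      proof (elim disjE)
        assume "m = n"
        then show ?thesis using ex1[OF mn(1)] mn by blast
      qed (use mono[OF mn(1)] mono[OF mn(2)] mn om in blast)+
    qed
  qed
  ultimately show ?thesis using t(1) by blast
qed

section \<open>Transitive closures and membership induction\<close>

definition trans :: "'a \<Rightarrow> bool" where "trans x \<longleftrightarrow> x \<in> U \<and> (\<forall>y\<in>E x. E y \<subseteq> E x)"

lemma ex_trans: assumes "x \<in> U" shows "\<exists>t. trans t \<and> E x \<subseteq> E t"
proof -
  have "Tm1 un" by (intro Dintro)
  then obtain t where t: "t \<in> U" "x \<in> E t" "\<forall>y\<in>E t. un y \<in> E t" using ex_iteration assms by metis
  have "trans (un t)" unfolding trans_def
  proof (intro conjI ballI subsetI)
    fix y z assume "y \<in> E (un t)" "z \<in> E y"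
    then obtain w where "w \<in> E t" "y \<in> E w" using t by auto
    then have "z \<in> E (un w)" "un w \<in> E t" using t \<open>z \<in> E y\<close> E_U by auto
    then show "z \<in> E (un t)" using t by auto
  qed (use t in simp)
  moreover have "E x \<subseteq> E (un t)" using t by auto
  ultimately show ?thesis by blast
qed

lemma ex_trans_mem: assumes "x \<in> U" shows "\<exists>t. trans t \<and> x \<in> E t"
  using ex_trans[of "up x x"] assms by auto

text \<open>Foundation of \<open>M\<close> speaks about sets of \<open>M\<close> only, hence the
  restriction to definable \<open>P\<close>: the counterexamples inside a transitive set around
  \<open>x\<close> form a set, and a minimal one contradicts the step.\<close>

lemma eps_induct [consumes 1, case_names Def step]:
  assumes "x \<in> U" "Def1 P" "\<And>x. x \<in> U \<Longrightarrow> (\<And>y. y \<in> E x \<Longrightarrow> P y) \<Longrightarrow> P x"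
  shows "P x"
proof (rule ccontr)
  assume "\<not> P x"
  obtain t where t: "trans t" "x \<in> E t" using ex_trans_mem assms(1) by blast
  then have "S {z \<in> E t. \<not> P z}" by (intro S_sep Def_not assms) (simp add: trans_def)
  then obtain v where v: "v \<in> U" "E v = {z \<in> E t. \<not> P z}" by (auto simp: S_def)
  then obtain y where "y \<in> E v" "E y \<inter> E v = {}" using foundation[of v] \<open>\<not> P x\<close> t by blast
  then show False using v t assms(3)[of y] E_U unfolding trans_def by blast
qed

section \<open>Recursion, collection and choice in the ground model\<close>

lemma Tm1_U: "Tm1 F \<Longrightarrow> a \<in> U \<Longrightarrow> F a \<in> U"
  using Tm_U[of "\<lambda>s. F (s 0)" "\<lambda>_. a"] by (simp add: env_def)

lemma Tm2_U: "Tm2 F \<Longrightarrow> a \<in> U \<Longrightarrow> b \<in> U \<Longrightarrow> F a b \<in> U"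
  using Tm_U[of "\<lambda>s. F (s 0) (s 1)" "case_nat a (\<lambda>_. b)"] by (simp add: env_def split: nat.split)

lemma Tm3_U: "Tm3 F \<Longrightarrow> a \<in> U \<Longrightarrow> b \<in> U \<Longrightarrow> c \<in> U \<Longrightarrow> F a b c \<in> U"
  using Tm_U[of "\<lambda>s. F (s 0) (s 1) (s 2)" "case_nat a (case_nat b (\<lambda>_. c))"]
  by (simp add: env_def numeral_2_eq_2 split: nat.split)

lemma Tm_the:
  assumes "Def (\<lambda>s. Q (s 0) (pop s))"
    "\<And>s. env s \<Longrightarrow> \<exists>y\<in>U. Q y s \<and> (\<forall>z\<in>U. Q z s \<longrightarrow> z = y)"
  shows "Tm (\<lambda>s. THE y. y \<in> U \<and> Q y s)"
  unfolding Tm_def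
proof safe
  have the: "(THE y. y \<in> U \<and> Q y s) \<in> U \<and> Q (THE y. y \<in> U \<and> Q y s) s" if "env s" for s
    using theI'[of "\<lambda>y. y \<in> U \<and> Q y s"] assms(2)[OF that] by blast
  then show "\<And>s. env s \<Longrightarrow> (THE y. y \<in> U \<and> Q y s) \<in> U" by blast
  show "Def (\<lambda>s. s 0 = (THE y. y \<in> U \<and> Q y (pop s)))"
  proof (rule Def_cong[OF assms(1)])
    fix s assume s: "env s"
    then show "Q (s 0) (pop s) \<longleftrightarrow> s 0 = (THE y. y \<in> U \<and> Q y (pop s))"
      using the[OF env_Suc[OF s]] assms(2)[OF env_Suc[OF s]] envD[OF s, of 0] by metis
  qed
qed

lemma Tm_image [Dintro]:
  assumes "Tm1 F" "Tm g" shows "Tm (\<lambda>s. mk (F ` E (g s)))"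
proof (rule Tm_mk)
  show "Def (\<lambda>s. s 0 \<in> F ` E (g (pop s)))"
    unfolding image_iff by (intro Dintro Tm_ren[OF assms(2)] Tm_comp1[OF assms(1)])
qed (use S_image Tm_U assms in blast)

lemma image_mk: assumes "x \<in> U" "Tm1 F"
  shows "mk (F ` E x) \<in> U" "E (mk (F ` E x)) = F ` E x"
  using mk_S[OF S_image[OF assms]] by auto

definition rng where "rng f = mk {w \<in> U. \<exists>y\<in>U. op y w \<in> E f}"

lemma S_rng: assumes "f \<in> U" shows "S {w \<in> U. \<exists>y\<in>U. op y w \<in> E f}"
proof (rule S_Def_sub[of "un (un f)"])
  show "{w \<in> U. \<exists>y\<in>U. op y w \<in> E f} \<subseteq> E (un (un f))"
  proof safe
    fix w y assume "w \<in> U" "y \<in> U" "op y w \<in> E f"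
    then have "up y w \<in> E (un f)" using assms op_E[of y w] by auto
    then show "w \<in> E (un (un f))" using assms up(2)[OF \<open>y \<in> U\<close> \<open>w \<in> U\<close>] by auto
  qed
  show "Def (\<lambda>s. s 0 \<in> {w \<in> U. \<exists>y\<in>U. op y w \<in> E f})" by (intro Dintro assms)
qed (use assms in simp)

lemma rng [simp]: "f \<in> U \<Longrightarrow> rng f \<in> U" "f \<in> U \<Longrightarrow> E (rng f) = {w \<in> U. \<exists>y\<in>U. op y w \<in> E f}"
  using mk_S[OF S_rng] by (simp_all add: rng_def)

lemma Tm_rng [Dintro]: assumes "Tm f" shows "Tm (\<lambda>s. rng (f s))"
proof (rule Tm_comp1[OF _ assms])
  show "Tm1 rng" unfolding rng_def by (intro Tm_mk S_rng Dintro envD)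
qed

definition prd where "prd x y = mk {z \<in> U. \<exists>a\<in>E x. \<exists>b\<in>E y. z = op a b}"

lemma S_prd: assumes "x \<in> U" "y \<in> U" shows "S {z \<in> U. \<exists>a\<in>E x. \<exists>b\<in>E y. z = op a b}"
proof (rule S_Def_sub[of "pw (pw (un (up x y)))"])
  show "{z \<in> U. \<exists>a\<in>E x. \<exists>b\<in>E y. z = op a b} \<subseteq> E (pw (pw (un (up x y))))"
  proof safe
    fix z a b assume "a \<in> E x" "b \<in> E y" "op a b \<in> U"
    moreover from this have "a \<in> U" "b \<in> U" by (auto dest: E_U)
    ultimately show "op a b \<in> E (pw (pw (un (up x y))))" using assms by (auto simp: op_E)
  qed
  show "Def (\<lambda>s. s 0 \<in> {z \<in> U. \<exists>a\<in>E x. \<exists>b\<in>E y. z = op a b})" by (intro Dintro assms)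
qed (use assms in simp)

lemma prd: "x \<in> U \<Longrightarrow> y \<in> U \<Longrightarrow> prd x y \<in> U"
    "x \<in> U \<Longrightarrow> y \<in> U \<Longrightarrow> E (prd x y) = {z \<in> U. \<exists>a\<in>E x. \<exists>b\<in>E y. z = op a b}"
  using mk_S[OF S_prd] by (simp_all add: prd_def)

lemma Tm_prd [Dintro]: assumes "Tm f" "Tm g" shows "Tm (\<lambda>s. prd (f s) (g s))"
proof (rule Tm_comp2[OF _ assms])
  show "Tm2 prd" unfolding prd_def by (intro Tm_mk S_prd Dintro envD)
qed

definition gr where "gr F x = mk ((\<lambda>y. op y (F y)) ` E x)"

lemma gr:
  assumes "Tm1 F" "x \<in> U"
  shows "gr F x \<in> U" "E (gr F x) = (\<lambda>y. op y (F y)) ` E x"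
proof -
  have "Tm (\<lambda>s. op (s 0) (F (s 0)))" by (intro Dintro assms)
  from image_mk[OF assms(2) this] show "gr F x \<in> U" "E (gr F x) = (\<lambda>y. op y (F y)) ` E x"
    by (simp_all add: gr_def)
qed

lemma Tm_inst1:
  assumes "Tm2 F" "q \<in> U" shows "Tm (\<lambda>s. F q (s 0))"
  by (intro Tm_comp2[OF assms(1)] Dintro assms)

text \<open>The parameter \<open>q\<close> is carried along so that the solution is one definable
  function of both arguments, as \<open>act\<close> needs for permutations indexed by
  \<open>q\<close>.\<close>

lemma eps_rec:
  assumes H: "Tm3 H"
  shows "\<exists>F. Tm2 F \<and> (\<forall>q\<in>U. \<forall>x\<in>U. F q x = H q x (gr (F q) x))"
proof -
  note [Dintro] = Tm_comp3[OF H]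
  \<comment> \<open>A table of values with domain exactly \<open>x\<close>; that the relevant tables
    are single-valued follows from \<open>uniq\<close>.\<close>
  define ig where "ig g x \<longleftrightarrow> (\<forall>z\<in>E g. \<exists>y\<in>E x. \<exists>w\<in>U. z = op y w) \<and>
    (\<forall>y\<in>E x. \<exists>w\<in>U. op y w \<in> E g)" for g x
  have [Dintro]: "Def (\<lambda>s. ig (f s) (g s))" if "Tm f" "Tm g" for f g
    by (rule Def_Tm2[OF _ that]) (unfold ig_def, intro Dintro)
  define ap where "ap q p \<longleftrightarrow>
    (\<forall>z\<in>E p. \<exists>x\<in>U. \<exists>g\<in>U. z = op x (H q x g) \<and> ig g x \<and> E g \<subseteq> E p)" for q p
  have [Dintro]: "Def (\<lambda>s. ap (f s) (g s))" if "Tm f" "Tm g" for f g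
    by (rule Def_Tm2[OF _ that]) (unfold ap_def, intro Dintro)
  define R where "R q x v \<longleftrightarrow> (\<exists>p\<in>U. ap q p \<and> op x v \<in> E p)" for q x v
  have [Dintro]: "Def (\<lambda>s. R (f s) (g s) (h s))" if "Tm f" "Tm g" "Tm h" for f g h
    by (rule Def_Tm3[OF _ that]) (unfold R_def, intro Dintro)
  have RD: "\<exists>g\<in>U. v = H q x g \<and> ig g x \<and> (\<forall>y w. op y w \<in> E g \<longrightarrow> R q y w)"
    if qxv: "q \<in> U" "x \<in> U" "v \<in> U" and Rv: "R q x v" for q x v
  proof -
    obtain p where p: "p \<in> U" "ap q p" "op x v \<in> E p" using Rv by (auto simp: R_def)
    then obtain x' g where g: "x' \<in> U" "g \<in> U" "op x v = op x' (H q x' g)" "ig g x'" "E g \<subseteq> E p"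
      unfolding ap_def by blast
    have "x = x' \<and> v = H q x' g" using g(3) qxv g(1) Tm3_U[OF H qxv(1) g(1,2)] by simp
    then show ?thesis using g p unfolding R_def by blast
  qed
  have uniq: "\<forall>v\<in>U. \<forall>v'\<in>U. R q x v \<and> R q x v' \<longrightarrow> v = v'" if q: "q \<in> U" and xU: "x \<in> U" for q x
    using xU
  proof (induction rule: eps_induct)
    show "Def (\<lambda>s. \<forall>v\<in>U. \<forall>v'\<in>U. R q (s 0) v \<and> R q (s 0) v' \<longrightarrow> v = v')" by (intro Dintro q)
  next
    fix x assume x: "x \<in> U" and IH: "\<And>y. y \<in> E x \<Longrightarrow> \<forall>v\<in>U. \<forall>v'\<in>U. R q y v \<and> R q y v' \<longrightarrow> v = v'"
    have half: "E g \<subseteq> E g'"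
      if g: "ig g x" "ig g' x" "\<forall>y w. op y w \<in> E g \<longrightarrow> R q y w" "\<forall>y w. op y w \<in> E g' \<longrightarrow> R q y w" for g g'
    proof
      fix z assume z: "z \<in> E g"
      then obtain y w where y: "y \<in> E x" "w \<in> U" "z = op y w" using g(1) unfolding ig_def by blast
      obtain w' where w': "w' \<in> U" "op y w' \<in> E g'" using g(2) y(1) unfolding ig_def by blast
      have "w = w'" using IH[OF y(1)] z y g(3,4) w' by blast
      then show "z \<in> E g'" using w' y by simp
    qed
    show "\<forall>v\<in>U. \<forall>v'\<in>U. R q x v \<and> R q x v' \<longrightarrow> v = v'"
    proof (intro ballI impI)
      fix v v' assume v: "v \<in> U" "v' \<in> U" "R q x v \<and> R q x v'"
      obtain g where g: "g \<in> U" "v = H q x g" "ig g x" "\<forall>y w. op y w \<in> E g \<longrightarrow> R q y w"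
        using RD[OF q x v(1)] v(3) by blast
      obtain g' where g': "g' \<in> U" "v' = H q x g'" "ig g' x" "\<forall>y w. op y w \<in> E g' \<longrightarrow> R q y w"
        using RD[OF q x v(2)] v(3) by blast
      have "g = g'" using half[OF g(3) g'(3) g(4) g'(4)] half[OF g'(3) g(3) g'(4) g(4)] g(1) g'(1)
        by (intro ext) auto
      then show "v = v'" using g g' by simp
    qed
  qed
  have ex: "\<exists>v\<in>U. R q x v" if q: "q \<in> U" and xU: "x \<in> U" for q x
    using xU
  proof (induction rule: eps_induct)
    show "Def (\<lambda>s. \<exists>v\<in>U. R q (s 0) v)" by (intro Dintro q)
  next
    fix x assume x: "x \<in> U" and IH: "\<And>y. y \<in> E x \<Longrightarrow> \<exists>v\<in>U. R q y v"
    obtain T where T: "trans T" "E x \<subseteq> E T" using ex_trans x by blast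
    \<comment> \<open>Replacement over a transitive superset of \<open>x\<close> collects all values
      available there, \<open>uniq\<close> making the relation functional. Transitivity of
      \<open>T\<close> makes \<open>p\<close> contain the tables of its own pairs.\<close>
    have "S {b \<in> U. \<exists>a\<in>E T. \<exists>v\<in>U. R q a v \<and> b = op a v}"
    proof (rule S_repl)
      show "T \<in> U" using T by (simp add: trans_def)
      show "Def (\<lambda>s. \<exists>v\<in>U. R q (s 0) v \<and> s 1 = op (s 0) v)" by (intro Dintro q)
      show "b = b'" if "a \<in> E T" "\<exists>v\<in>U. R q a v \<and> b = op a v" "\<exists>v\<in>U. R q a v \<and> b' = op a v" for a b b'
        using that uniq[OF q E_U[OF that(1)]] by blast
    qed
    then obtain p where p: "p \<in> U" "E p = {b \<in> U. \<exists>a\<in>E T. \<exists>v\<in>U. R q a v \<and> b = op a v}"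
      by (auto simp: S_def)
    have pI: "op a v \<in> E p \<longleftrightarrow> a \<in> E T \<and> R q a v" if "a \<in> U" "v \<in> U" for a v
      using that p E_U by auto
    have "S {u \<in> E p. \<exists>y\<in>E x. \<exists>w\<in>U. u = op y w}" by (intro S_sep Dintro p(1) x)
    then obtain g where g: "g \<in> U" "E g = {u \<in> E p. \<exists>y\<in>E x. \<exists>w\<in>U. u = op y w}" by (auto simp: S_def)
    have ig: "ig g x" unfolding ig_def
    proof (intro conjI ballI)
      fix y assume y: "y \<in> E x"
      then obtain w where "w \<in> U" "R q y w" using IH by blast
      then show "\<exists>w\<in>U. op y w \<in> E g" using g(2) pI E_U[OF y] y T(2) by blast
    qed (use g(2) in blast)
    define v where "v = H q x g"
    have v: "v \<in> U" unfolding v_def by (intro Tm3_U[OF H] q x g)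
    have "S (insert (op x v) (E p))" by (intro S_insert op x v S_E p(1))
    then obtain p' where p': "p' \<in> U" "E p' = insert (op x v) (E p)" by (auto simp: S_def)
    have "\<exists>x\<in>U. \<exists>g\<in>U. z = op x (H q x g) \<and> ig g x \<and> E g \<subseteq> E p'" if zp: "z \<in> E p'" for z
    proof (cases "z = op x v")
      case True
      then show ?thesis using x g(1) ig g(2) p'(2) unfolding v_def by blast
    next
      case False
      then have "z \<in> E p" using zp p'(2) by simp
      then obtain a w where a: "a \<in> E T" "w \<in> U" "R q a w" "z = op a w" unfolding p(2) by blast
      then obtain g' where g': "g' \<in> U" "w = H q a g'" "ig g' a" "\<forall>y w. op y w \<in> E g' \<longrightarrow> R q y w"
        using RD[OF q E_U[OF a(1)]] by blast
      have "E g' \<subseteq> E p"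
      proof
        fix u assume u: "u \<in> E g'"
        then obtain y w where y: "y \<in> E a" "w \<in> U" "u = op y w" using g'(3) unfolding ig_def by blast
        then have "y \<in> E T" using T(1) a(1) by (auto simp: trans_def)
        then show "u \<in> E p" using pI[OF E_U] y u g'(4) by blast
      qed
      then show ?thesis using a g' p'(2) E_U by blast
    qed
    then have "R q x v" using p' unfolding R_def ap_def by blast
    then show "\<exists>v\<in>U. R q x v" using v by blast
  qed
  define F where "F q x = (THE v. v \<in> U \<and> R q x v)" for q x
  have F: "F q x \<in> U" "R q x (F q x)" "\<And>v. v \<in> U \<Longrightarrow> R q x v \<Longrightarrow> v = F q x" if "q \<in> U" "x \<in> U" for q x
  proof -
    have "\<exists>!v. v \<in> U \<and> R q x v" using ex[OF that] uniq[OF that] by blast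
    from theI'[OF this] show "F q x \<in> U" "R q x (F q x)" by (auto simp: F_def)
    then show "\<And>v. v \<in> U \<Longrightarrow> R q x v \<Longrightarrow> v = F q x" using uniq[OF that] by blast
  qed
  have TF: "Tm2 F"
    unfolding F_def
  proof (rule Tm_the)
    show "Def (\<lambda>s. R (s (Suc 0)) (s (Suc 1)) (s 0))" by (intro Dintro)
    show "\<And>s. env s \<Longrightarrow> \<exists>y\<in>U. R (s 0) (s 1) y \<and> (\<forall>z\<in>U. R (s 0) (s 1) z \<longrightarrow> z = y)"
      using ex uniq by (meson envD)
  qed
  have "F q x = H q x (gr (F q) x)" if q: "q \<in> U" and x: "x \<in> U" for q x
  proof -
    obtain g where g: "g \<in> U" "F q x = H q x g" "ig g x" "\<forall>y w. op y w \<in> E g \<longrightarrow> R q y w"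
      using RD[OF q x F(1,2)[OF q x]] by blast
    have "E g = (\<lambda>y. op y (F q y)) ` E x"
    proof safe
      fix z assume z: "z \<in> E g"
      then obtain y w where y: "y \<in> E x" "w \<in> U" "z = op y w" using g(3) unfolding ig_def by blast
      then have "w = F q y" using F(3)[OF q E_U[OF y(1)]] g(4) z by blast
      then show "z \<in> (\<lambda>y. op y (F q y)) ` E x" using y by blast
    next
      fix y assume y: "y \<in> E x"
      then obtain w where w: "w \<in> U" "op y w \<in> E g" using g(3) unfolding ig_def by blast
      then show "op y (F q y) \<in> E g" using F(3)[OF q E_U[OF y] w(1)] g(4) by simp
    qed
    then have "g = gr (F q) x" unfolding gr_def using mk_E[OF g(1)] by simp
    then show ?thesis using g(2) by simp
  qed
  then show ?thesis using TF by blast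
qed

lemma eps_rec_image:
  assumes H: "Tm3 H"
  shows "\<exists>F. Tm2 F \<and> (\<forall>q\<in>U. \<forall>x\<in>U. F q x = H q x (mk (F q ` E x)))"
proof -
  have "Tm (\<lambda>s. H (s 0) (s 1) (rng (s 2)))" by (intro Tm_comp3[OF H] Dintro)
  then obtain F where F: "Tm2 F"
      "\<And>q x. q \<in> U \<Longrightarrow> x \<in> U \<Longrightarrow> F q x = H q x (rng (gr (F q) x))"
    using eps_rec[of "\<lambda>q x f. H q x (rng f)"] by blast
  have "rng (gr (F q) x) = mk (F q ` E x)" if "q \<in> U" "x \<in> U" for q x
  proof -
    note g = gr[OF Tm_inst1[OF F(1) that(1)] that(2)]
    have "F q y \<in> U" if "y \<in> E x" for y using Tm2_U[OF F(1) \<open>q \<in> U\<close> E_U[OF that]] .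
    then have "{w \<in> U. \<exists>y\<in>U. op y w \<in> E (gr (F q) x)} = F q ` E x"
      unfolding g(2) by (force simp: E_U)
    then show ?thesis by (simp add: rng_def)
  qed
  then show ?thesis using F by metis
qed

section \<open>The rank hierarchy without ordinals, and Scott's trick\<close>

definition V where
  "V = (SOME F. Tm1 F \<and> (\<forall>x\<in>U. F x = un (mk (pw ` E (mk (F ` E x))))))"

lemma V_spec: "Tm1 V \<and> (\<forall>x\<in>U. V x = un (mk (pw ` E (mk (V ` E x)))))"
proof -
  have "Tm (\<lambda>s. un (mk (pw ` E (s 2))))" by (intro Dintro)
  then obtain F where F: "Tm2 F"
      "\<forall>q\<in>U. \<forall>x\<in>U. F q x = un (mk (pw ` E (mk (F q ` E x))))"
    using eps_rec_image[of "\<lambda>q x f. un (mk (pw ` E f))"] by blast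
  show ?thesis unfolding V_def
    by (rule someI[of _ "F emp"]) (use F Tm_inst1[OF F(1)] in auto)
qed

lemma Tm_V [Dintro]: "Tm f \<Longrightarrow> Tm (\<lambda>s. V (f s))"
  using Tm_comp1 V_spec by blast

lemma V_U [simp]: "x \<in> U \<Longrightarrow> V x \<in> U" using Tm1_U V_spec by blast

text \<open>Unfolds the recursion: \<open>V x\<close> is the union of the power sets of all
  \<open>V y\<close> with \<open>y\<close> in \<open>x\<close>. In ordinal terms it is the level of
  the cumulative hierarchy at the rank of \<open>x\<close>.\<close>

lemma V_mem: assumes "x \<in> U" shows "z \<in> E (V x) \<longleftrightarrow> z \<in> U \<and> (\<exists>y\<in>E x. E z \<subseteq> E (V y))"
proof -
  have T: "Tm1 pw" by (intro Dintro)
  note v = image_mk[OF assms V_spec[THEN conjunct1]]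
  have "V x = un (mk (pw ` V ` E x))" using V_spec assms v by simp
  moreover have "E (mk (pw ` V ` E x)) = pw ` V ` E x" "mk (pw ` V ` E x) \<in> U"
    using image_mk[OF v(1) T] v by auto
  ultimately have "E (V x) = (\<Union>y\<in>E x. E (pw (V y)))" by simp
  then show ?thesis using E_U by auto
qed

lemma V_sub: "x \<in> U \<Longrightarrow> E x \<subseteq> E (V x)"
proof (induction rule: eps_induct)
  show "Def (\<lambda>s. E (s 0) \<subseteq> E (V (s 0)))" by (intro Dintro)
next
  fix x assume "x \<in> U" "\<And>y. y \<in> E x \<Longrightarrow> E y \<subseteq> E (V y)"
  then show "E x \<subseteq> E (V x)" using V_mem E_U by blast
qed

text \<open>Stands in for the linear order of ranks. An \<open>a\<close> in \<open>V x\<close> but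
  not in \<open>V y\<close> is included in some \<open>V x'\<close> with \<open>x'\<close> in
  \<open>x\<close>; the induction hypothesis for \<open>x'\<close> places all of \<open>V y\<close>
  inside \<open>V x'\<close>, which makes \<open>V y\<close> an element of
  \<open>V x\<close>.\<close>

lemma V_linear: assumes "x \<in> U" "y \<in> U" shows "V y \<in> E (V x) \<or> E (V x) \<subseteq> E (V y)"
proof -
  have "\<forall>y\<in>U. V y \<in> E (V x) \<or> E (V x) \<subseteq> E (V y)"
    using assms(1)
  proof (induction rule: eps_induct)
    show "Def (\<lambda>s. \<forall>y\<in>U. V y \<in> E (V (s 0)) \<or> E (V (s 0)) \<subseteq> E (V y))" by (intro Dintro)
  next
    fix x assume x: "x \<in> U" and IH: "\<And>x'. x' \<in> E x \<Longrightarrow> \<forall>y\<in>U. V y \<in> E (V x') \<or> E (V x') \<subseteq> E (V y)"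
    show "\<forall>y\<in>U. V y \<in> E (V x) \<or> E (V x) \<subseteq> E (V y)"
    proof (intro ballI, rule ccontr)
      fix y assume y: "y \<in> U" and neg: "\<not> (V y \<in> E (V x) \<or> E (V x) \<subseteq> E (V y))"
      then obtain a where a: "a \<in> E (V x)" "a \<notin> E (V y)" by blast
      then obtain x' where x': "x' \<in> E x" "E a \<subseteq> E (V x')" using V_mem[OF x] by blast
      have "E (V y) \<subseteq> E (V x')"
      proof
        fix b assume b: "b \<in> E (V y)"
        then obtain y' where y': "y' \<in> E y" "E b \<subseteq> E (V y')" using V_mem[OF y] by blast
        have "\<not> E (V x') \<subseteq> E (V y')" using a y' x' V_mem[OF y] E_U[OF a(1)] by blast
        then have "V y' \<in> E (V x')" using IH[OF x'(1)] E_U[OF y'(1)] by blast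
        then obtain w where "w \<in> E x'" "E (V y') \<subseteq> E (V w)" using V_mem[OF E_U[OF x'(1)]] by blast
        then show "b \<in> E (V x')" using y' V_mem[OF E_U[OF x'(1)]] E_U[OF b] by blast
      qed
      then have "V y \<in> E (V x)" using V_mem[OF x] x' y V_U by blast
      then show False using neg by blast
    qed
  qed
  then show ?thesis using assms(2) by blast
qed

text \<open>Scott's trick, with the hierarchy \<open>V\<close> indexed by arbitrary sets instead of ordinals.\<close>

definition scott :: "('a \<Rightarrow> bool) \<Rightarrow> 'a set" where
  "scott P = {y \<in> U. P y \<and> (\<forall>z\<in>U. P z \<longrightarrow> E (V y) \<subseteq> E (V z))}"

lemma Def_scott [Dintro]:
  assumes "Tm f" "Def (\<lambda>s. P (s 0) (pop s))"
  shows "Def (\<lambda>s. f s \<in> scott (\<lambda>y. P y s))"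
proof -
  have *: "Def (\<lambda>s. P (s 0) (\<lambda>i. s (Suc (Suc i))))"
    using Def_ren[OF assms(2), of "\<lambda>i. if i = 0 then 0 else Suc i"] by simp
  have "Def (\<lambda>s. \<exists>y\<in>U. y = f s \<and> P y s \<and> (\<forall>z\<in>U. P z s \<longrightarrow> E (V y) \<subseteq> E (V z)))"
    by (intro Dintro Tm_ren[OF assms(1)] assms(2) *)
  then show ?thesis by (rule Def_cong) (auto simp: scott_def Tm_U[OF assms(1)])
qed

lemma S_scott: assumes "Def1 P" shows "S (scott P)"
proof (cases "\<exists>y\<in>U. P y")
  case True
  then obtain y where y: "y \<in> U" "P y" by blast
  show ?thesis
  proof (rule S_Def_sub[of "pw (V y)"])
    show "scott P \<subseteq> E (pw (V y))" using y V_sub by (auto simp: scott_def)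
    show "Def (\<lambda>s. s 0 \<in> scott P)" using Def_scott[of "\<lambda>s. s 0" "\<lambda>y s. P y"] assms Tm_var by simp
  qed (use y in simp)
next
  case False
  then have "scott P = {}" by (auto simp: scott_def)
  then show ?thesis by simp
qed

text \<open>If no \<open>V y\<close> were least, \<open>V_linear\<close> would turn each failing
  inclusion into a membership and yield a descent through values of \<open>V\<close>. The induction
  therefore runs on such a value \<open>v\<close>, not on \<open>y\<close>.\<close>

lemma scott_ne: assumes "Def1 P" "y \<in> U" "P y" shows "scott P \<noteq> {}"
proof
  assume e: "scott P = {}"
  have [Dintro]: "Def (\<lambda>s. P (f s))" if "Tm f" for f by (rule Def_Tm1[OF assms(1) that])
  have "\<forall>y\<in>U. P y \<longrightarrow> V y \<noteq> v" if "v \<in> U" for v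
    using that
  proof (induction rule: eps_induct)
    show "Def (\<lambda>s. \<forall>y\<in>U. P y \<longrightarrow> V y \<noteq> s 0)" by (intro Dintro)
  next
    fix v assume v: "v \<in> U" and IH: "\<And>w. w \<in> E v \<Longrightarrow> \<forall>y\<in>U. P y \<longrightarrow> V y \<noteq> w"
    show "\<forall>y\<in>U. P y \<longrightarrow> V y \<noteq> v"
    proof (intro ballI impI notI)
      fix y assume y: "y \<in> U" "P y" "V y = v"
      then obtain z where "z \<in> U" "P z" "\<not> E (V y) \<subseteq> E (V z)" using e unfolding scott_def by blast
      then show False using V_linear[OF y(1)] IH y by blast
    qed
  qed
  then show False using assms V_U by blast
qed

lemma Tm_scott [Dintro]:
  assumes "Def (\<lambda>s. P (s 0) (pop s))"
  shows "Tm (\<lambda>s. mk (scott (\<lambda>y. P y s)))"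
proof (rule Tm_mk)
  have *: "Def (\<lambda>s. P (s 0) (\<lambda>i. s (Suc (Suc i))))"
    using Def_ren[OF assms, of "\<lambda>i. if i = 0 then 0 else Suc i"] by simp
  show "Def (\<lambda>s. s 0 \<in> scott (\<lambda>y. P y (pop s)))" by (intro Dintro *)
  fix s assume s: "env s"
  have "Def (\<lambda>t. P (t 0) s)"
    using Def_fill[OF assms, of "\<lambda>k. case k of 0 \<Rightarrow> Inl 0 | Suc k \<Rightarrow> Inr (s k)"] s
    by (simp add: fill_def slots_def split: nat.splits)
  then show "S (scott (\<lambda>y. P y s))" by (rule S_scott)
qed

section \<open>Collection, choice and dependent choice for definable relations\<close>

lemma Def_inst1: "Def2 R \<Longrightarrow> a \<in> U \<Longrightarrow> Def (\<lambda>s. R a (s 0))"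
  by (rule Def_Tm2[of R "\<lambda>s. a" "\<lambda>s. s 0"]) (simp_all add: Tm_const Tm_var)

text \<open>The set of least-rank witnesses for \<open>a\<close> is a definable term of
  \<open>a\<close>, so Replacement applies to it although no single witness is singled out.\<close>

lemma collection:
  assumes "x \<in> U" and R: "Def2 R" and ex: "\<forall>a\<in>E x. \<exists>b\<in>U. R a b"
  shows "\<exists>c\<in>U. \<forall>a\<in>E x. \<exists>b\<in>E c. R a b"
proof -
  have R': "Def (\<lambda>s. R (s 1) (s 0))" using Def_ren[OF R, of "\<lambda>i. 1 - i"] by simp
  have T: "Tm (\<lambda>s. mk (scott (R (s 0))))" using Tm_scott[of "\<lambda>y s. R (s 0) y"] R' by simp
  note im = image_mk[OF assms(1) T]
  have "\<exists>b\<in>E (un (mk ((\<lambda>a. mk (scott (R a))) ` E x))). R a b" if a: "a \<in> E x" for a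
  proof -
    obtain b where b: "b \<in> scott (R a)"
      using a scott_ne[OF Def_inst1[OF R E_U[OF a]]] ex by blast
    then show "\<exists>b\<in>E (un (mk ((\<lambda>a. mk (scott (R a))) ` E x))). R a b"
      using E_mk[OF S_scott[OF Def_inst1[OF R E_U[OF a]]]] im a by (auto simp: scott_def)
  qed
  then show ?thesis using im(1) un(1) by blast
qed

text \<open>Collection bounds the witnesses by a set \<open>d\<close>. Tagging the candidates for
  \<open>a\<close> with \<open>a\<close> makes the family \<open>Y\<close> disjoint, as
  \<open>ax_choice\<close> demands; the transversal is read back as a definable function, with value
  \<open>emp\<close> outside \<open>x\<close> to make it total.\<close>

lemma choice:
  assumes "x \<in> U" and R: "Def2 R" and ex: "\<forall>a\<in>E x. \<exists>b\<in>U. R a b"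
  shows "\<exists>g. Tm1 g \<and> (\<forall>a\<in>E x. R a (g a))"
proof -
  obtain d where d: "d \<in> U" "\<forall>a\<in>E x. \<exists>b\<in>E d. R a b" using collection[OF assms] by blast
  note [Dintro] = Def_Tm2[OF R]
  define Y where "Y a = mk {z \<in> E (prd x d). \<exists>b\<in>U. z = op a b \<and> R a b}" for a
  note p = prd[OF assms(1) d(1)]
  have SY: "S {z \<in> E (prd x d). \<exists>b\<in>U. z = op a b \<and> R a b}" if "a \<in> U" for a
    by (intro S_sep Dintro that p)
  have Y: "Y a \<in> U" "E (Y a) = {z \<in> E (prd x d). \<exists>b\<in>U. z = op a b \<and> R a b}" if "a \<in> U" for a
    using mk_S[OF SY[OF that]] by (auto simp: Y_def)
  have "Tm1 Y" unfolding Y_def by (intro Tm_mk SY envD Dintro p)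
  note im = image_mk[OF assms(1) this]
  have ac: "ax_choice M" using ZFC by (simp add: ZFC_def)
  have "\<exists>c\<in>U. \<forall>y\<in>E (mk (Y ` E x)). \<exists>!z. z \<in> E y \<and> z \<in> E c"
  proof -
    have "E y \<noteq> {} \<and> y \<in> U" if y: "y \<in> E (mk (Y ` E x))" for y
    proof -
      obtain a where a: "a \<in> E x" "y = Y a" using y im by blast
      then obtain b where "b \<in> E d" "R a b" using d by blast
      then have "op a b \<in> E (Y a)" using Y[OF E_U[OF a(1)]] a p E_U by auto
      then show ?thesis using Y[OF E_U[OF a(1)]] a by auto
    qed
    moreover have "E y \<inter> E z = {}" if yz: "y \<in> E (mk (Y ` E x))" "z \<in> E (mk (Y ` E x))" "y \<noteq> z" for y z
    proof -
      obtain a b where "a \<in> E x" "y = Y a" "b \<in> E x" "z = Y b" using yz im by blast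
      moreover from this yz have "a \<noteq> b" by blast
      ultimately show ?thesis using Y E_U by auto
    qed
    ultimately show ?thesis
      using ac[unfolded ax_choice_def is_set_iff, rule_format, of "mk (Y ` E x)"] im(1) by blast
  qed
  then obtain c where c: "c \<in> U" "\<And>a. a \<in> E x \<Longrightarrow> \<exists>!z. z \<in> E (Y a) \<and> z \<in> E c" using im by auto
  define Q where "Q b a \<longleftrightarrow> (a \<in> E x \<and> op a b \<in> E c \<and> op a b \<in> E (prd x d) \<and> R a b) \<or> (a \<notin> E x \<and> b = emp)" for b a
  have Q: "\<exists>b\<in>U. Q b a \<and> (\<forall>b'\<in>U. Q b' a \<longrightarrow> b' = b)" if aU: "a \<in> U" for a
  proof (cases "a \<in> E x")
    case True
    obtain z where z: "z \<in> E (Y a)" "z \<in> E c" "\<And>z'. z' \<in> E (Y a) \<Longrightarrow> z' \<in> E c \<Longrightarrow> z' = z"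
      using c(2)[OF True] by blast
    then obtain b where b: "b \<in> U" "z = op a b" "R a b" "z \<in> E (prd x d)"
      unfolding Y(2)[OF aU] by blast
    moreover have "b' = b" if "b' \<in> U" "Q b' a" for b'
    proof -
      have "op a b' = z" using z(3)[of "op a b'"] that True Y[OF \<open>a \<in> U\<close>] by (auto simp: Q_def)
      then show ?thesis using b that \<open>a \<in> U\<close> by simp
    qed
    moreover have "Q b a" using b z(2) True by (simp add: Q_def)
    ultimately show ?thesis by blast
  qed (auto simp: Q_def)
  define g where "g a = (THE b. b \<in> U \<and> Q b a)" for a
  have "Tm1 g" unfolding g_def
    by (rule Tm_the) (unfold Q_def, intro Dintro c assms(1) p emp, use Q in \<open>unfold Q_def, simp\<close>)
  moreover have "R a (g a)" if "a \<in> E x" for a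
  proof -
    have "\<exists>!b. b \<in> U \<and> Q b a" using Q[OF E_U[OF that]] by blast
    from theI'[OF this] show ?thesis using that by (auto simp: g_def Q_def)
  qed
  ultimately show ?thesis by blast
qed

lemma gr_Tm [Dintro]: assumes "Tm1 F" "Tm f" shows "Tm (\<lambda>s. gr F (f s))"
  unfolding gr_def by (intro Tm_image Tm_op Tm_var assms)

text \<open>The values of the sequence are kept inside sets \<open>D l\<close>, so that one choice function suffices.\<close>

lemma dependent_choice:
  assumes k: "trans k" and R: "Def2 R"
    and ex: "\<And>l F. l \<in> E k \<Longrightarrow> Tm1 F \<Longrightarrow> (\<forall>i\<in>E l. R (gr F i) (F i)) \<Longrightarrow>
      \<exists>y\<in>U. R (gr F l) y"
  shows "\<exists>F. Tm1 F \<and> (\<forall>l\<in>E k. R (gr F l) (F l))"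
proof -
  have kU: "k \<in> U" using k by (simp add: trans_def)
  have R': "Def (\<lambda>s. R (s 1) (s 0))" using Def_ren[OF R, of "\<lambda>i. 1 - i"] by simp
  define sc where "sc h = mk (scott (R h))" for h
  have Tsc: "Tm1 sc" unfolding sc_def using Tm_scott[of "\<lambda>y s. R (s 0) y"] R' by simp
  have sc: "sc h \<in> U" "E (sc h) = scott (R h)" if "h \<in> U" for h
    using mk_S[OF S_scott[OF Def_inst1[OF R that]]] by (auto simp: sc_def)
  \<comment> \<open>\<open>D l\<close> will collect the least-rank successors of all possible
    histories on \<open>l\<close> with values in the earlier \<open>D i\<close>. This involves no
    choice and confines the histories to the set \<open>?X\<close>, over which one choice function
    is taken.\<close>
  have "Tm (\<lambda>s. un (mk (sc ` E (pw (prd (s 1) (un (s 2)))))))" by (intro Dintro Tsc)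
  then obtain D0 where D0: "Tm2 D0"
      "\<forall>q\<in>U. \<forall>x\<in>U. D0 q x = un (mk (sc ` E (pw (prd x (un (mk (D0 q ` E x)))))))"
    using eps_rec_image[of "\<lambda>q x f. un (mk (sc ` E (pw (prd x (un f)))))"] by blast
  define D where "D = D0 emp"
  have TD: "Tm1 D" unfolding D_def by (rule Tm_inst1[OF D0(1)]) simp
  define Z where "Z x = un (mk (D ` E x))" for x
  have Z: "Z x \<in> U" "E (Z x) = (\<Union>y\<in>E x. E (D y))" if "x \<in> U" for x
    using image_mk[OF that TD] by (auto simp: Z_def)
  have D: "E (D x) = (\<Union>h\<in>{h\<in>U. E h \<subseteq> E (prd x (Z x))}. scott (R h))" if "x \<in> U" for x
  proof -
    have "D x = un (mk (sc ` E (pw (prd x (Z x)))))" using D0 that by (simp add: D_def Z_def)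
    moreover have "pw (prd x (Z x)) \<in> U" using prd Z that by simp
    ultimately have "E (D x) = (\<Union>h\<in>E (pw (prd x (Z x))). E (sc h))"
      using image_mk[OF _ Tsc] by simp
    then show ?thesis using prd(1) Z(1) that sc by simp
  qed
  let ?X = "pw (prd k (Z k))"
  have XU: "?X \<in> U" using prd Z kU by simp
  have "Def (\<lambda>s. \<exists>y\<in>U. R (s 0) y)" by (intro Dintro) (use R' in simp)
  from S_sep[OF XU this] obtain X where X: "X \<in> U" "E X = {h \<in> E ?X. \<exists>y\<in>U. R h y}"
    by (auto simp: S_def)
  have "\<exists>g. Tm1 g \<and> (\<forall>h\<in>E X. g h \<in> scott (R h))"
  proof (rule choice[OF X(1)])
    show "Def (\<lambda>s. s 1 \<in> scott (R (s 0)))"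
      by (rule Def_scott) (intro Dintro, use Def_ren[OF R, of "\<lambda>i. 1 - i"] in simp)
    show "\<forall>h\<in>E X. \<exists>b\<in>U. b \<in> scott (R h)"
    proof
      fix h assume h: "h \<in> E X"
      then obtain y where "y \<in> U" "R h y" using X(2) by blast
      from scott_ne[OF Def_inst1[OF R E_U[OF h]] this] show "\<exists>b\<in>U. b \<in> scott (R h)"
        by (auto simp: scott_def)
    qed
  qed
  then obtain g where g: "Tm1 g" "\<And>h. h \<in> E X \<Longrightarrow> g h \<in> scott (R h)" by blast
  have "Tm (\<lambda>s. g (s 2))" by (intro Tm_comp1[OF g(1)] Dintro)
  then obtain F0 where F0: "Tm2 F0" "\<forall>q\<in>U. \<forall>x\<in>U. F0 q x = g (gr (F0 q) x)"
    using eps_rec[of "\<lambda>q x f. g f"] by blast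
  define F where "F = F0 emp"
  have TF: "Tm1 F" unfolding F_def by (rule Tm_inst1[OF F0(1)]) simp
  have F: "F x = g (gr F x)" if "x \<in> U" for x using F0 that by (simp add: F_def)
  note [Dintro] = Tm_comp1[OF TF] Tm_comp1[OF TD] Def_Tm2[OF R]
  have "l \<in> E k \<longrightarrow> F l \<in> E (D l) \<and> R (gr F l) (F l)" if "l \<in> U" for l
    using that
  proof (induction rule: eps_induct)
    show "Def (\<lambda>s. s 0 \<in> E k \<longrightarrow> F (s 0) \<in> E (D (s 0)) \<and> R (gr F (s 0)) (F (s 0)))"
      by (intro Dintro kU TF)
  next
    fix l assume a: "l \<in> U" and IH: "\<And>i. i \<in> E l \<Longrightarrow> i \<in> E k \<longrightarrow> F i \<in> E (D i) \<and> R (gr F i) (F i)"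
    show "l \<in> E k \<longrightarrow> F l \<in> E (D l) \<and> R (gr F l) (F l)"
    proof
      assume ak: "l \<in> E k"
      have IH': "i \<in> E k \<and> F i \<in> E (D i) \<and> R (gr F i) (F i)" if "i \<in> E l" for i
        using IH[OF that] ak k that by (auto simp: trans_def)
      note h = gr[OF TF a]
      have "\<exists>y\<in>U. R (gr F l) y" using ex[OF ak TF] IH' by blast
      \<comment> \<open>This bound yields membership in \<open>D l\<close>; the next one, with
        \<open>k\<close>, puts the history into \<open>X\<close>, where \<open>g\<close> chooses
        correctly.\<close>
      moreover have "E (gr F l) \<subseteq> E (prd l (Z l))"
        unfolding h(2) prd(2)[OF a Z(1)[OF a]] using IH' Z(2)[OF a] E_U
          by (auto intro!: op Tm1_U[OF TF])
      moreover have "E (gr F l) \<subseteq> E (prd k (Z k))"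
        unfolding h(2) prd(2)[OF kU Z(1)[OF kU]] using IH' Z(2)[OF kU] E_U
        by (auto intro!: op Tm1_U[OF TF])
      ultimately have "F l \<in> scott (R (gr F l))" using F[OF a] g(2) X h(1) prd(1)[OF kU Z(1)[OF kU]] by simp
      then show "F l \<in> E (D l) \<and> R (gr F l) (F l)"
        using \<open>E (gr F l) \<subseteq> E (prd l (Z l))\<close> D[OF a] h(1) by (auto simp: scott_def)
    qed
  qed
  then show ?thesis using TF E_U by blast
qed

section \<open>Permutations of urelements\<close>

text \<open>A nonempty set codes a set of the new model if it contains \<open>emp\<close>, its coded members being
  its other elements, and a urelement otherwise. An ordered pair never contains \<open>emp\<close>.\<close>

definition perm :: "('a \<Rightarrow> 'a \<Rightarrow> 'a) \<Rightarrow> bool" where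
  "perm h \<longleftrightarrow> Tm2 h \<and> (\<forall>q\<in>U. h q emp = emp) \<and>
    (\<forall>q\<in>U. \<forall>x\<in>U. emp \<notin> E x \<longrightarrow> emp \<notin> E (h q x) \<and> h q (h q x) = x)"

text \<open>For a \<open>perm h\<close> the marker \<open>emp\<close> is fixed, so the extension
  keeps codes of sets and urelements apart and respects coded membership.\<close>

definition act :: "('a \<Rightarrow> 'a \<Rightarrow> 'a) \<Rightarrow> 'a \<Rightarrow> 'a \<Rightarrow> 'a" where
  "act h = (SOME F. Tm2 F \<and>
    (\<forall>q\<in>U. \<forall>x\<in>U. F q x = (if emp \<in> E x then mk (F q ` E x) else h q x)))"

lemma act_spec:
  assumes "perm h"
  shows "Tm (\<lambda>s. act h (s 0) (s 1)) \<and>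
    (\<forall>q\<in>U. \<forall>x\<in>U. act h q x = (if emp \<in> E x then mk (act h q ` E x) else h q x))"
proof -
  have h: "Tm2 h" using assms by (simp add: perm_def)
  have "Tm (\<lambda>s. if emp \<in> E (s 1) then s 2 else h (s 0) (s 1))"
    by (intro Tm_if Def_mem Tm_const Tm_var Tm_comp2[OF h] emp)
  from someI_ex[OF eps_rec_image[of "\<lambda>q x f. if emp \<in> E x then f else h q x", OF this]]
  show ?thesis unfolding act_def .
qed

context
  fixes h q assumes h: "perm h" and q: "q \<in> U"
begin

lemma Tm_act1: "Tm (\<lambda>s. act h q (s 0))"
  using Tm_inst1[OF act_spec[OF h, THEN conjunct1] q] .

lemma act_U [simp]: "x \<in> U \<Longrightarrow> act h q x \<in> U"
  using Tm1_U[OF Tm_act1] .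

lemma act_ure: "x \<in> U \<Longrightarrow> emp \<notin> E x \<Longrightarrow> act h q x = h q x"
  using act_spec[OF h] q by simp

lemma act_set: "x \<in> U \<Longrightarrow> emp \<in> E x \<Longrightarrow> E (act h q x) = act h q ` E x"
  using act_spec[OF h] q image_mk(2)[OF _ Tm_act1] by simp

lemma act_emp [simp]: "act h q emp = emp"
  using act_ure[of emp] h q by (simp add: perm_def)

lemma act_marker [simp]: assumes "x \<in> U" shows "emp \<in> E (act h q x) \<longleftrightarrow> emp \<in> E x"
proof (cases "emp \<in> E x")
  case True
  then have "act h q emp \<in> E (act h q x)" using act_set[OF assms True] by blast
  then show ?thesis using True by simp
next
  case False
  then show ?thesis using act_ure[OF assms] h q assms by (simp add: perm_def)
qed

lemma act_act [simp]: "x \<in> U \<Longrightarrow> act h q (act h q x) = x"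
proof (induction rule: eps_induct)
  show "Def (\<lambda>s. act h q (act h q (s 0)) = s 0)"
    by (intro Dintro Tm_comp1[OF Tm_act1])
next
  fix x assume x: "x \<in> U" and IH: "\<And>y. y \<in> E x \<Longrightarrow> act h q (act h q y) = y"
  show "act h q (act h q x) = x"
  proof (cases "emp \<in> E x")
    case True
    have "E (act h q (act h q x)) = act h q ` act h q ` E x"
      using act_set[OF act_U[OF x]] act_set[OF x True] x True by (metis act_marker)
    also have "\<dots> = E x" using IH by (force simp: image_image)
    finally show ?thesis using x by (intro ext) auto
  next
    case False
    then show ?thesis using act_ure[OF x] act_ure[of "h q x"] act_marker[OF x] act_U[OF x] h q x
      by (simp add: perm_def)
  qed
qed

lemma act_inj: "x \<in> U \<Longrightarrow> y \<in> U \<Longrightarrow> act h q x = act h q y \<Longrightarrow> x = y"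
  by (metis act_act)

lemma act_emp_iff [simp]: "x \<in> U \<Longrightarrow> act h q x = emp \<longleftrightarrow> x = emp"
  by (metis act_act act_emp)

lemma act_mem: assumes "x \<in> U" "y \<in> U" "emp \<in> E x"
  shows "act h q y \<in> E (act h q x) \<longleftrightarrow> y \<in> E x"
proof
  assume "act h q y \<in> E (act h q x)"
  then obtain z where "z \<in> E x" "act h q y = act h q z" using act_set[OF assms(1,3)] by blast
  then show "y \<in> E x" using act_inj[OF assms(2) E_U] by simp
qed (use act_set[OF assms(1,3)] in blast)

text \<open>Meant for a transitive set around a parameter: only the urelements lying in
  \<open>T\<close> matter, and transitivity keeps the induction inside \<open>T\<close>.\<close>

lemma act_fix:
  assumes T: "trans T" and fx: "\<And>z. z \<in> E T \<Longrightarrow> emp \<notin> E z \<Longrightarrow> h q z = z" and z: "z \<in> E T"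
  shows "act h q z = z"
proof -
  have TU: "T \<in> U" using T by (simp add: trans_def)
  have "z \<in> E T \<longrightarrow> act h q z = z"
    using E_U[OF z]
  proof (induction rule: eps_induct)
    show "Def (\<lambda>s. s 0 \<in> E T \<longrightarrow> act h q (s 0) = s 0)" by (intro Dintro Tm_comp1[OF Tm_act1] TU)
  next
    fix x assume x: "x \<in> U" and IH: "\<And>y. y \<in> E x \<Longrightarrow> y \<in> E T \<longrightarrow> act h q y = y"
    show "x \<in> E T \<longrightarrow> act h q x = x"
    proof
      assume xT: "x \<in> E T"
      show "act h q x = x"
      proof (cases "emp \<in> E x")
        case True
        have "act h q ` E x = E x" using IH xT T by (force simp: trans_def)
        then show ?thesis using act_set[OF x True] x by (intro ext) auto
      next
        case False
        then show ?thesis using act_ure[OF x] fx[OF xT] by simp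
      qed
    qed
  qed
  then show ?thesis using z by blast
qed

end

lemma Tm_act: assumes "perm h" "Tm f" "Tm g" shows "Tm (\<lambda>s. act h (f s) (g s))"
  by (rule Tm_comp2[OF act_spec[OF assms(1), THEN conjunct1] assms(2,3)])

section \<open>Ordered pairs as urelements: flips, shifts and swaps\<close>

definition isp where "isp x \<longleftrightarrow> (\<exists>a\<in>U. \<exists>b\<in>U. x = op a b)"
text \<open>Objects that are not pairs receive the default \<open>emp\<close>, which makes the
  projections total definable terms.\<close>

definition p1 where "p1 x = (THE a. a \<in> U \<and> ((\<exists>b\<in>U. x = op a b) \<or> (\<not> isp x \<and> a = emp)))"
definition p2 where "p2 x = (THE b. b \<in> U \<and> ((\<exists>a\<in>U. x = op a b) \<or> (\<not> isp x \<and> b = emp)))"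

lemma Def_isp [Dintro]: assumes "Tm f" shows "Def (\<lambda>s. isp (f s))"
  by (rule Def_Tm1[OF _ assms]) (unfold isp_def, intro Dintro)

lemma Tm_p1 [Dintro]: assumes "Tm f" shows "Tm (\<lambda>s. p1 (f s))"
proof (rule Tm_comp1[OF _ assms])
  show "Tm1 p1"
    unfolding p1_def
  proof (rule Tm_the)
    fix s assume "env s"
    show "\<exists>y\<in>U. ((\<exists>b\<in>U. s 0 = op y b) \<or> \<not> isp (s 0) \<and> y = emp) \<and>
       (\<forall>z\<in>U. (\<exists>b\<in>U. s 0 = op z b) \<or> \<not> isp (s 0) \<and> z = emp \<longrightarrow> z = y)"
    proof (cases "isp (s 0)")
      case True
      then obtain a b where "a \<in> U" "b \<in> U" "s 0 = op a b" by (auto simp: isp_def)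
      then show ?thesis using True by (intro bexI[of _ a]) auto
    qed (auto simp: isp_def)
  qed (intro Dintro emp)
qed

lemma Tm_p2 [Dintro]: assumes "Tm f" shows "Tm (\<lambda>s. p2 (f s))"
proof (rule Tm_comp1[OF _ assms])
  show "Tm1 p2"
    unfolding p2_def
  proof (rule Tm_the)
    fix s assume "env s"
    show "\<exists>y\<in>U. ((\<exists>b\<in>U. s 0 = op b y) \<or> \<not> isp (s 0) \<and> y = emp) \<and>
       (\<forall>z\<in>U. (\<exists>b\<in>U. s 0 = op b z) \<or> \<not> isp (s 0) \<and> z = emp \<longrightarrow> z = y)"
    proof (cases "isp (s 0)")
      case True
      then obtain a b where "a \<in> U" "b \<in> U" "s 0 = op a b" by (auto simp: isp_def)
      then show ?thesis using True by (intro bexI[of _ b]) auto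
    qed (auto simp: isp_def)
  qed (intro Dintro emp)
qed

lemma isp_op [simp]: "a \<in> U \<Longrightarrow> b \<in> U \<Longrightarrow> isp (op a b)" by (auto simp: isp_def)

lemma p12_op [simp]: assumes "a \<in> U" "b \<in> U" shows "p1 (op a b) = a" "p2 (op a b) = b"
  unfolding p1_def p2_def using assms by (auto intro!: the_equality)

lemma p1_U [simp]: "x \<in> U \<Longrightarrow> p1 x \<in> U"
  using Tm1_U[OF Tm_p1[OF Tm_var]] .

lemma p2_U [simp]: "x \<in> U \<Longrightarrow> p2 x \<in> U"
  using Tm1_U[OF Tm_p2[OF Tm_var]] .

lemma ispE: assumes "isp x" obtains a b where "a \<in> U" "b \<in> U" "x = op a b"
  using assms by (auto simp: isp_def)

lemma op_no_marker [simp]: "a \<in> U \<Longrightarrow> b \<in> U \<Longrightarrow> emp \<notin> E (op a b)"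
proof -
  assume ab: "a \<in> U" "b \<in> U"
  have "E (up a a) \<noteq> E emp" "E (up a b) \<noteq> E emp" using ab by simp_all
  then have "up a a \<noteq> emp" "up a b \<noteq> emp" by metis+
  then show ?thesis using ab by (auto simp: op_E)
qed

lemma not_isp_emp [simp]: "\<not> isp emp"
proof
  assume "isp emp"
  then obtain a b where ab: "a \<in> U" "b \<in> U" "emp = op a b" by (rule ispE)
  then have "E emp = {up a a, up a b}" using op_E by metis
  then show False by simp
qed

text \<open>Symmetric difference with the singleton of \<open>c\<close>: an involution, and any two
  of them commute. Flips and shifts inherit their commutation from this.\<close>

definition tog where "tog c r = mk {z \<in> U. (z \<in> E r \<and> z \<noteq> c) \<or> (z = c \<and> z \<notin> E r)}"

lemma S_tog: "c \<in> U \<Longrightarrow> r \<in> U \<Longrightarrow> S {z \<in> U. (z \<in> E r \<and> z \<noteq> c) \<or> (z = c \<and> z \<notin> E r)}"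
  by (rule S_Def_sub[of "un (up r (up c c))"]) (auto intro!: Dintro)

lemma tog: "c \<in> U \<Longrightarrow> r \<in> U \<Longrightarrow> tog c r \<in> U"
  "c \<in> U \<Longrightarrow> r \<in> U \<Longrightarrow> E (tog c r) = {z \<in> U. (z \<in> E r \<and> z \<noteq> c) \<or> (z = c \<and> z \<notin> E r)}"
  using mk_S[OF S_tog] by (simp_all add: tog_def)

declare tog(1) [simp]

lemma Tm_tog [Dintro]: assumes "Tm f" "Tm g" shows "Tm (\<lambda>s. tog (f s) (g s))"
proof (rule Tm_comp2[OF _ assms])
  show "Tm2 tog" unfolding tog_def by (intro Tm_mk S_tog envD Dintro)
qed

lemma tog_tog [simp]: assumes "c \<in> U" "r \<in> U" shows "tog c (tog c r) = r"
  by (rule ext) (use assms E_U in \<open>auto simp: tog\<close>)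

lemma tog_comm: assumes "c \<in> U" "d \<in> U" "r \<in> U" shows "tog c (tog d r) = tog d (tog c r)"
  by (rule ext) (use assms E_U in \<open>auto simp: tog\<close>)

definition pmap where
  "pmap f g x = (if isp x then op (f (p1 x)) (g (p1 x) (p2 x)) else x)"

text \<open>\<open>q\<close> codes two colours, which are exchanged in the first component of an
  index; an index that is not a pair has no colour.\<close>

definition hat where
  "hat q p = (if isp p then op (if p1 p = p1 q then p2 q else if p1 p = p2 q then p1 q else p1 p) (p2 p) else p)"

text \<open>The argument \<open>q\<close> is read differently each time: an index for
  \<open>flip\<close>, a colour together with the element to be toggled for \<open>shift\<close>,
  two colours for \<open>swap\<close>.\<close>

definition flip where
  "flip q = pmap (\<lambda>p. p) (\<lambda>p r. if p = q then tog emp r else r)"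
definition shift where
  "shift q = pmap (\<lambda>p. p) (\<lambda>p r. if isp p \<and> p1 p = p1 q then tog (p2 q) r else r)"
definition swap where
  "swap q = pmap (hat q) (\<lambda>p r. r)"

lemma pmap_op: "p \<in> U \<Longrightarrow> r \<in> U \<Longrightarrow> pmap f g (op p r) = op (f p) (g p r)"
  by (simp add: pmap_def)

lemma not_isp [simp]: "\<not> isp x \<Longrightarrow> flip q x = x" "\<not> isp x \<Longrightarrow> shift q x = x"
  "\<not> isp x \<Longrightarrow> swap q x = x" "\<not> isp p \<Longrightarrow> hat q p = p"
  by (simp_all add: flip_def shift_def swap_def hat_def pmap_def)

lemma flip_op: "p \<in> U \<Longrightarrow> r \<in> U \<Longrightarrow> flip q (op p r) = (if p = q then op p (tog emp r) else op p r)"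
  by (simp add: flip_def pmap_op)

lemma shift_op: "p \<in> U \<Longrightarrow> r \<in> U \<Longrightarrow>
   shift q (op p r) = (if isp p \<and> p1 p = p1 q then op p (tog (p2 q) r) else op p r)"
  by (simp add: shift_def pmap_op)

lemma swap_op: "p \<in> U \<Longrightarrow> r \<in> U \<Longrightarrow> swap q (op p r) = op (hat q p) r"
  by (simp add: swap_def pmap_op)

lemma Tm_hat [Dintro]: "Tm f \<Longrightarrow> Tm g \<Longrightarrow> Tm (\<lambda>s. hat (f s) (g s))"
  unfolding hat_def by (intro Dintro)

lemma hat_U [simp]: "q \<in> U \<Longrightarrow> p \<in> U \<Longrightarrow> hat q p \<in> U" by (simp add: hat_def)

lemma hat_hat [simp]: assumes "q \<in> U" "p \<in> U" shows "hat q (hat q p) = p"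
proof (cases "isp p")
  case True
  then obtain a b where "a \<in> U" "b \<in> U" "p = op a b" by (rule ispE)
  then show ?thesis using assms by (simp add: hat_def)
qed simp

lemma perm_pmap:
  assumes "Tm2 h" "\<And>q. h q = pmap (f q) (g q)"
    and "\<And>q p. q \<in> U \<Longrightarrow> p \<in> U \<Longrightarrow> f q p \<in> U \<and> f q (f q p) = p"
    and "\<And>q p r. q \<in> U \<Longrightarrow> p \<in> U \<Longrightarrow> r \<in> U \<Longrightarrow> g q p r \<in> U \<and> g q (f q p) (g q p r) = r"
  shows "perm h"
  unfolding perm_def
proof (intro conjI ballI impI)
  fix q x assume "q \<in> U" "x \<in> U" "emp \<notin> E x"
  then show "emp \<notin> E (h q x)" "h q (h q x) = x"
    unfolding assms(2) by (auto simp: pmap_def assms(3,4) elim!: ispE)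
qed (use assms in \<open>auto simp: pmap_def\<close>)

lemma perm_flip: "perm flip" and perm_shift: "perm shift" and perm_swap: "perm swap"
proof -
  have T: "Tm2 flip" "Tm2 shift" "Tm2 swap"
    unfolding flip_def shift_def swap_def pmap_def by (intro Dintro emp)+
  show "perm flip" by (rule perm_pmap[OF T(1) flip_def]) auto
  show "perm shift" by (rule perm_pmap[OF T(2) shift_def]) auto
  show "perm swap" by (rule perm_pmap[OF T(3) swap_def]) auto
qed

text \<open>\<open>a q\<close> is the action of \<open>h q\<close> on the indices of the flips.\<close>

definition compat :: "('a \<Rightarrow> 'a \<Rightarrow> 'a) \<Rightarrow> ('a \<Rightarrow> 'a \<Rightarrow> 'a) \<Rightarrow> bool" where
  "compat h a \<longleftrightarrow> perm h \<and> Tm2 a \<and>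
    (\<forall>q\<in>U. \<forall>p\<in>U. a q (a q p) = p) \<and>
    (\<forall>q\<in>U. \<forall>p\<in>U. \<forall>u\<in>U. h q (flip p u) = flip (a q p) (h q u))"

lemma compat_flip: "compat flip (\<lambda>q p. p)" and compat_shift: "compat shift (\<lambda>q p. p)"
  and compat_swap: "compat swap hat"
proof -
  have "flip q (flip p u) = flip p (flip q u) \<and> shift q (flip p u) = flip p (shift q u) \<and>
      swap q (flip p u) = flip (hat q p) (swap q u)" if qpu: "q \<in> U" "p \<in> U" "u \<in> U" for q p u
  proof (cases "isp u")
    case True
    then obtain a b where ab: "a \<in> U" "b \<in> U" "u = op a b" by (rule ispE)
    have "hat q a = hat q p \<longleftrightarrow> a = p" using hat_hat qpu ab(1) by metis
    then show ?thesis using qpu ab by (simp add: flip_op shift_op swap_op tog_comm)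
  qed simp
  then show "compat flip (\<lambda>q p. p)" "compat shift (\<lambda>q p. p)" "compat swap hat"
    unfolding compat_def using perm_flip perm_shift perm_swap Tm_hat[OF Tm_var Tm_var] Tm_var by simp_all
qed

abbreviation fl where "fl \<equiv> act flip"

lemma Tm_fl [Dintro]: "Tm f \<Longrightarrow> Tm g \<Longrightarrow> Tm (\<lambda>s. fl (f s) (g s))"
  by (rule Tm_act[OF perm_flip])

text \<open>Conjugation turns a flip into the flip at the moved index. For urelements this is part
  of \<open>compat\<close>, and membership induction lifts it to coded sets. Supports thereby move
  along with objects.\<close>

lemma act_flip_comm:
  assumes c: "compat h a" and q: "q \<in> U" and p: "p \<in> U" and "x \<in> U"
  shows "act h q (fl p x) = fl (a q p) (act h q x)"
  using assms(4)
proof (induction rule: eps_induct)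
  have h: "perm h" using c by (simp add: compat_def)
  have ap: "a q p \<in> U" using c q p Tm2_U[of a] by (simp add: compat_def)
  {
    show "Def (\<lambda>s. act h q (fl p (s 0)) = fl (a q p) (act h q (s 0)))"
      by (intro Dintro Tm_act[OF h] q p ap)
  next
    fix x assume x: "x \<in> U" and IH: "\<And>y. y \<in> E x \<Longrightarrow> act h q (fl p y) = fl (a q p) (act h q y)"
    show "act h q (fl p x) = fl (a q p) (act h q x)"
    proof (cases "emp \<in> E x")
      case True
      note pf = perm_flip
      have "E (act h q (fl p x)) = act h q ` fl p ` E x"
        using act_set[OF h q act_U[OF pf p x]] act_marker[OF pf p x] act_set[OF pf p x] True by simp
      also have "\<dots> = fl (a q p) ` act h q ` E x" using IH by (force simp: image_image)
      also have "\<dots> = E (fl (a q p) (act h q x))"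
        using act_set[OF pf ap act_U[OF h q x]] act_marker[OF h q x] act_set[OF h q x] True by simp
      finally show ?thesis using act_U h pf ap p q x by (intro ext) auto
    next
      case False
      note pf = perm_flip
      have 1: "fl p x = flip p x" "emp \<notin> E (flip p x)" "flip p x \<in> U"
        using act_ure[OF pf p x False] act_marker[OF pf p x] act_U[OF pf p x] False by auto
      have 2: "act h q x = h q x" "emp \<notin> E (h q x)" "h q x \<in> U"
        using act_ure[OF h q x False] act_marker[OF h q x] act_U[OF h q x] False by auto
      show ?thesis
        using act_ure[OF h q 1(3,2)] act_ure[OF pf ap 2(3,2)] 1(1) 2(1) c q p x by (simp add: compat_def)
    qed
  }
qed

end

section \<open>The symmetric model\<close>

locale symmetric_model = zfc_model +
  fixes \<kappa> :: 'a
  assumes kappa: "infinite_cardinal M \<kappa>"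
begin

lemma kappa_U [simp]: "\<kappa> \<in> U"
  using kappa by (simp add: infinite_cardinal_def ordinal_def trans_set_def)

lemma kappa_trans: "trans \<kappa>"
  using kappa by (simp add: infinite_cardinal_def ordinal_def trans_set_def trans_def)

text \<open>Adding \<open>emp\<close> and \<open>suc emp\<close> makes binary unions of supports a
  special case of \<open>K\<close>-indexed ones, without an inspection of the elements of
  \<open>\<kappa>\<close>.\<close>

definition K where "K = un (up \<kappa> (up emp (suc emp)))"

lemma K [simp]: "K \<in> U" "E K = E \<kappa> \<union> {emp, suc emp}" by (auto simp: K_def)

lemma op_in_prd:
  assumes "x \<in> U" "y \<in> U" "a \<in> E x" "b \<in> E y" shows "op a b \<in> E (prd x y)"
  unfolding prd(2)[OF assms(1,2)] using assms(3,4) op[OF E_U[OF assms(3)] E_U[OF assms(4)]] by blast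

text \<open>Iterates the map from \<open>y\<close> to the union of \<open>y\<close> with the product
  of \<open>K\<close> and \<open>y\<close>, starting from the singleton of \<open>emp\<close>. Each
  element of the union appears at some stage, and the next stage contains its pairs.\<close>

lemma ex_W: "\<exists>W\<in>U. emp \<in> E W \<and> (\<forall>a\<in>E K. \<forall>w\<in>E W. op a w \<in> E W)"
proof -
  have "Tm (\<lambda>s. un (up (s 0) (prd K (s 0))))" by (intro Dintro K)
  moreover have "up emp emp \<in> U" by simp
  ultimately obtain t where t: "t \<in> U" "up emp emp \<in> E t"
      "\<forall>y\<in>E t. un (up y (prd K y)) \<in> E t"
    using ex_iteration[of "\<lambda>y. un (up y (prd K y))" "up emp emp"] by blast
  have "op a w \<in> E (un t)" if aw: "a \<in> E K" "w \<in> E (un t)" for a w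
  proof -
    obtain y where y: "y \<in> E t" "w \<in> E y" using aw t by auto
    then have "op a w \<in> E (prd K y)" using aw op_in_prd K(1) E_U by blast
    then have "op a w \<in> E (un (up y (prd K y)))" using prd(1) y E_U[OF y(1)] by simp
    then show ?thesis using t(1,3) y(1) by auto
  qed
  moreover have "emp \<in> E (un t)" unfolding un(2)[OF t(1)] using t(2) up(2)[OF emp(1) emp(1)] by blast
  ultimately show ?thesis using t(1) un(1) by blast
qed

definition W where "W = (SOME W. W \<in> U \<and> emp \<in> E W \<and> (\<forall>a\<in>E K. \<forall>w\<in>E W. op a w \<in> E W))"

lemma W: "W \<in> U" "emp \<in> E W" "a \<in> E K \<Longrightarrow> w \<in> E W \<Longrightarrow> op a w \<in> E W"
proof -
  have "W \<in> U \<and> emp \<in> E W \<and> (\<forall>a\<in>E K. \<forall>w\<in>E W. op a w \<in> E W)"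
    unfolding W_def by (rule someI_ex) (use ex_W in blast)
  then show "W \<in> U" "emp \<in> E W" "a \<in> E K \<Longrightarrow> w \<in> E W \<Longrightarrow> op a w \<in> E W" by blast+
qed

text \<open>A support is coded by a function \<open>f\<close> with domain in \<open>W\<close>; its indices are those covered by \<open>f\<close>.
  Since \<open>K \<times> W \<subseteq> W\<close>, supports are closed under \<open>K\<close>-indexed unions, but by Cantor's theorem they cannot
  cover the power set of \<open>W\<close>.\<close>

definition cov where "cov f p \<longleftrightarrow> (\<exists>w\<in>E W. op w p \<in> E f)"
definition fn where
  "fn f \<longleftrightarrow> (\<forall>w\<in>U. \<forall>p\<in>U. \<forall>p'\<in>U. op w p \<in> E f \<and> op w p' \<in> E f \<longrightarrow> p = p')"
definition supp where "supp f x \<longleftrightarrow> (\<forall>p\<in>U. \<not> cov f p \<longrightarrow> fl p x = x)"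
definition Sym where "Sym x \<longleftrightarrow> (\<exists>f\<in>U. fn f \<and> supp f x)"
text \<open>Heredity is expressed by a witnessing set \<open>c\<close> instead of a recursion, which
  makes it visibly a single formula over \<open>M\<close>. The marker \<open>emp\<close> is exempt,
  and excluded from \<open>NN\<close>, as it is no object of the new model.\<close>

definition HS where
  "HS x \<longleftrightarrow> (\<exists>c\<in>U. x \<in> E c \<and> (\<forall>y\<in>E c. Sym y \<and> (emp \<in> E y \<longrightarrow> (\<forall>z\<in>E y. z \<noteq> emp \<longrightarrow> z \<in> E c))))"
definition NN where "NN = {x \<in> U. x \<noteq> emp \<and> HS x}"

lemma Def_cov [Dintro]: assumes "Tm f" "Tm g" shows "Def (\<lambda>s. cov (f s) (g s))"
  by (rule Def_Tm2[OF _ assms]) (unfold cov_def, intro Dintro W)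
lemma Def_fn [Dintro]: assumes "Tm f" shows "Def (\<lambda>s. fn (f s))"
  by (rule Def_Tm1[OF _ assms]) (unfold fn_def, intro Dintro)
lemma Def_supp [Dintro]: assumes "Tm f" "Tm g" shows "Def (\<lambda>s. supp (f s) (g s))"
  by (rule Def_Tm2[OF _ assms]) (unfold supp_def, intro Dintro)
lemma Def_Sym [Dintro]: assumes "Tm f" shows "Def (\<lambda>s. Sym (f s))"
  by (rule Def_Tm1[OF _ assms]) (unfold Sym_def, intro Dintro)
lemma Def_HS [Dintro]: assumes "Tm f" shows "Def (\<lambda>s. HS (f s))"
  by (rule Def_Tm1[OF _ assms]) (unfold HS_def, intro Dintro emp)
lemma Def_NN [Dintro]: assumes "Tm f" shows "Def (\<lambda>s. f s \<in> NN)"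
  by (rule Def_Tm1[OF _ assms]) (unfold NN_def, intro Dintro emp)

lemma NN_U: "x \<in> NN \<Longrightarrow> x \<in> U" by (simp add: NN_def)
lemma NN_ne: "x \<in> NN \<Longrightarrow> x \<noteq> emp" by (simp add: NN_def)

lemma HS_iff: assumes x: "x \<in> U"
  shows "HS x \<longleftrightarrow> Sym x \<and> (emp \<in> E x \<longrightarrow> (\<forall>z\<in>E x. z \<noteq> emp \<longrightarrow> HS z))"
proof
  assume "HS x"
  then obtain c where c: "c \<in> U" "x \<in> E c"
      "\<forall>y\<in>E c. Sym y \<and> (emp \<in> E y \<longrightarrow> (\<forall>z\<in>E y. z \<noteq> emp \<longrightarrow> z \<in> E c))"
    unfolding HS_def by blast
  then have "HS z" if "emp \<in> E x" "z \<in> E x" "z \<noteq> emp" for z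
    unfolding HS_def using that by blast
  then show "Sym x \<and> (emp \<in> E x \<longrightarrow> (\<forall>z\<in>E x. z \<noteq> emp \<longrightarrow> HS z))" using c by blast
next
  assume r: "Sym x \<and> (emp \<in> E x \<longrightarrow> (\<forall>z\<in>E x. z \<noteq> emp \<longrightarrow> HS z))"
  obtain T where T: "trans T" "x \<in> E T" using ex_trans_mem x by blast
  then have "S {z \<in> E T. HS z \<or> z = x}" by (intro S_sep Dintro x) (simp add: trans_def)
  then obtain c where c: "c \<in> U" "E c = {z \<in> E T. HS z \<or> z = x}" by (auto simp: S_def)
  have "Sym y \<and> (emp \<in> E y \<longrightarrow> (\<forall>z\<in>E y. z \<noteq> emp \<longrightarrow> HS z))" if hy: "HS y" for y
  proof -
    obtain c where c: "c \<in> U" "y \<in> E c"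
        "\<forall>y\<in>E c. Sym y \<and> (emp \<in> E y \<longrightarrow> (\<forall>z\<in>E y. z \<noteq> emp \<longrightarrow> z \<in> E c))"
      using hy unfolding HS_def by blast
    then have "HS z" if "emp \<in> E y" "z \<in> E y" "z \<noteq> emp" for z
      unfolding HS_def using that by blast
    then show ?thesis using c by blast
  qed
  then have "Sym y \<and> (emp \<in> E y \<longrightarrow> (\<forall>z\<in>E y. z \<noteq> emp \<longrightarrow> z \<in> E c))" if y: "y \<in> E c" for y
  proof -
    have "E y \<subseteq> E T" "HS y \<or> y = x" using y T c(2) by (auto simp: trans_def)
    then show ?thesis using c(2) r \<open>\<And>y. HS y \<Longrightarrow> _\<close> by blast
  qed
  then show "HS x" unfolding HS_def using c T by blast
qed

lemma NN_iff:
  "x \<in> NN \<longleftrightarrow> x \<in> U \<and> x \<noteq> emp \<and> Sym x \<and> (emp \<in> E x \<longrightarrow> (\<forall>z\<in>E x. z \<noteq> emp \<longrightarrow> z \<in> NN))"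
  unfolding NN_def using HS_iff[of x] E_U[of _ x] by blast

text \<open>Any object of \<open>NN\<close> without the marker counts as a urelement; those that are
  not ordered pairs are fixed by flips, shifts and swaps alike.\<close>

definition N :: "'a ustruct" where
  "N = \<lparr>univ = NN, mem = (\<lambda>y x. y \<in> E x \<and> emp \<in> E x \<and> y \<noteq> emp), ure = (\<lambda>x. emp \<notin> E x)\<rparr>"

abbreviation EN where "EN \<equiv> elts N"

lemma N_sel [simp]: "univ N = NN" "mem N y x \<longleftrightarrow> y \<in> E x \<and> emp \<in> E x \<and> y \<noteq> emp" "ure N x \<longleftrightarrow> emp \<notin> E x"
  by (simp_all add: N_def)

lemma setN: "is_set N x \<longleftrightarrow> x \<in> NN \<and> emp \<in> E x" by (simp add: is_set_def)

lemma EN_set: "is_set N x \<Longrightarrow> EN x = E x - {emp}"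
  using NN_iff[of x] by (auto simp: elts_def[of N] setN)

lemma E_set: "is_set N x \<Longrightarrow> E x = insert emp (EN x)"
  using EN_set by (auto simp: setN)

lemma EN_ure: "emp \<notin> E x \<Longrightarrow> EN x = {}" by (simp add: elts_def[of N])

lemma EN_NN: "y \<in> EN x \<Longrightarrow> y \<in> NN" by (simp add: elts_def[of N])

lemma EN_iff: "y \<in> EN x \<longleftrightarrow> y \<in> NN \<and> y \<in> E x \<and> emp \<in> E x"
  using NN_ne by (auto simp: elts_def[of N])

lemma EN_U: "y \<in> EN x \<Longrightarrow> y \<in> U" using EN_NN NN_U by blast

lemma Def_EN [Dintro]: "Tm f \<Longrightarrow> Tm g \<Longrightarrow> Def (\<lambda>s. f s \<in> EN (g s))"
  unfolding EN_iff by (intro Dintro emp)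

lemma Def_setN [Dintro]: "Tm f \<Longrightarrow> Def (\<lambda>s. is_set N (f s))"
  unfolding setN by (intro Dintro emp)

lemma S_EN [simp]: assumes "x \<in> U" shows "S (EN x)"
  by (rule S_Def_sub[OF assms]) (auto simp: EN_iff intro!: Dintro assms)

lemma ext_N: assumes "is_set N x" "is_set N y" "EN x = EN y" shows "x = y"
  using assms E_set[OF assms(1)] E_set[OF assms(2)] by (intro ext) (simp_all add: setN NN_U)

lemma Def_all_NN [Dintro]:
  assumes "Def (\<lambda>s. P (s 0) (pop s))" shows "Def (\<lambda>s. \<forall>x\<in>NN. P x s)"
proof (rule Def_cong)
  show "Def (\<lambda>s. \<forall>x\<in>U. x \<in> NN \<longrightarrow> P x s)" by (intro Dintro assms)
qed (auto dest: NN_U)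

lemma Def_ex_NN [Dintro]:
  assumes "Def (\<lambda>s. P (s 0) (pop s))" shows "Def (\<lambda>s. \<exists>x\<in>NN. P x s)"
proof (rule Def_cong)
  show "Def (\<lambda>s. \<exists>x\<in>U. x \<in> NN \<and> P x s)" by (intro Dintro assms)
qed (auto dest: NN_U)

text \<open>The universe and the two predicates of \<open>N\<close> are definable in
  \<open>M\<close>, so it suffices to relativize the quantifiers to \<open>NN\<close>, for each
  fixed formula separately.\<close>

lemma Def_sat: "Def (\<lambda>s. sat N s \<phi>)"
proof (induction \<phi>)
  case (AllF i p)
  have eq: "(\<lambda>k. s (if k = i then 0 else Suc k)) = (\<lambda>k. s (Suc k))(i := s 0)" for s :: "nat \<Rightarrow> 'a"
    by auto
  have "Def (\<lambda>s. sat N ((\<lambda>k. s (Suc k))(i := s 0)) p)"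
    using Def_ren[OF AllF, of "\<lambda>k. if k = i then 0 else Suc k"] by (simp only: eq)
  then have "Def (\<lambda>s. \<forall>a\<in>NN. sat N (s(i := a)) p)" by (intro Def_all_NN)
  then show ?case by simp
next
  case (MemF i j)
  have "Def (\<lambda>s. s i \<in> E (s j) \<and> emp \<in> E (s j) \<and> s i \<noteq> emp)" by (intro Dintro emp)
  then show ?case by simp
next
  case (UreF i)
  have "Def (\<lambda>s. emp \<notin> E (s i))" by (intro Dintro emp)
  then show ?case by simp
next
  case (EqF i j)
  have "Def (\<lambda>s. s i = s j)" by (intro Dintro)
  then show ?case by simp
qed (auto intro!: Dintro)

subsection \<open>Automorphisms\<close>

context
  fixes h a q assumes comp: "compat h a" and q: "q \<in> U"
begin

lemma comp_perm: "perm h" using comp by (simp add: compat_def)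

lemma comp_a: "p \<in> U \<Longrightarrow> a q p \<in> U" "p \<in> U \<Longrightarrow> a q (a q p) = p"
  using comp q Tm2_U[of a] by (auto simp: compat_def)

text \<open>By \<open>act_flip_comm\<close>, applying \<open>a q\<close> to the indices of a support
  of \<open>x\<close> gives a support of the image; \<open>a q\<close> is an involution, so the
  result is again a function.\<close>

lemma Sym_act: assumes x: "x \<in> U" "Sym x" shows "Sym (act h q x)"
proof -
  obtain f where f: "f \<in> U" "fn f" "supp f x" using x(2) by (auto simp: Sym_def)
  have Ta: "Tm2 a" using comp by (simp add: compat_def)
  have "S {b \<in> U. \<exists>z\<in>E f. \<exists>w\<in>U. \<exists>p\<in>U. z = op w p \<and> b = op w (a q p)}"
    by (rule S_repl[OF f(1)]) (intro Dintro Tm_comp2[OF Ta] q, auto)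
  then obtain f' where f': "f' \<in> U"
      "E f' = {b \<in> U. \<exists>z\<in>E f. \<exists>w\<in>U. \<exists>p\<in>U. z = op w p \<and> b = op w (a q p)}"
    by (auto simp: S_def)
  have mem: "op w p \<in> E f' \<longleftrightarrow> op w (a q p) \<in> E f" if wp: "w \<in> U" "p \<in> U" for w p
  proof
    assume "op w p \<in> E f'"
    then obtain w' p' where "op w' p' \<in> E f" "w' \<in> U" "p' \<in> U" "op w p = op w' (a q p')"
      using f'(2) by auto
    then show "op w (a q p) \<in> E f" using comp_a wp by auto
  next
    assume "op w (a q p) \<in> E f"
    moreover have "op w p = op w (a q (a q p))" using comp_a(2) wp by simp
    ultimately show "op w p \<in> E f'" unfolding f'(2) using comp_a(1) wp op by blast
  qed
  have "fn f'" unfolding fn_def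
  proof (intro ballI impI)
    fix w p p' assume wp: "w \<in> U" "p \<in> U" "p' \<in> U" "op w p \<in> E f' \<and> op w p' \<in> E f'"
    then have "op w (a q p) \<in> E f" "op w (a q p') \<in> E f" using mem by auto
    then have "a q p = a q p'" using f(2) comp_a wp unfolding fn_def by blast
    then show "p = p'" using comp_a wp by metis
  qed
  moreover have "supp f' (act h q x)" unfolding supp_def
  proof (intro ballI impI)
    fix p assume p: "p \<in> U" "\<not> cov f' p"
    then have "\<not> cov f (a q p)" using mem E_U unfolding cov_def by blast
    then have "fl (a q p) x = x" using f(3) comp_a p by (simp add: supp_def)
    then show "fl p (act h q x) = act h q x"
      using act_flip_comm[OF comp q comp_a(1)[OF p(1)] x(1)] comp_a(2)[OF p(1)] by simp
  qed
  ultimately show ?thesis using f'(1) by (auto simp: Sym_def)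
qed

lemma NN_act1: "x \<in> U \<Longrightarrow> x \<in> NN \<longrightarrow> act h q x \<in> NN"
proof (induction rule: eps_induct)
  show "Def (\<lambda>s. s 0 \<in> NN \<longrightarrow> act h q (s 0) \<in> NN)"
    by (intro Dintro Tm_act[OF comp_perm] q)
next
  fix x assume x: "x \<in> U" and IH: "\<And>y. y \<in> E x \<Longrightarrow> y \<in> NN \<longrightarrow> act h q y \<in> NN"
  note ap = comp_perm q
  show "x \<in> NN \<longrightarrow> act h q x \<in> NN"
  proof
    assume xN: "x \<in> NN"
    have "z \<in> NN" if z: "emp \<in> E (act h q x)" "z \<in> E (act h q x)" "z \<noteq> emp" for z
    proof -
      have "emp \<in> E x" using z(1) act_marker[OF ap x] by simp
      then obtain y where y: "y \<in> E x" "z = act h q y" using act_set[OF ap x] z(2) by auto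
      then have "y \<noteq> emp" using z(3) act_emp[OF ap] by auto
      then have "y \<in> NN" using NN_iff[of x] xN \<open>emp \<in> E x\<close> y by blast
      then show ?thesis using IH y by blast
    qed
    moreover have "Sym x" "x \<noteq> emp" using NN_iff[of x] xN by auto
    ultimately show "act h q x \<in> NN"
      using Sym_act[OF x] act_U[OF ap x] act_emp_iff[OF ap x] NN_iff[of "act h q x"] by blast
  qed
qed

lemma NN_act: "x \<in> NN \<Longrightarrow> act h q x \<in> NN" using NN_act1 NN_U by blast

lemma act_act_NN [simp]: "x \<in> NN \<Longrightarrow> act h q (act h q x) = x" using act_act[OF comp_perm q NN_U] .

text \<open>Each of the permutations is an automorphism of \<open>N\<close>; being an involution of
  \<open>NN\<close>, it merely reindexes the range of a quantifier.\<close>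

lemma sat_act: "(\<And>i. s i \<in> NN) \<Longrightarrow> sat N (\<lambda>i. act h q (s i)) \<phi> \<longleftrightarrow> sat N s \<phi>"
proof (induction \<phi> arbitrary: s)
  case (MemF i j)
  note ap = comp_perm q
  have sU: "s i \<in> U" "s j \<in> U" using MemF NN_U by auto
  then show ?case
    using act_marker[OF ap] act_mem[OF ap sU(2) sU(1)] act_emp_iff[OF ap] by auto
next
  case (UreF i)
  then show ?case using act_marker[OF comp_perm q NN_U[of "s i"]] by simp
next
  case (EqF i j)
  then show ?case using act_inj[OF comp_perm q NN_U[of "s i"] NN_U[of "s j"]] by auto
next
  case (AllF i p)
  have *: "sat N ((\<lambda>k. act h q (s k))(i := act h q b)) p \<longleftrightarrow> sat N (s(i := b)) p" if b: "b \<in> NN" for b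
  proof -
    have "(\<lambda>k. act h q (s k))(i := act h q b) = (\<lambda>k. act h q ((s(i := b)) k))" by auto
    moreover have "(s(i := b)) k \<in> NN" for k using AllF.prems b by simp
    ultimately show ?thesis using AllF.IH[of "s(i := b)"] by metis
  qed
  have all: "(\<forall>b\<in>NN. P b) \<longleftrightarrow> (\<forall>b\<in>NN. P (act h q b))" for P
    using NN_act act_act_NN by metis
  have "(\<forall>b\<in>NN. sat N ((\<lambda>k. act h q (s k))(i := b)) p) \<longleftrightarrow>
      (\<forall>b\<in>NN. sat N ((\<lambda>k. act h q (s k))(i := act h q b)) p)" by (rule all)
  also have "\<dots> \<longleftrightarrow> (\<forall>b\<in>NN. sat N (s(i := b)) p)" using * by blast
  finally show ?case by simp
qed auto

lemma setN_act: "is_set N x \<Longrightarrow> is_set N (act h q x)"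
  using NN_act act_marker[OF comp_perm q NN_U] by (auto simp: setN)

lemma EN_act: assumes x: "x \<in> NN" and "y \<in> NN" shows "act h q y \<in> EN (act h q x) \<longleftrightarrow> y \<in> EN x"
  unfolding EN_iff using NN_act assms act_marker[OF comp_perm q NN_U[OF x]]
    act_mem[OF comp_perm q NN_U[OF x] NN_U[of y]] by blast

lemma EN_act_image: assumes x: "x \<in> NN" shows "EN (act h q x) = act h q ` EN x"
proof safe
  fix y assume y: "y \<in> EN (act h q x)"
  then have "act h q y \<in> EN x"
    using EN_act[OF x NN_act[OF EN_NN[OF y]]] act_act_NN[OF EN_NN[OF y]] by simp
  moreover have "y = act h q (act h q y)" using act_act_NN[OF EN_NN[OF y]] by simp
  ultimately show "y \<in> act h q ` EN x" by blast
qed (use EN_act[OF x] EN_NN in blast)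

end

lemmas fl_U [simp] = act_U[OF perm_flip]
lemmas NN_fl = NN_act[OF compat_flip]
lemmas EN_fl = EN_act_image[OF compat_flip]
lemmas setN_fl = setN_act[OF compat_flip]

subsection \<open>Supports\<close>

text \<open>A point \<open>w\<close> of the \<open>i\<close>-th support is replaced by
  \<open>op i w\<close>. The tag keeps the union single-valued, and the closure of \<open>W\<close>
  under pairing with \<open>K\<close> keeps its domain inside \<open>W\<close>.\<close>

lemma supp_union:
  assumes k: "k \<in> U" "E k \<subseteq> E K" and G: "Tm1 G" and fn: "\<And>i. i \<in> E k \<Longrightarrow> fn (G i)"
  shows "\<exists>f\<in>U. fn f \<and> (\<forall>i\<in>E k. \<forall>p\<in>U. cov (G i) p \<longrightarrow> cov f p)"
proof -
  let ?C = "{z \<in> U. \<exists>i\<in>E k. \<exists>w\<in>E W. \<exists>p\<in>U. op w p \<in> E (G i) \<and> z = op (op i w) p}"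
  let ?B = "un (un (un (mk (G ` E k))))"
  have BU: "?B \<in> U" using image_mk[OF k(1) G] by simp
  have "S ?C"
  proof (rule S_Def_sub)
    show "prd W ?B \<in> U" using prd W BU by simp
    show "?C \<subseteq> E (prd W ?B)"
    proof
      fix z assume "z \<in> ?C"
      then obtain i w p where z: "i \<in> E k" "w \<in> E W" "p \<in> U" "op w p \<in> E (G i)" "z = op (op i w) p" by blast
      have wU: "w \<in> U" using z E_U by blast
      have GU: "G i \<in> U" using Tm1_U[OF G E_U[OF z(1)]] .
      have im: "mk (G ` E k) \<in> U" "G i \<in> E (mk (G ` E k))" using image_mk[OF k(1) G] z by auto
      have "op w p \<in> E (un (mk (G ` E k)))" using im z(4) by auto
      then have "up w p \<in> E (un (un (mk (G ` E k))))" using im op_E[OF wU z(3)] by auto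
      then have "p \<in> E ?B" using im up(2)[OF wU z(3)] by auto
      moreover have "op i w \<in> E W" using W(3) z k by blast
      ultimately show "z \<in> E (prd W ?B)" using op_in_prd[OF W(1) BU] z(5) by blast
    qed
    show "Def (\<lambda>s. s 0 \<in> ?C)" by (intro Dintro W k Tm_comp1[OF G])
  qed
  then obtain f where f: "f \<in> U" "E f = ?C" by (auto simp: S_def)
  have mem: "op u p \<in> E f \<longleftrightarrow> (\<exists>i\<in>E k. \<exists>w\<in>E W. op w p \<in> E (G i) \<and> u = op i w)"
    if up: "u \<in> U" "p \<in> U" for u p
  proof
    assume "op u p \<in> E f"
    then obtain i w p' where z: "i \<in> E k" "w \<in> E W" "p' \<in> U" "op w p' \<in> E (G i)" "op u p = op (op i w) p'"
      unfolding f(2) by blast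
    then have "u = op i w" "p = p'" using up E_U by auto
    then show "\<exists>i\<in>E k. \<exists>w\<in>E W. op w p \<in> E (G i) \<and> u = op i w" using z by blast
  next
    assume "\<exists>i\<in>E k. \<exists>w\<in>E W. op w p \<in> E (G i) \<and> u = op i w"
    then show "op u p \<in> E f" unfolding f(2) using up op by blast
  qed
  have "fn f" unfolding fn_def
  proof (intro ballI impI)
    fix u p p' assume u: "u \<in> U" "p \<in> U" "p' \<in> U" "op u p \<in> E f \<and> op u p' \<in> E f"
    then obtain i w i' w' where z: "i \<in> E k" "w \<in> E W" "op w p \<in> E (G i)" "u = op i w"
        "i' \<in> E k" "w' \<in> E W" "op w' p' \<in> E (G i')" "u = op i' w'" using mem by meson
    then have "i = i'" "w = w'" using E_U op_inj by metis+
    then show "p = p'" using fn[OF z(1)] z u E_U unfolding fn_def by blast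
  qed
  moreover have "cov f p" if "i \<in> E k" "p \<in> U" "cov (G i) p" for i p
  proof -
    obtain w where w: "w \<in> E W" "op w p \<in> E (G i)" using \<open>cov (G i) p\<close> by (auto simp: cov_def)
    have "op i w \<in> E W" using W(3) w that k by blast
    moreover from this have "op (op i w) p \<in> E f" using mem[OF E_U] w that by blast
    ultimately show ?thesis by (auto simp: cov_def)
  qed
  ultimately show ?thesis using f(1) by blast
qed

lemma supp_mono: "supp f x \<Longrightarrow> (\<And>p. p \<in> U \<Longrightarrow> cov f p \<Longrightarrow> cov g p) \<Longrightarrow> supp g x"
  unfolding supp_def by blast

lemma supp_union2:
  assumes "f \<in> U" "g \<in> U" "fn f" "fn g"
  shows "\<exists>e\<in>U. fn e \<and> (\<forall>p\<in>U. cov f p \<or> cov g p \<longrightarrow> cov e p)"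
proof -
  have "Tm (\<lambda>s. if s 0 = emp then f else g)" by (intro Dintro emp assms)
  moreover have "E (up emp (suc emp)) \<subseteq> E K" "up emp (suc emp) \<in> U" by auto
  ultimately have "\<exists>e\<in>U. fn e \<and> (\<forall>i\<in>E (up emp (suc emp)). \<forall>p\<in>U. cov (if i = emp then f else g) p \<longrightarrow> cov e p)"
    using assms by (intro supp_union) auto
  then show ?thesis by (auto simp del: K)
qed

lemma fn_emp: "fn emp" by (simp add: fn_def)

lemma supp_finite:
  assumes "finite I" "\<And>i. i \<in> I \<Longrightarrow> s i \<in> NN"
  shows "\<exists>f\<in>U. fn f \<and> (\<forall>i\<in>I. supp f (s i))"
  using assms
proof (induction I rule: finite_induct)
  case empty
  then show ?case using fn_emp by (intro bexI[of _ emp]) auto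
next
  case (insert i I)
  then obtain f where f: "f \<in> U" "fn f" "\<forall>i\<in>I. supp f (s i)" by blast
  obtain g where g: "g \<in> U" "fn g" "supp g (s i)"
    using insert.prems[of i] NN_iff[of "s i"] by (auto simp: Sym_def)
  obtain e where e: "e \<in> U" "fn e" "\<forall>p\<in>U. cov f p \<or> cov g p \<longrightarrow> cov e p"
    using supp_union2[OF f(1) g(1) f(2) g(2)] by blast
  have "supp e (s j)" if "j \<in> insert i I" for j
    using that f(3) g(3) e(3) supp_mono[of f "s j" e] supp_mono[of g "s j" e] by blast
  then show ?case using e by blast
qed

definition nset :: "'a set \<Rightarrow> bool" where "nset C \<longleftrightarrow> (\<exists>x. is_set N x \<and> EN x = C)"

text \<open>The working criterion for a collection to be a set of \<open>N\<close>. Inclusion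
  suffices for invariance under the flips, because these are involutions.\<close>

lemma nsetI:
  assumes "S C" "C \<subseteq> NN" "f \<in> U" "fn f"
    and fl: "\<And>p y. p \<in> U \<Longrightarrow> \<not> cov f p \<Longrightarrow> y \<in> C \<Longrightarrow> fl p y \<in> C"
  shows "nset C" "supp f (mk (insert emp C))" "is_set N (mk (insert emp C))" "EN (mk (insert emp C)) = C"
proof -
  let ?x = "mk (insert emp C)"
  have "S (insert emp C)" using assms(1) by simp
  then have x: "?x \<in> U" "E ?x = insert emp C" using mk_S by auto
  have m: "emp \<in> E ?x" using x by simp
  show sup: "supp f ?x" unfolding supp_def
  proof (intro ballI impI)
    fix p assume p: "p \<in> U" "\<not> cov f p"
    have fl': "fl p y \<in> insert emp C" if "y \<in> insert emp C" for y
      using fl[OF p] that act_emp[OF perm_flip p(1)] by auto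
    have "fl p ` insert emp C = insert emp C"
    proof
      show "insert emp C \<subseteq> fl p ` insert emp C"
      proof
        fix y assume y: "y \<in> insert emp C"
        then have "y \<in> U" using assms(2) NN_U by auto
        then have "y = fl p (fl p y)" using act_act[OF perm_flip p(1)] by simp
        then show "y \<in> fl p ` insert emp C" using fl'[OF y] by blast
      qed
    qed (use fl' in blast)
    then show "fl p ?x = ?x"
      using act_set[OF perm_flip p(1) x(1) m] x p by (intro ext) auto
  qed
  have "?x \<noteq> emp" using m by auto
  then have "?x \<in> NN"
    using NN_iff[of ?x] x sup assms(2,3,4) by (auto simp: Sym_def)
  then show sx: "is_set N ?x" using m by (simp add: setN)
  show "EN ?x = C" using EN_set[OF sx] x assms(2) NN_ne by auto
  then show "nset C" using sx by (auto simp: nset_def)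
qed

lemma Sym_NN: assumes "x \<in> NN" obtains f where "f \<in> U" "fn f" "supp f x"
  using assms NN_iff[of x] by (auto simp: Sym_def)

text \<open>The variables in \<open>I\<close> are moved, the other free ones hold parameters fixed
  by the flip. This is how definable classes inherit a support from their parameters.\<close>

lemma sat_fl:
  assumes "\<And>i. s i \<in> NN" "p \<in> U" and fx: "\<And>i. i \<in> fv \<phi> - I \<Longrightarrow> fl p (s i) = s i"
  shows "sat N (\<lambda>i. if i \<in> I then fl p (s i) else s i) \<phi> \<longleftrightarrow> sat N s \<phi>"
proof -
  have "sat N s \<phi> \<longleftrightarrow> sat N (\<lambda>i. fl p (s i)) \<phi>" using sat_act[OF compat_flip assms(2,1)] by simp
  also have "\<dots> \<longleftrightarrow> sat N (\<lambda>i. if i \<in> I then fl p (s i) else s i) \<phi>"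
    by (rule sat_on_fv) (use fx in auto)
  finally show ?thesis by simp
qed

subsection \<open>The axioms\<close>

lemma nup_S: "a \<in> U \<Longrightarrow> b \<in> U \<Longrightarrow> S {emp, a, b}"
  by (intro S_insert S_upair emp)

text \<open>The unordered pair of \<open>N\<close> carries the marker, and \<open>NP\<close> is the
  Kuratowski pair of \<open>N\<close>. Both are sets of \<open>N\<close>, unlike the values of
  \<open>op\<close>, which are urelements there.\<close>

definition nup where "nup a b = mk {emp, a, b}"
definition NP where "NP a b = nup (nup a a) (nup a b)"

lemma nup_U [simp]: "a \<in> U \<Longrightarrow> b \<in> U \<Longrightarrow> nup a b \<in> U" "a \<in> U \<Longrightarrow> b \<in> U \<Longrightarrow> E (nup a b) = {emp, a, b}"
  using mk_S[OF nup_S] by (simp_all add: nup_def)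

lemma Tm_nup [Dintro]: assumes "Tm f" "Tm g" shows "Tm (\<lambda>s. nup (f s) (g s))"
proof (rule Tm_comp2[OF _ assms])
  have "Def (\<lambda>s. s 0 = emp \<or> s 0 = s (Suc 0) \<or> s 0 = s (Suc 1))" by (intro Dintro emp)
  then show "Tm2 nup" unfolding nup_def by (intro Tm_mk nup_S envD) simp_all
qed

lemma Tm_NP [Dintro]: "Tm f \<Longrightarrow> Tm g \<Longrightarrow> Tm (\<lambda>s. NP (f s) (g s))"
  unfolding NP_def by (intro Dintro)

lemma act_nup:
  assumes h: "perm h" "q \<in> U" and ab: "a \<in> U" "b \<in> U"
  shows "act h q (nup a b) = nup (act h q a) (act h q b)"
proof (rule ext)
  show "E (act h q (nup a b)) = E (nup (act h q a) (act h q b))"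
    using act_set[OF h, of "nup a b"] ab act_emp[OF h] act_U[OF h] by simp
qed (use act_U[OF h] ab in auto)

lemma act_NP:
  assumes h: "perm h" "q \<in> U" and ab: "a \<in> U" "b \<in> U"
  shows "act h q (NP a b) = NP (act h q a) (act h q b)"
  unfolding NP_def using act_nup[OF h] ab by simp

lemma nup_NN: assumes "a \<in> NN" "b \<in> NN" shows "is_set N (nup a b)" "EN (nup a b) = {a, b}"
proof -
  have "\<exists>f\<in>U. fn f \<and> (\<forall>i\<in>{a, b}. supp f i)" by (rule supp_finite) (use assms in auto)
  then obtain f where f: "f \<in> U" "fn f" "supp f a" "supp f b" by blast
  have "S {a, b}" using assms NN_U by simp
  from nsetI[OF this _ f(1,2)] show "is_set N (nup a b)" "EN (nup a b) = {a, b}"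
    using f(3,4) assms by (auto simp: supp_def nup_def)
qed

lemma is_upair_N: "a \<in> NN \<Longrightarrow> b \<in> NN \<Longrightarrow> is_upair N a b z \<longleftrightarrow> z = nup a b"
  using nup_NN[of a b] ext_N[of z "nup a b"] by (auto simp: is_upair_def)

lemma set_NN: "is_set N x \<Longrightarrow> x \<in> NN" by (simp add: setN)

lemma nup_NN': "a \<in> NN \<Longrightarrow> b \<in> NN \<Longrightarrow> nup a b \<in> NN"
  using nup_NN(1) set_NN by blast

lemma NP_NN: "a \<in> NN \<Longrightarrow> b \<in> NN \<Longrightarrow> NP a b \<in> NN"
  unfolding NP_def by (intro nup_NN')

lemma nup_inj: "a \<in> NN \<Longrightarrow> b \<in> NN \<Longrightarrow> c \<in> NN \<Longrightarrow> d \<in> NN \<Longrightarrow> nup a b = nup c d \<longleftrightarrow> {a, b} = {c, d}"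
  using nup_NN(2) by (metis nup_def)

lemma NP_inj: "a \<in> NN \<Longrightarrow> b \<in> NN \<Longrightarrow> c \<in> NN \<Longrightarrow> d \<in> NN \<Longrightarrow> NP a b = NP c d \<longleftrightarrow> a = c \<and> b = d"
  unfolding NP_def by (auto simp: nup_inj set_NN nup_NN doubleton_eq_iff)

lemma is_opair_N: "a \<in> NN \<Longrightarrow> b \<in> NN \<Longrightarrow> is_opair N a b p \<longleftrightarrow> p = NP a b"
  unfolding is_opair_def NP_def by (simp add: is_upair_N set_NN nup_NN)

lemma pair_in_N: "a \<in> NN \<Longrightarrow> b \<in> NN \<Longrightarrow> pair_in N a b f \<longleftrightarrow> NP a b \<in> EN f"
  unfolding pair_in_def by (auto simp: is_opair_N)

lemma supp_fv:
  assumes "range s \<subseteq> NN" "x \<in> NN"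
  shows "\<exists>f\<in>U. fn f \<and> supp f x \<and> (\<forall>i\<in>fv \<phi>. supp f (s i))"
proof -
  have "\<exists>f\<in>U. fn f \<and> (\<forall>y\<in>insert x (s ` fv \<phi>). supp f y)"
    by (rule supp_finite) (use assms finite_fv in auto)
  then show ?thesis by auto
qed

lemma N_urelements: "ax_urelements N"
  by (auto simp: ax_urelements_def EN_ure)

lemma N_extensionality: "ax_extensionality N"
  using ext_N by (auto simp: ax_extensionality_def)

lemma N_foundation: "ax_foundation N"
  unfolding ax_foundation_def
proof (intro allI impI)
  fix x assume x: "is_set N x \<and> EN x \<noteq> {}"
  then have "S (EN x)" using NN_U by (auto simp: setN)
  \<comment> \<open>The marker \<open>emp\<close> would be a minimal element of \<open>x\<close>, so
    Foundation in \<open>M\<close> is applied to \<open>EN x\<close>.\<close>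
  then obtain y where "y \<in> EN x" "E y \<inter> EN x = {}"
    using foundation[of "mk (EN x)"] mk_S x by metis
  then show "\<exists>y\<in>EN x. EN y \<inter> EN x = {}" by (intro bexI[of _ y]) (auto simp: EN_iff)
qed

lemma N_pairing: "ax_pairing N"
  unfolding ax_pairing_def by (auto simp: is_upair_N)

lemma N_union: "ax_union N"
  unfolding ax_union_def
proof (intro allI impI)
  fix x assume x: "is_set N x"
  obtain f where f: "f \<in> U" "fn f" "supp f x" using Sym_NN[OF set_NN[OF x]] .
  have xU: "x \<in> U" using x NN_U set_NN by blast
  let ?C = "{u \<in> U. \<exists>z\<in>E x. z \<in> EN x \<and> u \<in> EN z}"
  have "S ?C"
    by (rule S_Def_sub[of "un x"]) (use xU in \<open>auto simp: EN_iff intro!: Dintro\<close>)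
  moreover have C: "?C = (\<Union>z\<in>EN x. EN z)" using EN_iff EN_U by blast
  ultimately have "nset (\<Union>z\<in>EN x. EN z)"
  proof (intro nsetI(1)[OF _ _ f(1,2)])
    fix p y assume p: "p \<in> U" "\<not> cov f p" and "y \<in> (\<Union>z\<in>EN x. EN z)"
    then obtain z where z: "z \<in> EN x" "y \<in> EN z" by blast
    have "fl p x = x" using f p by (simp add: supp_def)
    then have "fl p z \<in> EN x" using EN_fl[OF p(1) set_NN[OF x]] z by force
    moreover have "fl p y \<in> EN (fl p z)" using EN_fl[OF p(1) EN_NN[OF z(1)]] z by force
    ultimately show "fl p y \<in> (\<Union>z\<in>EN x. EN z)" by blast
  qed (use EN_NN in auto)
  then show "\<exists>y. is_set N y \<and> EN y = (\<Union>z\<in>EN x. EN z)" by (simp add: nset_def)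
qed

lemma N_powerset: "ax_powerset N"
  unfolding ax_powerset_def
proof (intro allI impI)
  fix x assume x: "is_set N x"
  obtain f where f: "f \<in> U" "fn f" "supp f x" using Sym_NN[OF set_NN[OF x]] .
  have xU: "x \<in> U" using x NN_U set_NN by blast
  let ?C = "{z. is_set N z \<and> EN z \<subseteq> EN x}"
  have "S ?C"
  proof (rule S_Def_sub[of "pw x"])
    have "E z \<subseteq> E x" if "z \<in> ?C" for z using that E_set[of z] E_set[OF x] by auto
    then show "?C \<subseteq> E (pw x)" using xU set_NN NN_U by auto
    have "Def (\<lambda>s. is_set N (s 0) \<and> (\<forall>u\<in>U. u \<in> EN (s 0) \<longrightarrow> u \<in> EN x))" by (intro Dintro xU)
    then show "Def (\<lambda>s. s 0 \<in> ?C)" by (rule Def_cong) (use EN_U in auto)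
  qed (use xU in simp)
  then have "nset ?C"
  proof (intro nsetI(1)[OF _ _ f(1,2)])
    fix p z assume p: "p \<in> U" "\<not> cov f p" and z: "z \<in> ?C"
    have "fl p x = x" using f p by (simp add: supp_def)
    then have "EN x = fl p ` EN x" using EN_fl[OF p(1) set_NN[OF x]] by simp
    moreover have "EN (fl p z) \<subseteq> fl p ` EN x" using EN_fl[OF p(1) set_NN[of z]] z by blast
    ultimately have "EN (fl p z) \<subseteq> EN x" by simp
    then show "fl p z \<in> ?C" using setN_fl[OF p(1)] z by blast
  qed (use set_NN in auto)
  then show "\<exists>y. is_set N y \<and> EN y = ?C" by (simp add: nset_def)
qed

text \<open>The subset exists in \<open>M\<close> because truth in \<open>N\<close> is definable
  there; a common support of \<open>x\<close> and of the finitely many parameters occurring in the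
  formula supports it.\<close>

lemma N_separation: "ax_separation N"
  unfolding ax_separation_def
proof (intro allI impI)
  fix \<phi> and s :: "nat \<Rightarrow> 'a" and x assume "range s \<subseteq> univ N \<and> is_set N x"
  then have s: "range s \<subseteq> NN" and x: "is_set N x" by auto
  have xU: "x \<in> U" using x NN_U set_NN by blast
  obtain f where f: "f \<in> U" "fn f" "supp f x" "\<forall>i\<in>fv \<phi>. supp f (s i)"
    using supp_fv[OF s set_NN[OF x]] by blast
  let ?C = "{z \<in> EN x. sat N (s(0 := z)) \<phi>}"
  define r :: "nat \<Rightarrow> nat + 'a" where "r k = (if k = 0 then Inl 0 else Inr (s k))" for k
  have sl: "slots r" using s NN_U by (auto simp: slots_def r_def)
  have eq: "fill r e = s(0 := e 0)" for e by (auto simp: fill_def r_def)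
  have D: "Def (\<lambda>e. sat N (s(0 := e 0)) \<phi>)" 
    using Def_fill[OF Def_sat sl] by (simp only: eq)
  have "S {z \<in> E x. z \<in> EN x \<and> sat N (s(0 := z)) \<phi>}" by (intro S_sep Dintro D xU)
  moreover have "{z \<in> E x. z \<in> EN x \<and> sat N (s(0 := z)) \<phi>} = ?C" by (auto simp: EN_iff)
  ultimately have "S ?C" by simp
  then have "nset ?C"
  proof (intro nsetI(1)[OF _ _ f(1,2)])
    fix p z assume p: "p \<in> U" "\<not> cov f p" and z: "z \<in> ?C"
    have zN: "z \<in> NN" using z EN_NN by blast
    have "fl p x = x" using f p by (simp add: supp_def)
    then have "fl p z \<in> EN x" using EN_fl[OF p(1) set_NN[OF x]] z by force
    moreover have "sat N (\<lambda>i. if i \<in> {0} then fl p ((s(0 := z)) i) else (s(0 := z)) i) \<phi> \<longleftrightarrow> sat N (s(0 := z)) \<phi>"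
      by (rule sat_fl) (use s zN p f(4) in \<open>auto simp: supp_def\<close>)
    moreover have "(\<lambda>i. if i \<in> {0} then fl p ((s(0 := z)) i) else (s(0 := z)) i) = s(0 := fl p z)" by auto
    ultimately show "fl p z \<in> ?C" using z by simp
  qed (use EN_NN in auto)
  then show "\<exists>y. is_set N y \<and> EN y = ?C" by (simp add: nset_def)
qed

lemma N_replacement: "ax_replacement N"
  unfolding ax_replacement_def
proof (intro allI impI)
  fix \<phi> and s :: "nat \<Rightarrow> 'a" and x assume "range s \<subseteq> univ N \<and> is_set N x \<and>
    (\<forall>a\<in>EN x. \<exists>!b. b \<in> univ N \<and> sat N (s(0 := a, 1 := b)) \<phi>)"
  then have s: "range s \<subseteq> NN" and x: "is_set N x"
    and ex1: "\<And>a. a \<in> EN x \<Longrightarrow> \<exists>!b. b \<in> NN \<and> sat N (s(0 := a, 1 := b)) \<phi>" by auto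
  have xU: "x \<in> U" using x NN_U set_NN by blast
  obtain f where f: "f \<in> U" "fn f" "supp f x" "\<forall>i\<in>fv \<phi>. supp f (s i)"
    using supp_fv[OF s set_NN[OF x]] by blast
  let ?C = "{b \<in> NN. \<exists>a\<in>EN x. sat N (s(0 := a, 1 := b)) \<phi>}"
  define r :: "nat \<Rightarrow> nat + 'a" where "r k = (if k = 0 then Inl 0 else if k = 1 then Inl 1 else Inr (s k))" for k
  have sl: "slots r" using s NN_U by (auto simp: slots_def r_def)
  have eq: "fill r e = s(0 := e 0, 1 := e 1)" for e by (auto simp: fill_def r_def)
  have D: "Def (\<lambda>e. sat N (s(0 := e 0, 1 := e 1)) \<phi>)" 
    using Def_fill[OF Def_sat sl] by (simp only: eq)
  have EN: "mk (EN x) \<in> U" "E (mk (EN x)) = EN x" using mk_S[OF S_EN[OF xU]] by auto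
  have "S {b \<in> U. \<exists>a\<in>E (mk (EN x)). b \<in> NN \<and> sat N (s(0 := a, 1 := b)) \<phi>}"
  proof (rule S_repl[OF EN(1)])
    show "Def (\<lambda>e. e 1 \<in> NN \<and> sat N (s(0 := e 0, 1 := e 1)) \<phi>)" by (intro Dintro D)
  qed (use ex1 EN in blast)
  moreover have "{b \<in> U. \<exists>a\<in>E (mk (EN x)). b \<in> NN \<and> sat N (s(0 := a, 1 := b)) \<phi>} = ?C"
    using EN(2) NN_U by auto
  ultimately have "S ?C" by simp
  then have "nset ?C"
  proof (intro nsetI(1)[OF _ _ f(1,2)])
    fix p b assume p: "p \<in> U" "\<not> cov f p" and "b \<in> ?C"
    then obtain a where b: "b \<in> NN" "a \<in> EN x" "sat N (s(0 := a, 1 := b)) \<phi>" by blast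
    let ?s = "s(0 := a, 1 := b)"
    have aN: "a \<in> NN" using b EN_NN by blast
    have "fl p x = x" using f p by (simp add: supp_def)
    then have "fl p a \<in> EN x" using EN_fl[OF p(1) set_NN[OF x]] b by force
    moreover have "sat N (\<lambda>i. if i \<in> {0, 1} then fl p (?s i) else ?s i) \<phi> \<longleftrightarrow> sat N ?s \<phi>"
      by (rule sat_fl) (use s aN b p f(4) in \<open>auto simp: supp_def\<close>)
    moreover have "(\<lambda>i. if i \<in> {0, 1} then fl p (?s i) else ?s i) = s(0 := fl p a, 1 := fl p b)" by auto
    ultimately show "fl p b \<in> ?C" using b NN_fl[OF p(1)] by auto
  qed auto
  then show "\<exists>y. is_set N y \<and> EN y = {b \<in> univ N. \<exists>a\<in>EN x. sat N (s(0 := a, 1 := b)) \<phi>}"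
    by (simp add: nset_def)
qed

subsection \<open>The pure sets\<close>

text \<open>The canonical copy of a set of \<open>M\<close>: the marker is added at every level,
  starting from the singleton of \<open>emp\<close> as code of the empty set.\<close>

definition j where
  "j = (SOME F. Tm1 F \<and> (\<forall>x\<in>U. F x = un (up (up emp emp) (mk (F ` E x)))))"

lemma j_spec: "Tm1 j \<and> (\<forall>x\<in>U. j x = un (up (up emp emp) (mk (j ` E x))))"
proof -
  have "Tm (\<lambda>s. un (up (up emp emp) (s 2)))" by (intro Dintro emp)
  then obtain F where F: "Tm2 F"
      "\<forall>q\<in>U. \<forall>x\<in>U. F q x = un (up (up emp emp) (mk (F q ` E x)))"
    using eps_rec_image[of "\<lambda>q x f. un (up (up emp emp) f)"] by blast
  show ?thesis unfolding j_def
    by (rule someI[of _ "F emp"]) (use F Tm_inst1[OF F(1)] in auto)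
qed

lemma Tm_j [Dintro]: "Tm f \<Longrightarrow> Tm (\<lambda>s. j (f s))"
  using Tm_comp1 j_spec by blast

lemma j_U [simp]: "x \<in> U \<Longrightarrow> j x \<in> U" using Tm1_U j_spec by blast

lemma E_j: "x \<in> U \<Longrightarrow> E (j x) = insert emp (j ` E x)"
  using j_spec image_mk[of x j] by simp

lemma fl_j: assumes p: "p \<in> U" and "x \<in> U" shows "fl p (j x) = j x"
  using assms(2)
proof (induction rule: eps_induct)
  show "Def (\<lambda>s. fl p (j (s 0)) = j (s 0))" by (intro Dintro p)
next
  fix x assume x: "x \<in> U" and IH: "\<And>y. y \<in> E x \<Longrightarrow> fl p (j y) = j y"
  have "fl p ` E (j x) = E (j x)"
    unfolding E_j[OF x] using IH act_emp[OF perm_flip p] by (force simp: image_iff)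
  then show "fl p (j x) = j x"
    using act_set[OF perm_flip p, of "j x"] E_j[OF x] x p by (intro ext) auto
qed

lemma j_NN: "x \<in> U \<Longrightarrow> j x \<in> NN"
proof (induction rule: eps_induct)
  show "Def (\<lambda>s. j (s 0) \<in> NN)" by (intro Dintro)
next
  fix x assume x: "x \<in> U" and IH: "\<And>y. y \<in> E x \<Longrightarrow> j y \<in> NN"
  have "Sym (j x)" unfolding Sym_def supp_def using fn_emp fl_j[OF _ x] by (intro bexI[of _ emp]) auto
  moreover have "j x \<noteq> emp" using E_j[OF x] by auto
  ultimately show "j x \<in> NN" using NN_iff[of "j x"] E_j[OF x] IH x by auto
qed

lemma setN_j [simp]: "x \<in> U \<Longrightarrow> is_set N (j x)"
  using j_NN E_j by (simp add: setN)

lemma EN_j: "x \<in> U \<Longrightarrow> EN (j x) = j ` E x"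
  using EN_set[OF setN_j] E_j[of x] NN_ne[OF j_NN] E_U by auto

lemma j_inj: assumes "x \<in> U" "y \<in> U" "j x = j y" shows "x = y"
proof -
  have "\<forall>y\<in>U. j x = j y \<longrightarrow> x = y"
    using assms(1)
  proof (induction rule: eps_induct)
    show "Def (\<lambda>s. \<forall>y\<in>U. j (s 0) = j y \<longrightarrow> s 0 = y)" by (intro Dintro)
  next
    fix x assume x: "x \<in> U" and IH: "\<And>z. z \<in> E x \<Longrightarrow> \<forall>y\<in>U. j z = j y \<longrightarrow> z = y"
    show "\<forall>y\<in>U. j x = j y \<longrightarrow> x = y"
    proof (intro ballI impI)
      fix y assume y: "y \<in> U" "j x = j y"
      then have im: "j ` E x = j ` E y" using EN_j[OF x] EN_j[OF y(1)] by simp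
      have "E x = E y"
      proof safe
        fix z assume z: "z \<in> E x"
        then obtain z' where "z' \<in> E y" "j z = j z'" using im by blast
        then show "z \<in> E y" using IH[OF z] E_U by blast
      next
        fix z' assume "z' \<in> E y"
        moreover from this obtain z where "z \<in> E x" "j z' = j z" using im by blast
        ultimately show "z' \<in> E x" using IH E_U by metis
      qed
      then show "x = y" using x y by (intro ext)
    qed
  qed
  then show ?thesis using assms by blast
qed

lemma j_eq [simp]: "x \<in> U \<Longrightarrow> y \<in> U \<Longrightarrow> j x = j y \<longleftrightarrow> x = y" using j_inj by blast

lemma embedding: "transitive_embedding M N j"
  using EN_j by (auto simp: transitive_embedding_def inj_on_def)

lemma j_mem: "x \<in> U \<Longrightarrow> y \<in> U \<Longrightarrow> j x \<in> EN (j y) \<longleftrightarrow> x \<in> E y"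
  unfolding EN_j using E_U by auto

lemma N_infinity: "ax_infinity N"
proof -
  obtain w where w: "w \<in> U" "emp \<in> E w" "\<forall>x\<in>E w. suc x \<in> E w" using ex_inductive by blast
  show ?thesis unfolding ax_infinity_def
  proof (intro exI conjI ballI)
    show "is_set N (j w)" using w by simp
    show "\<exists>e\<in>EN (j w). is_set N e \<and> EN e = {}" using w by (intro bexI[of _ "j emp"]) (auto simp: EN_j)
    fix x assume "x \<in> EN (j w)"
    then obtain x' where x': "x' \<in> E w" "x = j x'" using w EN_j by auto
    then show "\<exists>y\<in>EN (j w). is_set N y \<and> EN y = insert x (EN x)"
      using w E_U[OF x'(1)] by (intro bexI[of _ "j (suc x')"]) (auto simp: EN_j)
  qed
qed

lemma N_ZFU: "ZFU_R N"
  unfolding ZFU_R_def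
  by (intro conjI N_urelements N_extensionality N_foundation N_pairing N_union N_powerset
    N_infinity N_separation N_replacement)

lemma j_onto:
  assumes z: "is_set N z" and ex: "\<And>y. y \<in> EN z \<Longrightarrow> \<exists>y'\<in>U. j y' = y"
  shows "\<exists>z'\<in>U. j z' = z"
proof -
  have zU: "z \<in> U" using z NN_U set_NN by blast
  have EN: "mk (EN z) \<in> U" "E (mk (EN z)) = EN z" using mk_S[OF S_EN[OF zU]] by auto
  have "S {b \<in> U. \<exists>a\<in>E (mk (EN z)). j b = a}"
  proof (rule S_repl[OF EN(1)])
    show "Def (\<lambda>s. j (s 1) = s 0)" by (intro Dintro)
  qed auto
  then obtain z' where z': "z' \<in> U" "E z' = {b \<in> U. \<exists>a\<in>EN z. j b = a}" unfolding EN by (auto simp: S_def)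
  have "j ` E z' = EN z" using z'(2) ex by force
  then have "j z' = z" using ext_N[OF setN_j[OF z'(1)] z] EN_j[OF z'(1)] by simp
  then show ?thesis using z' by blast
qed

lemma j_sub: assumes x: "x \<in> U" and y: "is_set N y" "EN y \<subseteq> j ` E x"
  shows "\<exists>y'\<in>U. j y' = y \<and> E y' \<subseteq> E x"
proof -
  have "\<exists>u\<in>U. j u = v" if "v \<in> EN y" for v using that y(2) E_U by blast
  then obtain y' where y': "y' \<in> U" "j y' = y" using j_onto[OF y(1)] by blast
  then have "E y' \<subseteq> E x" using y(2) EN_j[OF y'(1)] E_U by (metis (no_types, lifting) image_subset_iff j_mem[OF _ x] EN_j[OF x] subsetI)
  then show ?thesis using y' by blast
qed

text \<open>Membership induction in a transitive closure free of urelements. It shows that the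
  ordinals of \<open>N\<close>, in particular its natural numbers, come from
  \<open>M\<close>.\<close>

lemma pure_j: assumes "pure N x" shows "\<exists>x'\<in>U. j x' = x"
proof -
  obtain c where x: "is_set N x" and c: "is_trcl N x c" "\<forall>y\<in>EN c. \<not> ure N y"
    using assms by (auto simp: pure_def)
  have tc: "is_set N c" "\<forall>y\<in>EN c. EN y \<subseteq> EN c" "EN x \<subseteq> EN c"
    using c(1) by (auto simp: is_trcl_def trans_set_def)
  have cU: "c \<in> U" using tc NN_U set_NN by blast
  have "z \<in> EN c \<longrightarrow> (\<exists>z'\<in>U. j z' = z)" if "z \<in> U" for z
    using that
  proof (induction rule: eps_induct)
    show "Def (\<lambda>s. s 0 \<in> EN c \<longrightarrow> (\<exists>z'\<in>U. j z' = s 0))" by (intro Dintro cU)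
  next
    fix z assume z: "z \<in> U" and IH: "\<And>y. y \<in> E z \<Longrightarrow> y \<in> EN c \<longrightarrow> (\<exists>z'\<in>U. j z' = y)"
    show "z \<in> EN c \<longrightarrow> (\<exists>z'\<in>U. j z' = z)"
    proof
      assume zc: "z \<in> EN c"
      then have "is_set N z" using c(2) EN_NN by (auto simp: setN)
      moreover have "\<exists>y'\<in>U. j y' = y" if "y \<in> EN z" for y
      proof -
        have "y \<in> E z" using that by (simp add: EN_iff)
        moreover have "y \<in> EN c" using that tc(2) zc by blast
        ultimately show ?thesis using IH by blast
      qed
      ultimately show "\<exists>z'\<in>U. j z' = z" by (rule j_onto)
    qed
  qed
  then show ?thesis using j_onto[OF x] tc(3) EN_U by blast
qed

section \<open>Absoluteness of ordinals and cardinals along \<open>j\<close>\<close>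

lemma trans_set_M: "trans_set M x \<longleftrightarrow> trans x" by (simp add: trans_set_def trans_def)

lemma trans_j: assumes "x \<in> U" shows "trans_set N (j x) \<longleftrightarrow> trans_set M x"
proof -
  have "(\<forall>y\<in>j ` E x. EN y \<subseteq> j ` E x) \<longleftrightarrow> (\<forall>y\<in>E x. E y \<subseteq> E x)"
  proof -
    have "EN (j y) \<subseteq> j ` E x \<longleftrightarrow> E y \<subseteq> E x" if "y \<in> U" for y
      unfolding EN_j[OF that] using E_U assms j_eq by (auto simp: subset_iff image_iff)
    then show ?thesis using E_U by auto
  qed
  then show ?thesis using assms EN_j by (simp add: trans_set_def)
qed

lemma mem_M: "a \<in> U \<Longrightarrow> mem M a b \<longleftrightarrow> a \<in> E b" by (simp add: elts_def)

lemma mem_j: "a \<in> U \<Longrightarrow> b \<in> U \<Longrightarrow> mem N (j a) (j b) \<longleftrightarrow> mem M a b"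
  using j_mem[of a b] j_NN[of a] by (simp add: mem_M elts_def[of N])

text \<open>Only the clause on nonempty subsets quantifies outside \<open>x\<close>; by
  \<open>j_sub\<close> the subsets of \<open>j x\<close> in \<open>N\<close> are the images of the
  subsets of \<open>x\<close>.\<close>

lemma wo_j: assumes x: "x \<in> U" shows "wellordered_by_mem N (j x) \<longleftrightarrow> wellordered_by_mem M x"
proof -
  have 1: "(\<forall>a\<in>EN (j x). \<not> mem N a a) \<longleftrightarrow> (\<forall>a\<in>E x. \<not> mem M a a)"
    unfolding EN_j[OF x] using mem_j E_U by blast
  have 2: "(\<forall>a\<in>EN (j x). \<forall>b\<in>EN (j x). \<forall>c\<in>EN (j x). mem N a b \<and> mem N b c \<longrightarrow> mem N a c) \<longleftrightarrow>
     (\<forall>a\<in>E x. \<forall>b\<in>E x. \<forall>c\<in>E x. mem M a b \<and> mem M b c \<longrightarrow> mem M a c)"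
    unfolding EN_j[OF x] ball_simps(9) using mem_j E_U by (simp cong: ball_cong)
  have 3: "(\<forall>a\<in>EN (j x). \<forall>b\<in>EN (j x). mem N a b \<or> a = b \<or> mem N b a) \<longleftrightarrow>
     (\<forall>a\<in>E x. \<forall>b\<in>E x. mem M a b \<or> a = b \<or> mem M b a)"
    unfolding EN_j[OF x] ball_simps(9) using mem_j E_U by (simp cong: ball_cong)
  have 4: "(\<exists>m\<in>EN (j y). \<forall>z\<in>EN (j y). m = z \<or> mem N m z) \<longleftrightarrow> (\<exists>m\<in>E y. \<forall>z\<in>E y. m = z \<or> mem M m z)"
    if "y \<in> U" for y
    unfolding EN_j[OF that] ball_simps(9) bex_simps(7) using mem_j E_U by (simp cong: ball_cong bex_cong)
  have 5: "(\<forall>y. is_set N y \<and> EN y \<subseteq> EN (j x) \<and> EN y \<noteq> {} \<longrightarrow> (\<exists>m\<in>EN y. \<forall>z\<in>EN y. m = z \<or> mem N m z)) \<longleftrightarrow>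
     (\<forall>y. is_set M y \<and> E y \<subseteq> E x \<and> E y \<noteq> {} \<longrightarrow> (\<exists>m\<in>E y. \<forall>z\<in>E y. m = z \<or> mem M m z))" (is "?L \<longleftrightarrow> ?R")
  proof
    assume L: ?L
    show ?R
    proof (intro allI impI)
      fix y assume y: "is_set M y \<and> E y \<subseteq> E x \<and> E y \<noteq> {}"
      then have "is_set N (j y) \<and> EN (j y) \<subseteq> EN (j x) \<and> EN (j y) \<noteq> {}" using EN_j x by auto
      then have "\<exists>m\<in>EN (j y). \<forall>z\<in>EN (j y). m = z \<or> mem N m z" using L by blast
      then show "\<exists>m\<in>E y. \<forall>z\<in>E y. m = z \<or> mem M m z" using 4[of y] y by simp
    qed
  next
    assume R: ?R
    show ?L
    proof (intro allI impI)
      fix y assume y: "is_set N y \<and> EN y \<subseteq> EN (j x) \<and> EN y \<noteq> {}"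
      then obtain y' where y': "y' \<in> U" "j y' = y" "E y' \<subseteq> E x" using j_sub[OF x] EN_j[OF x] by auto
      then have "E y' \<noteq> {}" using y EN_j by auto
      then have "\<exists>m\<in>E y'. \<forall>z\<in>E y'. m = z \<or> mem M m z" using R y' by simp
      then show "\<exists>m\<in>EN y. \<forall>z\<in>EN y. m = z \<or> mem N m z" using 4[OF y'(1)] y'(2) by simp
    qed
  qed
  show ?thesis unfolding wellordered_by_mem_def 1 2 3 5 ..
qed

lemma zs_j: assumes x: "x \<in> U" shows "zero_or_succ N (j x) \<longleftrightarrow> zero_or_succ M x"
proof -
  have "j ` E x = insert (j y) (EN (j y)) \<longleftrightarrow> E x = insert y (E y)" if "y \<in> U" for y
  proof -
    have "insert (j y) (EN (j y)) = j ` insert y (E y)" using EN_j[OF that] by simp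
    moreover have "inj_on j (E x \<union> insert y (E y))" using that E_U by (auto simp: inj_on_def)
    then have "j ` E x = j ` insert y (E y) \<longleftrightarrow> E x = insert y (E y)"
      by (rule inj_on_image_eq_iff) auto
    ultimately show ?thesis by simp
  qed
  then show ?thesis unfolding zero_or_succ_def EN_j[OF x] using E_U by auto
qed

lemma pure_M: assumes "trans x" shows "pure M x"
proof -
  have "is_trcl M x x" using assms by (auto simp: is_trcl_def trans_set_M)
  then show ?thesis using assms not_ure E_U by (auto simp: pure_def trans_def)
qed

lemma ordinal_j_iff: assumes x: "x \<in> U" shows "ordinal N (j x) \<longleftrightarrow> ordinal M x"
proof -
  have "pure N (j x)" if "trans_set N (j x)"
  proof -
    have "is_trcl N (j x) (j x)" using that by (auto simp: is_trcl_def)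
    moreover have "\<not> ure N y" if "y \<in> EN (j x)" for y
      using that EN_j[OF x] E_j E_U by auto
    ultimately show ?thesis using x by (auto simp: pure_def)
  qed
  then show ?thesis unfolding ordinal_def using trans_j[OF x] wo_j[OF x] pure_M trans_set_M by blast
qed

lemma is_upair_M: "a \<in> U \<Longrightarrow> b \<in> U \<Longrightarrow> is_upair M a b z \<longleftrightarrow> z = up a b"
  using ext[of z "up a b"] by (auto simp: is_upair_def)

lemma is_opair_M: "a \<in> U \<Longrightarrow> b \<in> U \<Longrightarrow> is_opair M a b p \<longleftrightarrow> p = op a b"
  unfolding is_opair_def op_def by (simp add: is_upair_M)

lemma pair_in_M: "a \<in> U \<Longrightarrow> b \<in> U \<Longrightarrow> pair_in M a b f \<longleftrightarrow> op a b \<in> E f"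
  unfolding pair_in_def by (auto simp: is_opair_M)

text \<open>\<open>N\<close> is definable in \<open>M\<close>, so a bijection of \<open>N\<close>
  can be read off as a set \<open>g\<close> of \<open>M\<close>, and no cardinal of \<open>M\<close>
  collapses. \<open>infinite_cardinal_j\<close> uses this against smaller ordinals as well as
  against natural numbers.\<close>

lemma equinum_j: assumes x: "x \<in> U" and y: "y \<in> U" and eq: "equinum N (j x) (j y)"
  shows "equinum M x y"
proof -
  obtain f where f: "is_bij N f (j x) (j y)" using eq by (auto simp: equinum_def)
  have fs: "is_set N f" using f by (simp add: is_bij_def is_fun_def)
  have fU: "f \<in> U" using fs NN_U set_NN by blast
  have A: "\<forall>a\<in>EN (j x). \<exists>!b. b \<in> NN \<and> pair_in N a b f"
    and B: "\<forall>b\<in>EN (j y). \<exists>!a. a \<in> EN (j x) \<and> pair_in N a b f"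
    using f by (simp_all add: is_bij_def is_fun_def)
  define P where "P a b \<longleftrightarrow> NP (j a) (j b) \<in> EN f" for a b
  have pin: "pair_in N (j a) (j b) f \<longleftrightarrow> P a b" if "a \<in> U" "b \<in> U" for a b
    using that pair_in_N j_NN by (simp add: P_def)
  have 1: "\<exists>b\<in>E y. P a b \<and> (\<forall>b'\<in>E y. P a b' \<longrightarrow> b' = b)" if a: "a \<in> E x" for a
  proof -
    have ja: "j a \<in> EN (j x)" using a EN_j[OF x] by simp
    obtain v where v: "v \<in> NN" "pair_in N (j a) v f" "\<And>v'. v' \<in> NN \<Longrightarrow> pair_in N (j a) v' f \<Longrightarrow> v' = v"
      using A ja by blast
    have "v \<in> EN (j y)" using f ja v(1,2) unfolding is_bij_def by simp
    then obtain b where b: "b \<in> E y" "v = j b" using EN_j[OF y] by auto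
    have "b' = b" if "b' \<in> E y" "P a b'" for b'
    proof -
      have "j b' = v" using v(3)[of "j b'"] that pin E_U a j_NN by blast
      then show ?thesis using b that E_U j_eq by blast
    qed
    then show ?thesis using b v(2) pin E_U a by blast
  qed
  have 2: "\<exists>a\<in>E x. P a b \<and> (\<forall>a'\<in>E x. P a' b \<longrightarrow> a' = a)" if b: "b \<in> E y" for b
  proof -
    have jb: "j b \<in> EN (j y)" using b EN_j[OF y] by simp
    then obtain u where u: "u \<in> EN (j x)" "pair_in N u (j b) f" "\<And>u'. u' \<in> EN (j x) \<Longrightarrow> pair_in N u' (j b) f \<Longrightarrow> u' = u"
      using B by blast
    obtain a where a: "a \<in> E x" "u = j a" using u(1) EN_j[OF x] by auto
    have "a' = a" if "a' \<in> E x" "P a' b" for a'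
    proof -
      have "j a' = u" using u(3)[of "j a'"] that pin E_U b EN_j[OF x] by blast
      then show ?thesis using a that E_U j_eq by blast
    qed
    then show ?thesis using a u(2) pin E_U b by blast
  qed
  have "S {z \<in> E (prd x y). \<exists>a\<in>E x. \<exists>b\<in>E y. z = op a b \<and> P a b}"
    unfolding P_def by (intro S_sep Dintro prd x y fU)
  then obtain g where g: "g \<in> U" "E g = {z \<in> E (prd x y). \<exists>a\<in>E x. \<exists>b\<in>E y. z = op a b \<and> P a b}"
    by (auto simp: S_def)
  have gm: "op a b \<in> E g \<longleftrightarrow> a \<in> E x \<and> b \<in> E y \<and> P a b" if "a \<in> U" "b \<in> U" for a b
  proof
    assume "op a b \<in> E g"
    then obtain a' b' where "a' \<in> E x" "b' \<in> E y" "op a b = op a' b'" "P a' b'" unfolding g(2) by blast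
    then show "a \<in> E x \<and> b \<in> E y \<and> P a b" using that E_U op_inj by metis
  next
    assume "a \<in> E x \<and> b \<in> E y \<and> P a b"
    then show "op a b \<in> E g" unfolding g(2) using op_in_prd[OF x y] by blast
  qed
  have gp: "pair_in M a b g \<longleftrightarrow> a \<in> E x \<and> b \<in> E y \<and> P a b" if "a \<in> U" "b \<in> U" for a b
    using gm pair_in_M that by simp
  have "is_bij M g x y" unfolding is_bij_def is_fun_def
  proof (intro conjI ballI impI)
    show "is_set M g" using g by simp
    fix p assume "p \<in> E g"
    then obtain a b where "a \<in> E x" "b \<in> E y" "p = op a b" unfolding g(2) by blast
    then show "\<exists>a\<in>E x. \<exists>b\<in>U. is_opair M a b p" using is_opair_M E_U by blast
  next
    fix a assume a: "a \<in> E x"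
    then obtain b where "b \<in> E y" "P a b" "\<And>b'. b' \<in> E y \<Longrightarrow> P a b' \<Longrightarrow> b' = b" using 1 by blast
    then show "\<exists>!b. b \<in> U \<and> pair_in M a b g" using a gp E_U by (intro ex1I[of _ b]) blast+
  next
    fix b assume b: "b \<in> E y"
    then obtain a where "a \<in> E x" "P a b" "\<And>a'. a' \<in> E x \<Longrightarrow> P a' b \<Longrightarrow> a' = a" using 2 by blast
    then show "\<exists>!a. a \<in> E x \<and> pair_in M a b g" using b gp E_U by (intro ex1I[of _ a]) blast+
  qed (use gp E_U in blast)
  then show ?thesis by (auto simp: equinum_def)
qed

lemma infinite_cardinal_j: "infinite_cardinal N (j \<kappa>)"
  unfolding infinite_cardinal_def
proof (intro conjI)
  show "ordinal N (j \<kappa>)" using ordinal_j_iff kappa by (simp add: infinite_cardinal_def)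
  show "\<forall>b\<in>EN (j \<kappa>). \<not> equinum N b (j \<kappa>)"
  proof
    fix b assume "b \<in> EN (j \<kappa>)"
    then obtain b' where "b' \<in> E \<kappa>" "b = j b'" using EN_j by auto
    then show "\<not> equinum N b (j \<kappa>)"
      using equinum_j[OF E_U kappa_U, of b'] kappa by (auto simp: infinite_cardinal_def)
  qed
  show "\<not> (\<exists>n. natural N n \<and> equinum N (j \<kappa>) n)"
  proof
    assume "\<exists>n. natural N n \<and> equinum N (j \<kappa>) n"
    then obtain n where n: "natural N n" "equinum N (j \<kappa>) n" by blast
    then obtain n' where n': "n' \<in> U" "j n' = n" using pure_j by (auto simp: natural_def ordinal_def)
    have "natural M n'"
      using n(1) n' ordinal_j_iff[OF n'(1)] zs_j EN_j[OF n'(1)] E_U by (auto simp: natural_def)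
    then show False using equinum_j[OF kappa_U n'(1)] n n' kappa by (auto simp: infinite_cardinal_def)
  qed
qed

subsection \<open>Dependent choice\<close>

text \<open>Translates the graph in \<open>M\<close> of a sequence of objects of \<open>N\<close>
  into the code of this sequence as a function of \<open>N\<close>; the indices pass through
  \<open>j\<close>.\<close>

definition conv where
  "conv h = un (up (up emp emp) (mk ((\<lambda>z. NP (j (p1 z)) (p2 z)) ` E h)))"

lemma Tm_conv [Dintro]: assumes "Tm f" shows "Tm (\<lambda>s. conv (f s))"
proof (rule Tm_comp1[OF _ assms])
  show "Tm1 conv" unfolding conv_def by (intro Dintro emp)
qed

abbreviation npgr where "npgr F k \<equiv> (\<lambda>i. NP (j i) (F i)) ` E k"

lemma conv_gr:
  assumes F: "Tm1 F" and k: "k \<in> U"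
  shows "conv (gr F k) = mk (insert emp (npgr F k))"
    and "S (npgr F k)"
proof -
  have T: "Tm (\<lambda>s. NP (j (p1 (s 0))) (p2 (s 0)))" by (intro Dintro)
  have T': "Tm (\<lambda>s. NP (j (s 0)) (F (s 0)))" by (intro Dintro Tm_comp1[OF F])
  have eq: "NP (j (p1 (op i (F i)))) (p2 (op i (F i))) = NP (j i) (F i)" if "i \<in> E k" for i
    using E_U[OF that] Tm1_U[OF F] by simp
  note g = gr[OF F k]
  note im = image_mk[OF g(1) T]
  have "(\<lambda>z. NP (j (p1 z)) (p2 z)) ` E (gr F k) = npgr F k"
    unfolding g(2) image_image using eq by (intro image_cong) auto
  then have "E (mk ((\<lambda>z. NP (j (p1 z)) (p2 z)) ` E (gr F k))) = npgr F k"
    using im by simp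
  then have "E (conv (gr F k)) = insert emp (npgr F k)" "conv (gr F k) \<in> U"
    unfolding conv_def using im(1) by simp_all
  then show "conv (gr F k) = mk (insert emp (npgr F k))"
    using mk_E by metis
  show "S (npgr F k)" by (rule S_image[OF k T'])
qed

text \<open>Supports of all values are chosen simultaneously in \<open>M\<close> and united by
  \<open>supp_union\<close>. The union fixes every pair of the sequence, the indices being fixed by
  all flips (\<open>fl_j\<close>).\<close>

lemma conv_NN:
  assumes F: "Tm1 F" and k: "k \<in> U" "E k \<subseteq> E K" and FN: "\<And>i. i \<in> E k \<Longrightarrow> F i \<in> NN"
  shows "is_set N (conv (gr F k))" "EN (conv (gr F k)) = npgr F k"
proof -
  have "\<exists>g. Tm1 g \<and> (\<forall>i\<in>E k. fn (g i) \<and> supp (g i) (F i))"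
  proof (rule choice[OF k(1)])
    show "Def (\<lambda>s. fn (s 1) \<and> supp (s 1) (F (s 0)))" by (intro Dintro F)
    show "\<forall>a\<in>E k. \<exists>b\<in>U. fn b \<and> supp b (F a)" using FN Sym_NN by metis
  qed
  then obtain g where g: "Tm1 g" "\<And>i. i \<in> E k \<Longrightarrow> fn (g i) \<and> supp (g i) (F i)" by blast
  then obtain f where f: "f \<in> U" "fn f" "\<And>i p. i \<in> E k \<Longrightarrow> p \<in> U \<Longrightarrow> cov (g i) p \<Longrightarrow> cov f p"
    using supp_union[OF k g(1)] by blast
  have "fl p y \<in> npgr F k"
    if p: "p \<in> U" "\<not> cov f p" and y: "y \<in> npgr F k" for p y
  proof -
    obtain i where b: "i \<in> E k" "y = NP (j i) (F i)" using y by blast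
    have "fl p (F i) = F i" using g(2)[OF b(1)] f(3)[OF b(1) p(1)] p by (auto simp: supp_def)
    then have "fl p y = y"
      using act_NP[OF perm_flip p(1) j_U[OF E_U[OF b(1)]] NN_U[OF FN[OF b(1)]]] fl_j[OF p(1) E_U[OF b(1)]] b by simp
    then show ?thesis using y by simp
  qed
  moreover have "npgr F k \<subseteq> NN" using NP_NN j_NN E_U FN by blast
  ultimately show "is_set N (conv (gr F k))" "EN (conv (gr F k)) = npgr F k"
    unfolding conv_gr(1)[OF F k(1)] using nsetI[OF conv_gr(2)[OF F k(1)] _ f(1,2)] by blast+
qed

lemma Def_sat_asg: "Def (\<lambda>s. sat N (asg (s 0) (s 1) (s 2)) \<phi>)"
proof -
  have eq: "(\<lambda>k. s (if k = 0 then 0 else if k = 1 then 1 else 2)) = asg (s 0) (s 1) (s 2)" for s :: "nat \<Rightarrow> 'a"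
    by (auto simp: asg_def)
  show ?thesis using Def_ren[OF Def_sat, of "\<lambda>k. if k = 0 then 0 else if k = 1 then 1 else 2"] by (simp only: eq)
qed

lemma DC_N: "DC_scheme N (j \<kappa>)"
  unfolding DC_scheme_def
proof (intro allI ballI impI)
  fix \<phi> u assume "u \<in> univ N" and "\<forall>x\<in>univ N. \<exists>y\<in>univ N. sat N (asg x y u) \<phi>"
  then have u: "u \<in> NN" and ex: "\<And>x. x \<in> NN \<Longrightarrow> \<exists>y\<in>NN. sat N (asg x y u) \<phi>" by auto
  \<comment> \<open>The sequence is built in \<open>M\<close>, with graphs of \<open>M\<close> as
    histories; \<open>conv\<close> presents each history to the formula as an object of
    \<open>N\<close>.\<close>
  define R where "R h y \<longleftrightarrow> y \<in> NN \<and> sat N (asg (conv h) y u) \<phi>" for h y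
  have sub: "E l \<subseteq> E \<kappa>" if "l \<in> E \<kappa>" for l using kappa_trans that by (auto simp: trans_def)
  have "\<exists>F. Tm1 F \<and> (\<forall>l\<in>E \<kappa>. R (gr F l) (F l))"
  proof (rule dependent_choice[OF kappa_trans])
    show "Def2 R"
      unfolding R_def by (intro Dintro Def_Tm3[OF Def_sat_asg] NN_U[OF u])
    fix l F assume a: "l \<in> E \<kappa>" and F: "Tm1 F" "\<forall>i\<in>E l. R (gr F i) (F i)"
    have "is_set N (conv (gr F l))"
      by (rule conv_NN[OF F(1) E_U[OF a]]) (use F(2) sub[OF a] in \<open>auto simp: R_def\<close>)
    then obtain y where "y \<in> NN" "sat N (asg (conv (gr F l)) y u) \<phi>" using ex set_NN by blast
    then show "\<exists>y\<in>U. R (gr F l) y" using NN_U by (auto simp: R_def)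
  qed
  then obtain F where F: "Tm1 F" "\<And>l. l \<in> E \<kappa> \<Longrightarrow> R (gr F l) (F l)" by blast
  have FN: "F i \<in> NN" if "i \<in> E \<kappa>" for i using F(2)[OF that] by (simp add: R_def)
  have conv: "is_set N (conv (gr F k)) \<and> EN (conv (gr F k)) = npgr F k"
    if "k \<in> U" "E k \<subseteq> E \<kappa>" for k
    using conv_NN[OF F(1) that(1)] that(2) FN by auto
  define f where "f = conv (gr F \<kappa>)"
  have f: "is_set N f" "EN f = npgr F \<kappa>" using conv[of \<kappa>] by (auto simp: f_def)
  have pf: "pair_in N (j i) b f \<longleftrightarrow> b = F i" if "i \<in> E \<kappa>" "b \<in> NN" for i b
  proof -
    have "NP (j i) b \<in> EN f \<longleftrightarrow> (\<exists>m\<in>E \<kappa>. NP (j i) b = NP (j m) (F m))" unfolding f(2) by blast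
    also have "\<dots> \<longleftrightarrow> b = F i" using NP_inj that FN j_NN E_U j_eq by (metis (no_types, lifting))
    finally show ?thesis using pair_in_N j_NN E_U that by blast
  qed
  have "is_fun N f (j \<kappa>)" unfolding is_fun_def EN_j[OF kappa_U]
  proof (intro conjI ballI)
    fix p assume "p \<in> EN f"
    then obtain i where "i \<in> E \<kappa>" "p = NP (j i) (F i)" using f(2) by auto
    moreover from this have "is_opair N (j i) (F i) p" using is_opair_N FN j_NN E_U by blast
    ultimately show "\<exists>a\<in>j ` E \<kappa>. \<exists>b\<in>univ N. is_opair N a b p" using FN by (metis N_sel(1) imageI)
  next
    fix a assume "a \<in> j ` E \<kappa>"
    then obtain i where "i \<in> E \<kappa>" "a = j i" by blast
    then show "\<exists>!b. b \<in> univ N \<and> pair_in N a b f" using pf FN by (intro ex1I[of _ "F i"]) auto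
  qed (use f in simp)
  moreover have "\<exists>g. \<exists>v\<in>univ N. is_restr N f l g \<and> pair_in N l v f \<and> sat N (asg g v u) \<phi>"
    if al: "l \<in> EN (j \<kappa>)" for l
  proof -
    obtain i where b: "i \<in> E \<kappa>" "l = j i" using al EN_j by auto
    let ?g = "conv (gr F i)"
    have g: "is_set N ?g" "EN ?g = npgr F i"
      using conv[OF E_U[OF b(1)] sub[OF b(1)]] by auto
    have "EN ?g = {p \<in> EN f. \<exists>a\<in>EN l. \<exists>b\<in>univ N. is_opair N a b p}" (is "_ = ?P")
    proof (intro equalityI subsetI)
      fix p assume "p \<in> EN ?g"
      then obtain m where c: "m \<in> E i" "p = NP (j m) (F m)" using g(2) by auto
      then have ck: "m \<in> E \<kappa>" using sub b by blast
      have "is_opair N (j m) (F m) p" using is_opair_N j_NN FN ck c E_U by blast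
      moreover have "j m \<in> EN l" using b c EN_j E_U by auto
      ultimately show "p \<in> ?P"
        using f(2) ck c(2) FN[OF ck] by auto
    next
      fix p assume p: "p \<in> ?P"
      then obtain m where c: "m \<in> E \<kappa>" "p = NP (j m) (F m)" using f(2) by auto
      obtain a v where a: "a \<in> EN l" "v \<in> NN" "is_opair N a v p" using p by auto
      then obtain n where d: "n \<in> E i" "a = j n" using b EN_j E_U by auto
      have "p = NP (j n) v" using a d is_opair_N j_NN E_U by blast
      then have "j m = j n" using c NP_inj j_NN FN E_U a d by metis
      then have "m = n" using c d E_U j_eq by blast
      then show "p \<in> EN ?g" using g(2) c d by auto
    qed
    then have "is_restr N f l ?g" using g(1) by (simp add: is_restr_def)
    moreover have "pair_in N l (F i) f" using pf b FN by auto
    moreover have "F i \<in> univ N" "sat N (asg ?g (F i) u) \<phi>" using F(2)[OF b(1)] by (auto simp: R_def)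
    ultimately show ?thesis by blast
  qed
  ultimately show "\<exists>f. is_fun N f (j \<kappa>) \<and> (\<forall>l\<in>EN (j \<kappa>). \<exists>g. \<exists>v\<in>univ N.
      is_restr N f l g \<and> pair_in N l v f \<and> sat N (asg g v u) \<phi>)" by blast
qed

subsection \<open>Failure of Hume's Principle\<close>

text \<open>The bijection is the graph of the permutation on \<open>x\<close>. As the permutation
  commutes with every flip, a flip sends the pair at \<open>u\<close> to the pair at the flipped
  \<open>u\<close>, so any support of \<open>x\<close> supports the graph.\<close>

lemma equinum_act:
  assumes comp: "compat h (\<lambda>q p. p)" and q: "q \<in> U" and x: "is_set N x"
  shows "equinum N x (act h q x)"
proof -
  let ?F = "\<lambda>u. NP u (act h q u)"
  have ph: "perm h" using comp by (simp add: compat_def)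
  have xN: "x \<in> NN" "x \<in> U" using x set_NN NN_U by auto
  obtain f where f: "f \<in> U" "fn f" "supp f x" using Sym_NN[OF xN(1)] .
  have EN: "mk (EN x) \<in> U" "E (mk (EN x)) = EN x" using mk_S[OF S_EN[OF xN(2)]] by auto
  have "Tm (\<lambda>s. ?F (s 0))" by (intro Dintro Tm_act[OF ph] q)
  from S_image[OF EN(1) this] have SF: "S (?F ` EN x)" by (simp add: EN(2))
  have "nset (?F ` EN x)"
  proof (rule nsetI(1)[OF SF _ f(1,2)])
    show "?F ` EN x \<subseteq> NN" using NP_NN EN_NN NN_act[OF comp q] by blast
    fix p y assume p: "p \<in> U" "\<not> cov f p" and "y \<in> ?F ` EN x"
    then obtain u where u: "u \<in> EN x" "y = ?F u" by blast
    have "fl p x = x" using f p by (simp add: supp_def)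
    then have "fl p u \<in> EN x" using EN_fl[OF p(1) xN(1)] u by force
    moreover have "fl p y = ?F (fl p u)"
      using act_NP[OF perm_flip p(1) EN_U[OF u(1)]] act_U[OF ph q EN_U[OF u(1)]]
        act_flip_comm[OF comp q p(1) EN_U[OF u(1)]] u(2) by simp
    ultimately show "fl p y \<in> ?F ` EN x" by blast
  qed
  then obtain g where g: "is_set N g" "EN g = ?F ` EN x" by (auto simp: nset_def)
  have pg: "pair_in N a b g \<longleftrightarrow> a \<in> EN x \<and> b = act h q a" if ab: "a \<in> NN" "b \<in> NN" for a b
  proof -
    have "NP a b = ?F u \<longleftrightarrow> a = u \<and> b = act h q u" if "u \<in> EN x" for u
      using NP_inj[OF ab EN_NN[OF that] NN_act[OF comp q EN_NN[OF that]]] .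
    then show ?thesis using pair_in_N[OF ab] g(2) by auto
  qed
  have "is_bij N g x (act h q x)"
    unfolding is_bij_def is_fun_def EN_act_image[OF comp q xN(1)]
  proof (intro conjI ballI impI)
    fix p assume "p \<in> EN g"
    then obtain u where u: "u \<in> EN x" "p = ?F u" using g(2) by blast
    then have "is_opair N u (act h q u) p" using is_opair_N EN_NN NN_act[OF comp q] by blast
    moreover have "act h q u \<in> univ N" using u EN_NN NN_act[OF comp q] by simp
    ultimately show "\<exists>a\<in>EN x. \<exists>b\<in>univ N. is_opair N a b p" using u by blast
  next
    fix a assume a: "a \<in> EN x"
    show "\<exists>!b. b \<in> univ N \<and> pair_in N a b g"
      by (rule ex1I[of _ "act h q a"]) (use a pg EN_NN NN_act[OF comp q] in auto)
  next
    fix a b assume "a \<in> EN x" "b \<in> univ N" "pair_in N a b g"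
    then show "b \<in> act h q ` EN x" using pg EN_NN by auto
  next
    fix b assume "b \<in> act h q ` EN x"
    then obtain a where a: "a \<in> EN x" "b = act h q a" by blast
    have bN: "b \<in> NN" using a EN_NN NN_act[OF comp q] by blast
    show "\<exists>!a. a \<in> EN x \<and> pair_in N a b g"
    proof (rule ex1I[of _ a])
      show "a \<in> EN x \<and> pair_in N a b g" using a pg[OF EN_NN[OF a(1)] bN] by blast
      fix a' assume a': "a' \<in> EN x \<and> pair_in N a' b g"
      then have "act h q a' = act h q a" using pg[OF EN_NN[of a' x] bN] a by simp
      then show "a' = a" using act_inj[OF ph q EN_U EN_U] a a' by blast
    qed
  qed (use g in simp)
  then show ?thesis by (auto simp: equinum_def)
qed

text \<open>Only the flip at \<open>p\<close> can move \<open>op p r\<close>, so a support with a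
  single point suffices; \<open>emp\<close> is taken as its argument because it lies in
  \<open>W\<close>.\<close>

lemma pair_NN: assumes "p \<in> U" "r \<in> U" shows "op p r \<in> NN"
proof -
  let ?f = "up (op emp p) (op emp p)"
  have "fn ?f" using assms by (auto simp: fn_def)
  moreover have "supp ?f (op p r)" unfolding supp_def
  proof (intro ballI impI)
    fix q assume q: "q \<in> U" "\<not> cov ?f q"
    then have "q \<noteq> p" using W(2) assms by (auto simp: cov_def)
    then show "fl q (op p r) = op p r"
      using act_ure[OF perm_flip q(1), of "op p r"] flip_op assms by simp
  qed
  moreover have "op p r \<noteq> emp" using not_isp_emp assms isp_op by metis
  ultimately show ?thesis
    using NN_iff[of "op p r"] assms op_no_marker unfolding Sym_def
    by (metis emp(1) op up(1))
qed

definition one where "one = up emp emp"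
text \<open>The indices of colour \<open>i\<close> are numbered by the subsets of \<open>W\<close>,
  so that \<open>cantor\<close> finds one outside any support. A flip can only interchange
  \<open>emp\<close> and \<open>one\<close> here, so \<open>Block i\<close> has empty
  support.\<close>

definition block where "block i = prd (prd (up i i) (pw W)) (up emp one)"
definition Block where "Block i = mk (insert emp (E (block i)))"

lemma one [simp]: "one \<in> U" "E one = {emp}" by (simp_all add: one_def)

lemma tog_one: "tog emp emp = one" "tog emp one = emp"
  by (rule ext; auto simp: tog)+

lemma one_ne: "one \<noteq> emp" 
proof -
  have "E one \<noteq> E emp" by simp
  then show ?thesis by metis
qed

lemma block: assumes "i \<in> U"
  shows "block i \<in> U" "z \<in> E (block i) \<longleftrightarrow> (\<exists>n\<in>E (pw W). z = op (op i n) emp \<or> z = op (op i n) one)"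
proof -
  have P: "prd (up i i) (pw W) \<in> U" "\<And>p. p \<in> E (prd (up i i) (pw W)) \<longleftrightarrow> (\<exists>n\<in>E (pw W). p = op i n)"
    using assms W(1) prd(1)[of "up i i" "pw W"] prd(2)[of "up i i" "pw W"] by auto
  show "block i \<in> U" unfolding block_def using prd(1)[OF P(1)] by simp
  have "z \<in> E (block i) \<longleftrightarrow> z \<in> U \<and> (\<exists>p\<in>E (prd (up i i) (pw W)). z = op p emp \<or> z = op p one)"
    unfolding block_def using prd(2)[OF P(1), of "up emp one"] by auto
  also have "\<dots> \<longleftrightarrow> z \<in> U \<and> (\<exists>n\<in>E (pw W). z = op (op i n) emp \<or> z = op (op i n) one)"
    unfolding Bex_def P(2) by blast
  also have "\<dots> \<longleftrightarrow> (\<exists>n\<in>E (pw W). z = op (op i n) emp \<or> z = op (op i n) one)"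
    using assms E_U[of _ "pw W"] by auto
  finally show "z \<in> E (block i) \<longleftrightarrow> (\<exists>n\<in>E (pw W). z = op (op i n) emp \<or> z = op (op i n) one)" .
qed

lemma Block: assumes i: "i \<in> U" shows "is_set N (Block i)" "EN (Block i) = E (block i)"
proof -
  have sub: "E (block i) \<subseteq> NN" using block[OF i] pair_NN i E_U by auto
  have "fl p y \<in> E (block i)" if p: "p \<in> U" and y: "y \<in> E (block i)" for p y
  proof -
    obtain n r where n: "n \<in> E (pw W)" "y = op (op i n) r" "r = emp \<or> r = one" using y block[OF i] by blast
    have U: "n \<in> U" "op i n \<in> U" "r \<in> U" using n i E_U by auto
    then have "fl p y = flip p y" using act_ure[OF perm_flip p] n by simp
    then have "fl p y = op (op i n) r \<or> fl p y = op (op i n) (tog emp r)" using flip_op U n by simp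
    then show ?thesis using n block[OF i] tog_one by auto
  qed
  then show "is_set N (Block i)" "EN (Block i) = E (block i)"
    unfolding Block_def using nsetI[OF S_E[OF block(1)[OF i]] sub emp(1) fn_emp] by blast+
qed

text \<open>If all these indices were covered, \<open>e\<close> would map a subset of
  \<open>W\<close> onto the power set of \<open>W\<close>; \<open>d\<close> is the diagonal
  set.\<close>

lemma cantor: assumes e: "e \<in> U" "fn e" and i: "i \<in> U"
  shows "\<exists>n\<in>E (pw W). \<not> cov e (op i n)"
proof (rule ccontr)
  assume neg: "\<not> (\<exists>n\<in>E (pw W). \<not> cov e (op i n))"
  have "S {w \<in> E W. \<exists>n\<in>E (pw W). op w (op i n) \<in> E e \<and> w \<notin> E n}"
    by (intro S_sep Dintro W e i)
  then obtain d where d: "d \<in> U" "E d = {w \<in> E W. \<exists>n\<in>E (pw W). op w (op i n) \<in> E e \<and> w \<notin> E n}"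
    by (auto simp: S_def)
  then have "d \<in> E (pw W)" using W by auto
  then obtain w where w: "w \<in> E W" "op w (op i d) \<in> E e" using neg by (auto simp: cov_def)
  have "n = d" if "n \<in> E (pw W)" "op w (op i n) \<in> E e" for n
  proof -
    have "op i n = op i d" using e(2) w that i d(1) E_U op unfolding fn_def by metis
    then show ?thesis using i d(1) E_U[OF that(1)] by simp
  qed
  then show False using w d(2) \<open>d \<in> E (pw W)\<close> by blast
qed

lemma not_equinum:
  assumes i: "i \<in> U" and k: "k \<in> U" "i \<noteq> k"
    and y: "\<And>b. b \<in> EN y \<Longrightarrow> \<exists>n\<in>U. \<exists>r\<in>U. b = op (op k n) r"
  shows "\<not> equinum N (Block i) y"
proof
  assume "equinum N (Block i) y"
  then obtain f where f: "is_bij N f (Block i) y" by (auto simp: equinum_def)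
  then have fN: "f \<in> NN" using set_NN by (auto simp: is_bij_def is_fun_def)
  then obtain e where e: "e \<in> U" "fn e" "supp e f" using Sym_NN by blast
  \<comment> \<open>The flip at this uncovered index fixes \<open>f\<close> and also the value
    \<open>b\<close>, which has another colour, but it exchanges the two urelements of the index.
    Both are then sent to \<open>b\<close>.\<close>
  obtain n where n: "n \<in> E (pw W)" "\<not> cov e (op i n)" using cantor[OF e(1,2) i] by blast
  have nU: "n \<in> U" using n E_U by blast
  define p where "p = op i n"
  have pU: "p \<in> U" using i nU by (simp add: p_def)
  have u: "op p emp \<in> EN (Block i)" "op p one \<in> EN (Block i)" using Block[OF i] block[OF i] n by (auto simp: p_def)
  have flu: "fl p (op p emp) = op p one"
    using act_ure[OF perm_flip pU] flip_op pU tog_one by simp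
  have A: "\<forall>a\<in>EN (Block i). \<exists>!b. b \<in> NN \<and> pair_in N a b f"
    and B: "\<forall>a\<in>EN (Block i). \<forall>b\<in>NN. pair_in N a b f \<longrightarrow> b \<in> EN y"
    and C: "\<forall>b\<in>EN y. \<exists>!a. a \<in> EN (Block i) \<and> pair_in N a b f"
    using f by (simp_all add: is_bij_def is_fun_def)
  obtain b where b: "b \<in> NN" "pair_in N (op p emp) b f" using A u by blast
  then have by': "b \<in> EN y" using B u by blast
  obtain m r where m: "m \<in> U" "r \<in> U" "b = op (op k m) r" using y[OF by'] by blast
  have "fl p b = b"
    using act_ure[OF perm_flip pU, of b] flip_op m k i nU by (simp add: p_def)
  moreover have "fl p f = f" using e n pU by (simp add: supp_def p_def)
  moreover have "NP (op p emp) b \<in> EN f" using b pair_in_N EN_NN u by blast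
  ultimately have "NP (op p one) b \<in> EN f"
    using EN_act_image[OF compat_flip pU fN] act_NP[OF perm_flip pU, of "op p emp" b] flu pU NN_U[OF b(1)]
    by (metis emp(1) image_eqI op)
  then have "pair_in N (op p one) b f" using pair_in_N EN_NN u b(1) by blast
  then have "op p emp = op p one" using C by' u b(2) by blast
  then show False using pU one_ne by simp
qed

lemma trans_pair: assumes T: "trans T" and ab: "a \<in> U" "b \<in> U" "op a b \<in> E T" shows "a \<in> E T" "b \<in> E T"
proof -
  have "up a b \<in> E (op a b)" "E (up a b) = {a, b}" using op_E ab by auto
  then show "a \<in> E T" "b \<in> E T" using T ab(3) unfolding trans_def by blast+
qed

lemma definable_act:
  assumes comp: "compat h a" and q: "q \<in> U" and u: "u \<in> NN" "act h q u = u"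
    and F: "\<And>x y. x \<in> NN \<Longrightarrow> y \<in> NN \<Longrightarrow> sat N (asg x y u) \<phi> \<longleftrightarrow> is_set N x \<and> y = F x"
    and x: "is_set N x" "F x \<in> NN"
  shows "F (act h q x) = act h q (F x)"
proof -
  have xN: "x \<in> NN" using x set_NN by blast
  have "sat N (asg x (F x) u) \<phi>" using F[OF xN x(2)] x by simp
  then have "sat N (\<lambda>i. act h q (asg x (F x) u i)) \<phi>"
    using sat_act[OF comp q, of "asg x (F x) u"] xN x(2) u(1) by (simp add: asg_def)
  moreover have "(\<lambda>i. act h q (asg x (F x) u i)) = asg (act h q x) (act h q (F x)) u"
    using u(2) by (auto simp: asg_def)
  ultimately show ?thesis using F NN_act[OF comp q] xN x(2) by auto
qed

lemma no_Hume: assumes def: "param_definable N F" shows "\<not> fulfills_Hume N F"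
proof
  assume Hume: "fulfills_Hume N F"
  obtain \<phi> u where u: "u \<in> NN"
    and F: "\<And>x y. x \<in> NN \<Longrightarrow> y \<in> NN \<Longrightarrow> sat N (asg x y u) \<phi> \<longleftrightarrow> is_set N x \<and> y = F x"
    using def unfolding param_definable_def N_sel by blast
  have FN: "F x \<in> NN" if "is_set N x" for x using Hume that by (simp add: fulfills_Hume_def)
  have Feq: "equinum N x y \<longleftrightarrow> F x = F y" if "is_set N x" "is_set N y" for x y
    using Hume that by (simp add: fulfills_Hume_def)
  \<comment> \<open>The transitive set \<open>T\<close> itself serves as the colour: a urelement of
    colour \<open>T\<close> inside \<open>T\<close> would make \<open>T\<close> a member of
    itself.\<close>
  obtain T where T: "trans T" "u \<in> E T" using ex_trans_mem NN_U u by blast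
  have TU: "T \<in> U" using T by (simp add: trans_def)
  define A where "A = Block T"
  have A: "is_set N A" "EN A = E (block T)" using Block[OF TU] by (auto simp: A_def)
  define y where "y = F A"
  have y: "y \<in> NN" "y \<in> U" using FN[OF A(1)] NN_U by (auto simp: y_def)
  have "un (up (up y u) (up T T)) \<in> U" "E (un (up (up y u) (up T T))) = {y, u, T}"
    using y TU NN_U[OF u] by auto
  \<comment> \<open>\<open>T'\<close> is both the element toggled by the shift and the new colour,
    so one \<open>q\<close> serves \<open>shift\<close> and \<open>swap\<close>. Having
    \<open>T\<close> in \<open>T'\<close> keeps \<open>T'\<close> out of \<open>T\<close>, so
    neither colour occurs in \<open>T\<close>.\<close>
  then obtain T' where T': "trans T'" "y \<in> E T'" "u \<in> E T'" "T \<in> E T'"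
    using ex_trans by (metis insert_subset)
  have T'U: "T' \<in> U" using T' by (simp add: trans_def)
  have cyc: "T \<notin> E T" "T' \<notin> E T'" "T' \<notin> E T" using no_cycle1 no_cycle2 TU T'U T'(4) by blast+
  define q where "q = op T T'"
  have q: "q \<in> U" "p1 q = T" "p2 q = T'" using TU T'U by (auto simp: q_def)
  have "act shift q u = u"
  proof (rule act_fix[OF perm_shift q(1) T(1) _ T(2)])
    fix z assume z: "z \<in> E T"
    show "shift q z = z"
    proof (cases "isp z")
      case True
      then obtain a b where ab: "a \<in> U" "b \<in> U" "z = op a b" by (rule ispE)
      have "p1 a \<noteq> T" if "isp a"
      proof -
        obtain c d where cd: "c \<in> U" "d \<in> U" "a = op c d" using \<open>isp a\<close> by (rule ispE)
        then have "c \<in> E T" using trans_pair[OF T(1)] ab z by blast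
        then show ?thesis using cd cyc(1) by auto
      qed
      then have "\<not> (isp a \<and> p1 a = T)" by blast
      then show ?thesis unfolding ab(3) shift_op[OF ab(1,2)] q(2) by (rule if_not_P)
    qed simp
  qed
  then have "F (act shift q A) = act shift q y"
    using definable_act[OF compat_shift q(1) u _ F A(1)] FN[OF A(1)] by (simp add: y_def)
  moreover have "F A = F (act shift q A)"
    using Feq[OF A(1) setN_act[OF compat_shift q(1) A(1)]] equinum_act[OF compat_shift q(1) A(1)] by simp
  ultimately have sy: "act shift q y = y" by (simp add: y_def)
  have "act swap q u = u"
  proof (rule act_fix[OF perm_swap q(1) T(1) _ T(2)])
    fix z assume z: "z \<in> E T"
    show "swap q z = z"
    proof (cases "isp z")
      case True
      then obtain a b where ab: "a \<in> U" "b \<in> U" "z = op a b" by (rule ispE)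
      have "hat q a = a"
      proof (cases "isp a")
        case True
        then obtain c d where cd: "c \<in> U" "d \<in> U" "a = op c d" by (rule ispE)
        then have "c \<in> E T" using trans_pair[OF T(1)] ab z by blast
        then have "c \<noteq> T" "c \<noteq> T'" using cyc by auto
        then show ?thesis using cd q by (simp add: hat_def)
      qed simp
      then show ?thesis using ab swap_op by simp
    qed simp
  qed
  moreover have "act swap q y = y"
  proof -
    \<comment> \<open>Staying in \<open>T'\<close> together with the shift passes on to coded
      members and holds for \<open>y\<close>, which the shift fixes. A urelement of colour
      \<open>T\<close> cannot satisfy it: its second component lies in \<open>T'\<close> and so
      omits \<open>T'\<close>, hence the shift inserts \<open>T'\<close>, and transitivity would
      give \<open>T'\<close> in \<open>T'\<close>.\<close>
    have "z \<in> E T' \<and> act shift q z \<in> E T' \<longrightarrow> act swap q z = z" if "z \<in> U" for z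
      using that
    proof (induction rule: eps_induct)
      show "Def (\<lambda>s. s 0 \<in> E T' \<and> act shift q (s 0) \<in> E T' \<longrightarrow> act swap q (s 0) = s 0)"
        by (intro Dintro Tm_act[OF perm_shift] Tm_act[OF perm_swap] q T'U)
    next
      fix z assume z: "z \<in> U"
        and IH: "\<And>w. w \<in> E z \<Longrightarrow> w \<in> E T' \<and> act shift q w \<in> E T' \<longrightarrow> act swap q w = w"
      show "z \<in> E T' \<and> act shift q z \<in> E T' \<longrightarrow> act swap q z = z"
      proof (intro impI, elim conjE)
        assume zT: "z \<in> E T'" and sz: "act shift q z \<in> E T'"
        show "act swap q z = z"
        proof (cases "emp \<in> E z")
          case True
          have "act swap q w = w" if "w \<in> E z" for w
          proof -
            have "act shift q w \<in> E (act shift q z)" using act_set[OF perm_shift q(1) z True] that by blast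
            then show ?thesis using IH[OF that] that zT sz T'(1) unfolding trans_def by blast
          qed
          then have "act swap q ` E z = E z" by force
          then show ?thesis using act_set[OF perm_swap q(1) z True] act_U[OF perm_swap q(1) z] z by (intro ext) auto
        next
          case False
          have "swap q z = z"
          proof (cases "isp z")
            case True
            then obtain a b where ab: "a \<in> U" "b \<in> U" "z = op a b" by (rule ispE)
            have abT: "a \<in> E T'" "b \<in> E T'" using trans_pair[OF T'(1)] ab zT by blast+
            have "hat q a = a"
            proof (cases "isp a")
              case True
              then obtain c d where cd: "c \<in> U" "d \<in> U" "a = op c d" by (rule ispE)
              then have "c \<noteq> T'" using trans_pair[OF T'(1)] abT cyc by blast
              moreover have "c \<noteq> T"
              proof
                assume "c = T"
                then have "act shift q z = op a (tog T' b)"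
                  using act_ure[OF perm_shift q(1) z False] shift_op[OF ab(1,2)] ab cd q by simp
                then have "tog T' b \<in> E T'" using trans_pair[OF T'(1) ab(1)] sz tog(1)[OF T'U ab(2)] by simp
                moreover have "T' \<notin> E b" using abT(2) T'(1) cyc unfolding trans_def by blast
                then have "T' \<in> E (tog T' b)" using tog(2)[OF T'U ab(2)] T'U by simp
                ultimately show False using T'(1) cyc unfolding trans_def by blast
              qed
              ultimately show ?thesis using cd q by (simp add: hat_def)
            qed simp
            then show ?thesis using ab swap_op by simp
          qed simp
          then show ?thesis using act_ure[OF perm_swap q(1) z False] by simp
        qed
      qed
    qed
    then show ?thesis using y T'(2) sy by simp
  qed
  ultimately have "F (act swap q A) = F A"
    using definable_act[OF compat_swap q(1) u _ F A(1)] FN[OF A(1)] by (simp add: y_def)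
  then have "equinum N A (act swap q A)"
    using Feq[OF A(1) setN_act[OF compat_swap q(1) A(1)]] by simp
  moreover have "\<not> equinum N (Block T) (act swap q A)"
  proof (rule not_equinum[OF TU T'U])
    show "T \<noteq> T'" using T'(4) cyc by blast
    fix b assume "b \<in> EN (act swap q A)"
    then obtain c where c: "c \<in> E (block T)" "b = act swap q c"
      using EN_act_image[OF compat_swap q(1) set_NN[OF A(1)]] A(2) by auto
    obtain n r where n: "n \<in> E (pw W)" "c = op (op T n) r" "r = emp \<or> r = one" using c block[OF TU] by blast
    have U: "n \<in> U" "op T n \<in> U" "r \<in> U" using n TU E_U by auto
    have "b = swap q c" using c n U act_ure[OF perm_swap q(1)] by simp
    then have "b = op (op T' n) r" using n U swap_op[OF U(2,3)] q TU by (simp add: hat_def)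
    then show "\<exists>n\<in>U. \<exists>r\<in>U. b = op (op T' n) r" using U by blast
  qed
  ultimately show False by (simp add: A_def)
qed

subsection \<open>Reflection\<close>

text \<open>A requirement states what a later stage \<open>d\<close> must provide for a stage
  \<open>c\<close>. Monotonicity in \<open>d\<close> lets several requirements be met at once by a
  union.\<close>

definition req :: "('a \<Rightarrow> 'a \<Rightarrow> bool) \<Rightarrow> bool" where
  "req Q \<longleftrightarrow> Def2 Q \<and> (\<forall>c\<in>U. \<exists>d\<in>U. Q c d) \<and>
    (\<forall>c\<in>U. \<forall>d\<in>U. \<forall>d'\<in>U. Q c d \<and> E d \<subseteq> E d' \<longrightarrow> Q c d')"

text \<open>\<open>t\<close> is a chain of stages, and the candidate for reflection is its union.
  Comparability puts any two members of the union into a common stage.\<close>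

definition closed :: "('a \<Rightarrow> 'a \<Rightarrow> bool) \<Rightarrow> 'a \<Rightarrow> bool" where
  "closed Q t \<longleftrightarrow> t \<in> U \<and> (\<forall>y\<in>E t. \<forall>z\<in>E t. E y \<subseteq> E z \<or> E z \<subseteq> E y) \<and> (\<forall>y\<in>E t. \<exists>z\<in>E t. Q y z)"

lemma req_conj: assumes "req P" "req Q" shows "req (\<lambda>c d. P c d \<and> Q c d)"
  unfolding req_def
proof (intro conjI)
  have D: "Def2 P" "Def2 Q" using assms by (auto simp: req_def)
  show "Def (\<lambda>s. P (s 0) (s 1) \<and> Q (s 0) (s 1))" by (intro Def_conj D)
  show "\<forall>c\<in>U. \<exists>d\<in>U. P c d \<and> Q c d"
  proof
    fix c assume c: "c \<in> U"
    obtain d d' where d: "d \<in> U" "P c d" "d' \<in> U" "Q c d'" using assms c unfolding req_def by meson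
    have u: "un (up d d') \<in> U" "E d \<subseteq> E (un (up d d'))" "E d' \<subseteq> E (un (up d d'))" using d by auto
    have "P c (un (up d d'))" using assms(1) c d(1,2) u unfolding req_def by blast
    moreover have "Q c (un (up d d'))" using assms(2) c d(3,4) u unfolding req_def by blast
    ultimately show "\<exists>d\<in>U. P c d \<and> Q c d" using u(1) by blast
  qed
  show "\<forall>c\<in>U. \<forall>d\<in>U. \<forall>d'\<in>U. (P c d \<and> Q c d) \<and> E d \<subseteq> E d' \<longrightarrow> P c d' \<and> Q c d'"
    using assms unfolding req_def by blast
qed

lemma closed_conj: "closed (\<lambda>c d. P c d \<and> Q c d) t \<Longrightarrow> closed P t \<and> closed Q t"
  unfolding closed_def by blast

text \<open>The step \<open>G\<close> adds the union of all least-rank solutions, so nothing has to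
  be chosen; by monotonicity the enlarged stage still solves \<open>Q\<close>.\<close>

lemma ex_closed: assumes Q: "req Q" and c: "c \<in> U" shows "\<exists>t. closed Q t \<and> c \<in> E t"
proof -
  have D: "Def2 Q" using Q by (simp add: req_def)
  have D': "Def (\<lambda>s. Q (s 1) (s 0))" using Def_ren[OF D, of "\<lambda>i. 1 - i"] by simp
  define G where "G c = un (up c (un (mk (scott (Q c)))))" for c
  have Ts: "Tm (\<lambda>s. mk (scott (Q (s 0))))" using Tm_scott[of "\<lambda>y s. Q (s 0) y"] D' by simp
  have TG: "Tm1 G" unfolding G_def by (intro Dintro Ts)
  have G: "E y \<subseteq> E (G y) \<and> Q y (G y)" if y: "y \<in> U" for y
  proof -
    have sc: "mk (scott (Q y)) \<in> U" "E (mk (scott (Q y))) = scott (Q y)"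
      using mk_S[OF S_scott[OF Def_inst1[OF D y]]] by auto
    have GU: "G y \<in> U" using Tm1_U[OF TG y] .
    obtain d where "d \<in> U" "Q y d" using Q y unfolding req_def by blast
    from scott_ne[OF Def_inst1[OF D y] this] obtain d where d: "d \<in> scott (Q y)" by blast
    then have d': "d \<in> U" "Q y d" by (auto simp: scott_def)
    have "E (G y) = E y \<union> (\<Union>d\<in>scott (Q y). E d)" using y sc by (auto simp: G_def)
    then show ?thesis using d d' Q y GU unfolding req_def by blast
  qed
  obtain t where "t \<in> U" "c \<in> E t" "\<forall>y\<in>E t. G y \<in> E t"
      "(\<forall>y\<in>U. E y \<subseteq> E (G y)) \<longrightarrow> (\<forall>y\<in>E t. \<forall>z\<in>E t. E y \<subseteq> E z \<or> E z \<subseteq> E y)"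
    using ex_iteration[OF TG c] by blast
  then have "closed Q t" unfolding closed_def using G E_U by blast
  then show ?thesis using \<open>c \<in> E t\<close> by blast
qed

text \<open>Extends \<open>Def_sat\<close> from variables to terms at all places at once, as
  required when a whole assignment is decoded from one object.\<close>

lemma Def_sat_Tm: "(\<And>k. Tm (F k)) \<Longrightarrow> Def (\<lambda>e. sat N (\<lambda>k. F k e) \<phi>)"
proof (induction \<phi> arbitrary: F)
  case (AllF i p)
  let ?F = "\<lambda>k. if k = i then (\<lambda>e. e 0) else (\<lambda>e. F k (\<lambda>l. e (Suc l)))"
  have "Tm (?F k)" for k using Tm_ren[OF AllF.prems, where r = Suc] Tm_var by simp
  from AllF.IH[OF this] have "Def (\<lambda>e. sat N (\<lambda>k. ?F k e) p)" .
  moreover have "(\<lambda>k. ?F k e) = (\<lambda>k. F k (\<lambda>l. e (Suc l)))(i := e 0)" for e by auto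
  ultimately have "Def (\<lambda>e. sat N ((\<lambda>k. F k (\<lambda>l. e (Suc l)))(i := e 0)) p)" by (simp only:)
  then have "Def (\<lambda>e. \<forall>a\<in>NN. sat N ((\<lambda>k. F k e)(i := a)) p)" by (rule Def_all_NN)
  then show ?case by simp
next
  case (MemF i j)
  have "Def (\<lambda>e. F i e \<in> E (F j e) \<and> emp \<in> E (F j e) \<and> F i e \<noteq> emp)" by (intro Dintro emp MemF)
  then show ?case by simp
next
  case (UreF i)
  have "Def (\<lambda>e. emp \<notin> E (F i e))" by (intro Dintro emp UreF)
  then show ?case by simp
next
  case (EqF i j)
  have "Def (\<lambda>e. F i e = F j e)" by (intro Dintro EqF)
  then show ?case by simp
next
  case (NegF p)
  then show ?case using Def_not[OF NegF.IH[OF NegF.prems]] by simp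
next
  case (ConjF p q)
  then show ?case using Def_conj[OF ConjF.IH(1)[OF ConjF.prems] ConjF.IH(2)[OF ConjF.prems]] by simp
qed

text \<open>Coding the finitely many relevant values of an assignment by nested pairs reduces the
  collection of witnesses to one variable.\<close>

definition dec :: "'a \<Rightarrow> nat \<Rightarrow> 'a" where "dec z k = p1 ((p2 ^^ k) z)"

lemma Tm_dec: assumes "Tm f" shows "Tm (\<lambda>e. dec (f e) k)"
proof -
  have "Tm (\<lambda>e. (p2 ^^ k) (f e))" by (induction k) (simp_all add: assms Tm_p2)
  then show ?thesis unfolding dec_def by (rule Tm_p1)
qed

primrec tup :: "(nat \<Rightarrow> 'a) \<Rightarrow> nat \<Rightarrow> 'a" where
  "tup s 0 = emp"
| "tup s (Suc n) = op (s 0) (tup (\<lambda>k. s (Suc k)) n)"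

lemma tup_U: "(\<And>k. s k \<in> U) \<Longrightarrow> tup s n \<in> U"
  by (induction n arbitrary: s) auto

lemma dec_tup: "(\<And>k. s k \<in> U) \<Longrightarrow> k < n \<Longrightarrow> dec (tup s n) k = s k"
proof (induction n arbitrary: s k)
  case (Suc n)
  have "tup (\<lambda>k. s (Suc k)) n \<in> U" using Suc.prems by (intro tup_U)
  then show ?case
    using Suc.IH[of "\<lambda>k. s (Suc k)"] Suc.prems by (cases k) (simp_all add: dec_def funpow_swap1)
qed simp

lemma tup_closed:
  assumes "\<And>a b. a \<in> C \<Longrightarrow> b \<in> C \<Longrightarrow> op a b \<in> C" "emp \<in> C" "\<And>k. s k \<in> C"
  shows "tup s n \<in> C"
  using assms(3) by (induction n arbitrary: s) (auto intro: assms(1,2))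

section \<open>Closure requirements: pairing, transitivity, flips and witnesses\<close>

definition Qpair where "Qpair c d \<longleftrightarrow> (\<forall>a\<in>E c. \<forall>b\<in>E c. op a b \<in> E d)"

lemma req_Qpair: "req Qpair"
  unfolding req_def
proof (intro conjI)
  show "Def2 Qpair" unfolding Qpair_def by (intro Dintro)
  show "\<forall>c\<in>U. \<exists>d\<in>U. Qpair c d" unfolding Qpair_def using op_in_prd prd(1) by meson
  show "\<forall>c\<in>U. \<forall>d\<in>U. \<forall>d'\<in>U. Qpair c d \<and> E d \<subseteq> E d' \<longrightarrow> Qpair c d'" unfolding Qpair_def by blast
qed

lemma closed_pair:
  assumes t: "closed Qpair t" and ab: "a \<in> E (un t)" "b \<in> E (un t)" shows "op a b \<in> E (un t)"
proof -
  have tU: "t \<in> U" using t by (simp add: closed_def)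
  obtain y z where yz: "y \<in> E t" "a \<in> E y" "z \<in> E t" "b \<in> E z" using ab tU by auto
  then obtain w where "w \<in> E t" "a \<in> E w" "b \<in> E w" using t unfolding closed_def by blast
  then obtain w' where "w' \<in> E t" "op a b \<in> E w'" using t unfolding closed_def Qpair_def by blast
  then show ?thesis using tU by auto
qed

definition Qtrans where "Qtrans c d \<longleftrightarrow> (\<forall>z\<in>E c. E z \<subseteq> E d)"

lemma req_Qtrans: "req Qtrans"
  unfolding req_def
proof (intro conjI)
  show "Def2 Qtrans" unfolding Qtrans_def by (intro Dintro)
  show "\<forall>c\<in>U. \<exists>d\<in>U. Qtrans c d"
  proof
    fix c assume "c \<in> U"
    then have "un c \<in> U" "Qtrans c (un c)" by (auto simp: Qtrans_def)
    then show "\<exists>d\<in>U. Qtrans c d" by blast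
  qed
  show "\<forall>c\<in>U. \<forall>d\<in>U. \<forall>d'\<in>U. Qtrans c d \<and> E d \<subseteq> E d' \<longrightarrow> Qtrans c d'" unfolding Qtrans_def by blast
qed

definition Qflip where "Qflip c d \<longleftrightarrow> (\<forall>z\<in>E c. \<forall>p\<in>U. fl p z \<in> E d)"

text \<open>Only the flips at members of the transitive closure act nontrivially.\<close>

lemma req_Qflip: "req Qflip"
  unfolding req_def
proof (intro conjI)
  show "Def2 Qflip" unfolding Qflip_def by (intro Dintro)
  show "\<forall>c\<in>U. \<exists>d\<in>U. Qflip c d"
  proof
    fix c assume c: "c \<in> U"
    obtain T where T: "trans T" "E c \<subseteq> E T" using ex_trans c by blast
    have TU: "T \<in> U" using T by (simp add: trans_def)
    let ?F = "\<lambda>w. fl (p1 w) (p2 w)"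
    have "Tm (\<lambda>s. ?F (s 0))" by (intro Dintro)
    note im = image_mk[OF prd(1)[OF TU c] this]
    let ?d = "un (up c (mk (?F ` E (prd T c))))"
    have d: "?d \<in> U" "E ?d = E c \<union> ?F ` E (prd T c)" using im c by auto
    have "fl p z \<in> E ?d" if zp: "z \<in> E c" "p \<in> U" for z p
    proof (cases "p \<in> E T")
      case True
      then have "op p z \<in> E (prd T c)" using op_in_prd[OF TU c] zp by blast
      then have "?F (op p z) \<in> ?F ` E (prd T c)" by (rule imageI)
      moreover have "?F (op p z) = fl p z" using zp(2) E_U[OF zp(1)] by simp
      ultimately show ?thesis unfolding d(2) by (simp only: UnI2)
    next
      case False
      have "fl p z = z"
      proof (rule act_fix[OF perm_flip zp(2) T(1)])
        fix u assume u: "u \<in> E T"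
        show "flip p u = u"
        proof (cases "isp u")
          case True
          then obtain a b where ab: "a \<in> U" "b \<in> U" "u = op a b" by (rule ispE)
          then have "a \<noteq> p" using trans_pair[OF T(1)] u False by blast
          then show ?thesis using flip_op ab by simp
        qed simp
      qed (use T zp in blast)
      then show ?thesis unfolding d(2) using zp by simp
    qed
    then show "\<exists>d\<in>U. Qflip c d" unfolding Qflip_def using d(1) by blast
  qed
  show "\<forall>c\<in>U. \<forall>d\<in>U. \<forall>d'\<in>U. Qflip c d \<and> E d \<subseteq> E d' \<longrightarrow> Qflip c d'" unfolding Qflip_def by blast
qed

text \<open>The Tarski-Vaught condition for a universal quantifier, phrased with counterexamples;
  \<open>z\<close> codes the values of the remaining variables.\<close>

definition Qwit where
  "Qwit i p c d \<longleftrightarrow> (\<forall>z\<in>E c. (\<exists>a\<in>NN. \<not> sat N ((dec z)(i := a)) p) \<longrightarrow>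
     (\<exists>a\<in>E d. a \<in> NN \<and> \<not> sat N ((dec z)(i := a)) p))"

lemma Def_Qwit_sat: assumes "Tm f" "Tm g" shows "Def (\<lambda>e. sat N ((dec (f e))(i := g e)) p)"
proof -
  have "Def (\<lambda>e. sat N (\<lambda>k. (if k = i then g else (\<lambda>e. dec (f e) k)) e) p)"
    by (rule Def_sat_Tm) (simp add: Tm_dec assms)
  moreover have "(\<lambda>k. (if k = i then g else (\<lambda>e. dec (f e) k)) e) = (dec (f e))(i := g e)" for e by auto
  ultimately show ?thesis by (simp only:)
qed

lemma req_Qwit: "req (Qwit i p)"
  unfolding req_def
proof (intro conjI)
  show "Def (\<lambda>s. Qwit i p (s 0) (s 1))" unfolding Qwit_def by (intro Dintro Def_Qwit_sat)
  show "\<forall>c\<in>U. \<exists>d\<in>U. Qwit i p c d"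
  proof
    fix c assume c: "c \<in> U"
    define R where "R z a \<longleftrightarrow> ((\<exists>a\<in>NN. \<not> sat N ((dec z)(i := a)) p) \<longrightarrow>
      a \<in> NN \<and> \<not> sat N ((dec z)(i := a)) p)" for z a
    have "\<exists>d\<in>U. \<forall>z\<in>E c. \<exists>a\<in>E d. R z a"
    proof (rule collection[OF c])
      show "Def2 R" unfolding R_def by (intro Dintro Def_Qwit_sat)
      show "\<forall>z\<in>E c. \<exists>a\<in>U. R z a" unfolding R_def using NN_U emp(1) by blast
    qed
    then show "\<exists>d\<in>U. Qwit i p c d" unfolding R_def Qwit_def by blast
  qed
  show "\<forall>c\<in>U. \<forall>d\<in>U. \<forall>d'\<in>U. Qwit i p c d \<and> E d \<subseteq> E d' \<longrightarrow> Qwit i p c d'" unfolding Qwit_def by blast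
qed

definition reflects :: "('a \<Rightarrow> 'a \<Rightarrow> bool) \<Rightarrow> fm \<Rightarrow> bool" where
  "reflects Q \<phi> \<longleftrightarrow> (\<forall>t s. closed Q t \<and> closed Qpair t \<and> emp \<in> E (un t) \<and>
     (\<forall>i\<in>fv \<phi>. s i \<in> E (un t) \<inter> NN) \<longrightarrow> (sat N s \<phi> \<longleftrightarrow> sat_on N (E (un t) \<inter> NN) s \<phi>))"

text \<open>The Levy-Montague argument: requirements are accumulated along the formula and each
  quantifier adds \<open>Qwit\<close>. Closure under pairing puts the code of an assignment into
  some stage, whose successor stage holds the counterexample.\<close>

lemma ex_reflects: "\<exists>Q. req Q \<and> reflects Q \<phi>"
proof (induction \<phi>)
  case (NegF p)
  then show ?case by (simp add: reflects_def)
next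
  case (ConjF p q)
  then obtain P Q where P: "req P" "reflects P p" and Q: "req Q" "reflects Q q" by blast
  show ?case
  proof (rule exI[of _ "\<lambda>c d. P c d \<and> Q c d"], unfold reflects_def, intro conjI allI impI req_conj P(1) Q(1))
    fix t s assume A: "closed (\<lambda>c d. P c d \<and> Q c d) t \<and> closed Qpair t \<and> emp \<in> E (un t) \<and>
      (\<forall>i\<in>fv (ConjF p q). s i \<in> E (un t) \<inter> NN)"
    then have "closed P t" "closed Q t" using closed_conj[of P Q t] by blast+
    then have "sat N s p \<longleftrightarrow> sat_on N (E (un t) \<inter> NN) s p" "sat N s q \<longleftrightarrow> sat_on N (E (un t) \<inter> NN) s q"
      using A P(2) Q(2) unfolding reflects_def by (simp_all del: Int_iff)
    then show "sat N s (ConjF p q) \<longleftrightarrow> sat_on N (E (un t) \<inter> NN) s (ConjF p q)" by simp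
  qed
next
  case (AllF i p)
  then obtain P where P: "req P" "reflects P p" by blast
  show ?case
  proof (rule exI[of _ "\<lambda>c d. P c d \<and> Qwit i p c d"], unfold reflects_def, intro conjI allI impI req_conj P(1) req_Qwit)
    fix t s assume A: "closed (\<lambda>c d. P c d \<and> Qwit i p c d) t \<and> closed Qpair t \<and> emp \<in> E (un t) \<and>
      (\<forall>k\<in>fv (AllF i p). s k \<in> E (un t) \<inter> NN)"
    then have cl: "closed P t" "closed (Qwit i p) t" "closed Qpair t" "emp \<in> E (un t)"
      using closed_conj[of P "Qwit i p" t] by blast+
    have tU: "t \<in> U" using cl by (simp add: closed_def)
    let ?T = "E (un t) \<inter> NN"
    have sv: "s k \<in> ?T" if "k \<in> fv p" "k \<noteq> i" for k using A that by simp
    have IH: "sat N (s(i := a)) p \<longleftrightarrow> sat_on N ?T (s(i := a)) p" if "a \<in> ?T" for a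
      using P(2)[unfolded reflects_def, rule_format, of t "s(i := a)"] cl sv that by simp
    have "\<exists>a\<in>?T. \<not> sat N (s(i := a)) p" if b: "b \<in> NN" "\<not> sat N (s(i := b)) p" for b
    proof -
      \<comment> \<open>Places that are not free receive \<open>emp\<close>: it lies in
        \<open>un t\<close>, so the whole tuple does, and although it is no object of
        \<open>N\<close> the formula does not see it.\<close>
      define r where "r k = (if k \<in> fv p - {i} then s k else emp)" for k
      obtain n where n: "\<forall>k\<in>fv p. k < n" using finite_fv[of p] finite_nat_set_iff_bounded by blast
      have r: "r k \<in> E (un t)" for k using sv cl(4) by (simp add: r_def)
      have rU: "r k \<in> U" for k using r E_U by blast
      let ?z = "tup r n"
      have "?z \<in> E (un t)" by (rule tup_closed) (use closed_pair[OF cl(3)] cl(4) r in auto)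
      then obtain y where y: "y \<in> E t" "?z \<in> E y" using tU by auto
      then obtain y' where y': "y' \<in> E t" "Qwit i p y y'" using cl(2) unfolding closed_def by blast
      have same: "sat N ((dec ?z)(i := a)) p \<longleftrightarrow> sat N (s(i := a)) p" for a
        by (rule sat_on_fv) (use n dec_tup[of r, OF rU] in \<open>auto simp: r_def\<close>)
      then have "\<exists>a\<in>NN. \<not> sat N ((dec ?z)(i := a)) p" using b by blast
      then obtain a where "a \<in> E y'" "a \<in> NN" "\<not> sat N ((dec ?z)(i := a)) p"
        using y'(2) y(2) unfolding Qwit_def by blast
      then show ?thesis using y'(1) tU same by auto
    qed
    then have "(\<forall>a\<in>NN. sat N (s(i := a)) p) \<longleftrightarrow> (\<forall>a\<in>?T. sat N (s(i := a)) p)" by blast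
    also have "\<dots> \<longleftrightarrow> (\<forall>a\<in>?T. sat_on N ?T (s(i := a)) p)" using IH by blast
    finally show "sat N s (AllF i p) \<longleftrightarrow> sat_on N ?T s (AllF i p)" by simp
  qed
\<comment> \<open>Atomic formulas reflect trivially; \<open>Qtrans\<close> is simply a requirement
  at hand.\<close>
qed (use req_Qtrans in \<open>auto simp: reflects_def\<close>)

text \<open>\<open>Qtrans\<close> makes the union transitive, \<open>Qflip\<close> makes its part in
  \<open>NN\<close> invariant under every flip. This part is therefore a set of \<open>N\<close>
  with empty support, to which \<open>ex_reflects\<close> applies.\<close>

lemma RP_N: "RP N"
  unfolding RP_def
proof (intro allI impI)
  fix \<phi> x assume x: "is_set N x"
  have xU: "x \<in> U" using x set_NN NN_U by blast
  obtain Q where Q: "req Q" "reflects Q \<phi>" using ex_reflects by blast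
  let ?Q = "\<lambda>c d. (Q c d \<and> Qpair c d) \<and> (Qtrans c d \<and> Qflip c d)"
  have "req ?Q" by (intro req_conj Q(1) req_Qpair req_Qtrans req_Qflip)
  from ex_closed[OF this xU] obtain t where t: "closed ?Q t" "x \<in> E t" by blast
  have "closed (\<lambda>c d. Q c d \<and> Qpair c d) t" "closed (\<lambda>c d. Qtrans c d \<and> Qflip c d) t"
    using closed_conj[OF t(1)] by blast+
  then have cl: "closed Q t" "closed Qpair t" "closed Qtrans t" "closed Qflip t"
    using closed_conj[of Q Qpair t] closed_conj[of Qtrans Qflip t] by blast+
  have tU: "t \<in> U" using t by (simp add: closed_def)
  have xt: "E x \<subseteq> E (un t)" using t(2) tU by auto
  \<comment> \<open>The marker of the set \<open>x\<close> supplies the filler value that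
    \<open>reflects\<close> expects in the union.\<close>
  have et: "emp \<in> E (un t)" using xt x by (auto simp: setN)
  let ?C = "E (un t) \<inter> NN"
  have "S {z \<in> E (un t). z \<in> NN}" by (intro S_sep Dintro) (use tU in simp)
  moreover have "{z \<in> E (un t). z \<in> NN} = ?C" by blast
  ultimately have SC: "S ?C" by simp
  have fC: "fl p y \<in> ?C" if p: "p \<in> U" and y: "y \<in> ?C" for p y
  proof -
    obtain z where z: "z \<in> E t" "y \<in> E z" using y tU by auto
    then obtain z' where "z' \<in> E t" "fl p y \<in> E z'" using cl(4) p unfolding closed_def Qflip_def by blast
    then show ?thesis using tU y NN_fl[OF p] by auto
  qed
  have "nset ?C" by (rule nsetI(1)[OF SC _ emp(1) fn_emp]) (use fC in auto)
  then obtain T where T: "is_set N T" "EN T = ?C" by (auto simp: nset_def)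
  have "trans_set N T" unfolding trans_set_def
  proof (intro conjI ballI subsetI)
    fix y z assume y: "y \<in> EN T" and z: "z \<in> EN y"
    then obtain w where w: "w \<in> E t" "y \<in> E w" using T tU by auto
    obtain w' where w': "w' \<in> E t" "Qtrans w w'" using cl(3) w(1) by (auto simp: closed_def)
    then have "E y \<subseteq> E w'" using w(2) by (simp add: Qtrans_def)
    then have "z \<in> E (un t)" using z w'(1) tU by (auto simp: EN_iff)
    then show "z \<in> EN T" using z T(2) EN_NN by blast
  qed (use T in simp)
  moreover have "EN x \<subseteq> EN T" using xt T(2) by (auto simp: EN_iff)
  moreover have "sat N s \<phi> \<longleftrightarrow> sat_on N (EN T) s \<phi>" if "\<forall>i\<in>fv \<phi>. s i \<in> EN T" for s
    using Q(2)[unfolded reflects_def, rule_format, of t s] cl et that T(2) by simp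
  ultimately show "\<exists>t. trans_set N t \<and> EN x \<subseteq> EN t \<and>
      (\<forall>s. (\<forall>i\<in>fv \<phi>. s i \<in> EN t) \<longrightarrow> (sat N s \<phi> \<longleftrightarrow> sat_on N (EN t) s \<phi>))" by blast
qed

end

theorem theorem10:
  fixes M :: "'a ustruct" and \<kappa> :: 'a
  assumes "ZFC M" and "infinite_cardinal M \<kappa>"
  shows "\<exists>(N :: 'a ustruct) j.
    transitive_embedding M N j \<and> infinite_cardinal N (j \<kappa>) \<and>
    ZFU_R N \<and> RP N \<and> DC_scheme N (j \<kappa>) \<and>
    \<not> Hume_holds_for_sets N \<and>
    (\<forall>F. param_definable N F \<longrightarrow> \<not> fulfills_Hume N F)"
proof -
  interpret symmetric_model M \<kappa>
    by unfold_locales (use assms in auto)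
  show ?thesis
    using embedding infinite_cardinal_j N_ZFU RP_N DC_N no_Hume
    unfolding Hume_holds_for_sets_def by blast
qed

end
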